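(* Let $n$ and $d$ be positive integers. Suppose $\sigma = \sigma_1 \cdots \sigma_p \in S_d$ is a product of $p$ disjoint cycles (where cycles of length one are counted), and let $\chi_\lambda$ denote the character of the irreducible representation $H_\lambda$ of $S_d$. Then the vector $(\chi_\lambda(\sigma))_{|\lambda| = d}$ is an eigenvector for the matrix $A^n_d$ with eigenvalue $n^p$.
   Context: For a partition $\lambda$ of $d$, $H_\lambda$ denotes the corresponding irreducible representation of the symmetric group $S_d$ over an algebraically closed field $\mathbb{F}$ of characteristic $0$. For partitions $\lambda, \beta_1, \dots, \beta_n$, the generalized Littlewood--Richardson coefficient $c^\lambda_{\beta_1,\dots,\beta_n}$ is the coefficient of the Schur function $s_\lambda$ in the product $s_{\beta_1} \cdots s_{\beta_n}$; equivalently, for $n \ge 2$, $c^{\lambda}_{\beta_1, \dots, \beta_n} = \sum_{\alpha_1, \dots, \alpha_{n-2}} c^{\lambda}_{\alpha_1, \beta_1}c^{\alpha_1}_{\alpha_2, \beta_2} \cdots c^{\alpha_{n-3}}_{\alpha_{n-2},\beta_{n-2}}c^{\alpha_{n-2}}_{\beta_{n-1}, \beta_n}$ in terms of ordinary Littlewood--Richardson coefficients. For partitions $\lambda,\mu$ of $d$, put $a^n_{\lambda,\mu} = \sum_{\beta_1,\dots,\beta_n} c^\lambda_{\beta_1,\dots,\beta_n} c^\mu_{\beta_1,\dots,\beta_n}$, the sum being over all $n$-tuples of partitions. (Equivalently, $a^n_{\lambda,\mu}$ is, for $k \gg 0$, the multiplicity of the irreducible $\mathfrak{gl}(k)$-module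 of highest weight $\mu$ in the restriction, along $M \mapsto \operatorname{diag}(M,\dots,M)$, of the irreducible $\mathfrak{gl}(nk)$-module of highest weight $\lambda$.) The matrix $A^n_d = (a^n_{\lambda,\mu})$ has rows and columns indexed by the partitions of $d$ in reverse lexicographical order, and vectors indexed by partitions of $d$ use the same order. *)

theory Defs
  imports
    "HOL-Library.Multiset"
    "HOL-Library.FuncSet"
    "HOL-Library.Function_Algebras"
    "HOL-Library.List_Lexorder"
    "HOL-Combinatorics.Permutations"
    "HOL-Combinatorics.Cycles"
    "HOL-Algebra.Sym_Groups"
    "HOL-Computational_Algebra.Polynomial"
    "Jordan_Normal_Form.Char_Poly"
begin

section \<open>Functions with values in a ring, as a module\<close>

text \<open>Both formal power series and group algebra elements are encoded as functions into the
  coefficient ring. Their products are convolutions, defined below; the pointwise product of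
  \<^theory>\<open>HOL-Library.Function_Algebras\<close> is not used.\<close>

definition fscale :: "'a::comm_ring_1 \<Rightarrow> ('b \<Rightarrow> 'a) \<Rightarrow> 'b \<Rightarrow> 'a" where
  "fscale c f = (\<lambda>x. c * f x)"

global_interpretation fmod: Modules.module "fscale :: 'a::comm_ring_1 \<Rightarrow> ('b \<Rightarrow> 'a) \<Rightarrow> 'b \<Rightarrow> 'a"
  by standard (auto simp: fscale_def fun_eq_iff algebra_simps)

text \<open>The trace of a linear endomorphism \<open>T\<close> of a finite-dimensional subspace \<open>W\<close>: the sum of the
  diagonal entries of its matrix in some basis of \<open>W\<close>.\<close>

definition trace_on :: "('b \<Rightarrow> 'a::field) set \<Rightarrow> (('b \<Rightarrow> 'a) \<Rightarrow> ('b \<Rightarrow> 'a)) \<Rightarrow> 'a" where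
  "trace_on W T =
     (let B = (SOME B. fmod.independent B \<and> fmod.span B = W)
      in \<Sum>b\<in>B. fmod.representation B (T b) b)"


section \<open>Partitions\<close>

definition is_partition :: "nat list \<Rightarrow> bool" where
  "is_partition \<alpha> \<longleftrightarrow> sorted_wrt (\<ge>) \<alpha> \<and> 0 \<notin> set \<alpha>"

definition partitions_of :: "nat \<Rightarrow> nat list set" where
  "partitions_of d = {\<alpha>. is_partition \<alpha> \<and> sum_list \<alpha> = d}"

text \<open>Reverse lexicographical order, from \<open>[d]\<close> down to \<open>[1, \<dots>, 1]\<close>.\<close>

definition partitions_list :: "nat \<Rightarrow> nat list list" where
  "partitions_list d = rev (sorted_list_of_set (partitions_of d))"

text \<open>Cells of the Young diagram are pairs (row, column), both counted from 0.\<close>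

definition young_diagram :: "nat list \<Rightarrow> (nat \<times> nat) set" where
  "young_diagram \<alpha> = {(i, j). i < length \<alpha> \<and> j < \<alpha> ! i}"


section \<open>Schur functions and Littlewood--Richardson coefficients\<close>

text \<open>A formal power series over the integers in the variables \<open>x\<^sub>0, x\<^sub>1, \<dots>\<close> is given by its
  coefficients; the multiset \<open>M\<close> stands for the monomial \<open>\<Prod>i\<in>#M. x\<^sub>i\<close>.\<close>

type_synonym power_series = "nat multiset \<Rightarrow> int"

definition ps_one :: power_series where
  "ps_one M = (if M = {#} then 1 else 0)"

definition ps_mult :: "power_series \<Rightarrow> power_series \<Rightarrow> power_series" where
  "ps_mult f g M = (\<Sum>A | A \<subseteq># M. f A * g (M - A))"

definition semistandard_tableaux :: "nat list \<Rightarrow> (nat \<times> nat \<Rightarrow> nat) set" where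
  "semistandard_tableaux \<alpha> =
     {T \<in> young_diagram \<alpha> \<rightarrow>\<^sub>E UNIV.
        (\<forall>i j j'. j < j' \<longrightarrow> (i, j') \<in> young_diagram \<alpha> \<longrightarrow> T (i, j) \<le> T (i, j')) \<and>
        (\<forall>i i' j. i < i' \<longrightarrow> (i', j) \<in> young_diagram \<alpha> \<longrightarrow> T (i, j) < T (i', j))}"

definition schur :: "nat list \<Rightarrow> power_series" where
  "schur \<alpha> M =
     int (card {T \<in> semistandard_tableaux \<alpha>. image_mset T (mset_set (young_diagram \<alpha>)) = M})"

definition schur_product :: "nat list list \<Rightarrow> power_series" where
  "schur_product \<beta>s = foldr ps_mult (map schur \<beta>s) ps_one"

text \<open>\<open>lr_coeff \<alpha> [\<beta>\<^sub>1, \<dots>, \<beta>\<^sub>n]\<close> is the coefficient of \<open>s\<^sub>\<alpha>\<close> in the expansion of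
  \<open>s\<^bsub>\<beta>\<^sub>1\<^esub> \<cdots> s\<^bsub>\<beta>\<^sub>n\<^esub>\<close> in the basis of Schur functions.\<close>

definition lr_coeff :: "nat list \<Rightarrow> nat list list \<Rightarrow> int" where
  "lr_coeff \<alpha> \<beta>s =
     fmod.representation (schur ` Collect is_partition) (schur_product \<beta>s) (schur \<alpha>)"

text \<open>The sum over all \<open>n\<close>-tuples of partitions has only finitely many nonzero terms; it is
  restricted to those, because \<^const>\<open>sum\<close> vanishes on infinite index sets.\<close>

definition a_coeff :: "nat \<Rightarrow> nat list \<Rightarrow> nat list \<Rightarrow> int" where
  "a_coeff n \<alpha> \<mu> =
     (\<Sum>\<beta>s | length \<beta>s = n \<and> (\<forall>\<beta>\<in>set \<beta>s. is_partition \<beta>) \<and> lr_coeff \<alpha> \<beta>s * lr_coeff \<mu> \<beta>s \<noteq> 0.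
        lr_coeff \<alpha> \<beta>s * lr_coeff \<mu> \<beta>s)"

definition A_matrix :: "nat \<Rightarrow> nat \<Rightarrow> int mat" where
  "A_matrix n d =
     (let ps = partitions_list d
      in mat (length ps) (length ps) (\<lambda>(i, j). a_coeff n (ps ! i) (ps ! j)))"


section \<open>The irreducible representations of the symmetric group\<close>

text \<open>The group algebra of \<open>S\<^sub>d\<close> consists of the functions vanishing outside \<open>S\<^sub>d\<close>.\<close>

definition group_algebra :: "nat \<Rightarrow> ((nat \<Rightarrow> nat) \<Rightarrow> 'a::field) set" where
  "group_algebra d = {f. \<forall>g. g \<notin> carrier (sym_group d) \<longrightarrow> f g = 0}"

definition ga_mult ::
  "nat \<Rightarrow> ((nat \<Rightarrow> nat) \<Rightarrow> 'a::field) \<Rightarrow> ((nat \<Rightarrow> nat) \<Rightarrow> 'a) \<Rightarrow> (nat \<Rightarrow> nat) \<Rightarrow> 'a" where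
  "ga_mult d f g x =
     (\<Sum>(y, z) | y \<in> carrier (sym_group d) \<and> z \<in> carrier (sym_group d) \<and> y \<circ> z = x. f y * g z)"

definition ga_of :: "(nat \<Rightarrow> nat) \<Rightarrow> (nat \<Rightarrow> nat) \<Rightarrow> 'a::field" where
  "ga_of \<sigma> = (\<lambda>x. if x = \<sigma> then 1 else 0)"

text \<open>The canonical tableau: the cells are numbered from 1 to \<open>d\<close>, row by row.\<close>

definition canonical_tableau :: "nat list \<Rightarrow> nat \<times> nat \<Rightarrow> nat" where
  "canonical_tableau \<alpha> = (\<lambda>(i, j). sum_list (take i \<alpha>) + j + 1)"

definition row_entries :: "nat list \<Rightarrow> nat \<Rightarrow> nat set" where
  "row_entries \<alpha> i = {canonical_tableau \<alpha> (i, j) | j. (i, j) \<in> young_diagram \<alpha>}"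

definition col_entries :: "nat list \<Rightarrow> nat \<Rightarrow> nat set" where
  "col_entries \<alpha> j = {canonical_tableau \<alpha> (i, j) | i. (i, j) \<in> young_diagram \<alpha>}"

definition row_group :: "nat list \<Rightarrow> (nat \<Rightarrow> nat) set" where
  "row_group \<alpha> = {g \<in> carrier (sym_group (sum_list \<alpha>)). \<forall>i. g ` row_entries \<alpha> i = row_entries \<alpha> i}"

definition col_group :: "nat list \<Rightarrow> (nat \<Rightarrow> nat) set" where
  "col_group \<alpha> = {g \<in> carrier (sym_group (sum_list \<alpha>)). \<forall>j. g ` col_entries \<alpha> j = col_entries \<alpha> j}"

definition row_symmetrizer :: "nat list \<Rightarrow> (nat \<Rightarrow> nat) \<Rightarrow> 'a::field" where
  "row_symmetrizer \<alpha> = (\<lambda>g. if g \<in> row_group \<alpha> then 1 else 0)"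

definition col_antisymmetrizer :: "nat list \<Rightarrow> (nat \<Rightarrow> nat) \<Rightarrow> 'a::field" where
  "col_antisymmetrizer \<alpha> = (\<lambda>g. if g \<in> col_group \<alpha> then of_int (sign g) else 0)"

definition young_symmetrizer :: "nat list \<Rightarrow> (nat \<Rightarrow> nat) \<Rightarrow> 'a::field" where
  "young_symmetrizer \<alpha> = ga_mult (sum_list \<alpha>) (row_symmetrizer \<alpha>) (col_antisymmetrizer \<alpha>)"

text \<open>The irreducible representation \<open>H\<^sub>\<alpha>\<close> is the Specht module, realized as the left ideal of
  the group algebra generated by the Young symmetrizer, with \<open>S\<^sub>d\<close> acting by left multiplication.
  In this convention \<open>H\<^bsub>[d]\<^esub>\<close> is the trivial and \<open>H\<^bsub>[1, \<dots>, 1]\<^esub>\<close> the sign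
  representation.\<close>

definition irrep :: "nat list \<Rightarrow> ((nat \<Rightarrow> nat) \<Rightarrow> 'a::field) set" where
  "irrep \<alpha> = {ga_mult (sum_list \<alpha>) x (young_symmetrizer \<alpha>) | x. x \<in> group_algebra (sum_list \<alpha>)}"

definition irrep_character :: "nat list \<Rightarrow> (nat \<Rightarrow> nat) \<Rightarrow> 'a::field" where
  "irrep_character \<alpha> \<sigma> = trace_on (irrep \<alpha>) (ga_mult (sum_list \<alpha>) (ga_of \<sigma>))"

definition character_vec :: "nat \<Rightarrow> (nat \<Rightarrow> nat) \<Rightarrow> 'a::field vec" where
  "character_vec d \<sigma> =
     (let ps = partitions_list d in vec (length ps) (\<lambda>i. irrep_character (ps ! i) \<sigma>))"

end

theory Submission
  imports Defs
begin

text \<open>Let \<open>p\<^sub>\<sigma>\<close> be the power sum symmetric function of the cycle type of \<open>\<sigma>\<close>; its coefficient at a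
  monomial is the number of \<open>\<sigma>\<close>-invariant colourings of \<open>{1..d}\<close> with that content. Frobenius'
  formula says \<open>p\<^sub>\<sigma> = \<Sum>\<^sub>\<alpha> \<chi>\<^sub>\<alpha>(\<sigma>) s\<^sub>\<alpha>\<close>. Replacing every variable by \<open>n\<close> copies of itself multiplies
  \<open>p\<^sub>\<sigma>\<close> by \<open>n\<close> to the number of cycles, and by Cauchy's identity it maps \<open>s\<^sub>\<alpha>\<close> to
  \<open>\<Sum>\<^sub>\<mu> a\<^sub>\<alpha>\<^sub>\<mu> s\<^sub>\<mu>\<close>; comparing coefficients gives the eigenvector equation.

  Cauchy's identity comes from a local rule for horizontal strips. For Frobenius' formula, the
  permutation characters on colourings have Gram matrix \<open>K\<^sup>T K\<close> with \<open>K\<close> the Kostka matrix, again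
  by Cauchy's identity. The characters of the Young symmetrizers are orthonormal, and the
  inner products with the permutation characters are unitriangular. As unitriangular
  factorisations are unique, these inner products are the Kostka numbers.\<close>

section \<open>Tableaux and horizontal strips\<close>

text \<open>Why coefficients may be compared: the Kostka matrix is unitriangular for the dominance
  order, so a combination of Schur functions is determined by its values at the contents
  \<open>row_content \<beta>\<close>. Even the symmetry of Schur functions comes from this: the
  Cauchy kernel counts nonnegative integer matrices with given margins, which relabelling the rows
  does not affect, so its coefficients with respect to the Schur functions of the other alphabet are
  unaffected too. Why repeated variables produce the matrix: \<open>a_coeff n\<close> is a
  Littlewood-Richardson matrix times its transpose, so its generating function in two alphabets is
  the n-th power of the Cauchy kernel; and this power is the kernel itself with each variable of one
  alphabet repeated n times. Why the characters are accessible: a Young symmetrizer \<open>c\<close>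
  satisfies \<open>c c = k c\<close> with \<open>k\<close> nonzero, so right multiplication by
  \<open>c / k\<close> projects onto the Specht module, and a trace becomes a sum of
  \<open>c\<close> over conjugates divided by \<open>k\<close>. The inner products of such sums
  reduce to traces of maps \<open>z\<close> to \<open>u z v\<close>, which either vanish or are
  products evaluated at the identity.\<close>

definition shapes :: "(nat \<Rightarrow> nat) set" where
  "shapes = {f. antimono f \<and> (\<exists>L. \<forall>i\<ge>L. f i = 0)}"

definition diagram :: "(nat \<Rightarrow> nat) \<Rightarrow> (nat \<times> nat) set" where
  "diagram f = {(i, j). j < f i}"

definition shape_size :: "(nat \<Rightarrow> nat) \<Rightarrow> nat" where
  "shape_size f = card (diagram f)"

text \<open>Interlacing form of the condition that each column gains at most one cell. Padding
  shapes with infinitely many zero rows avoids case distinctions on their lengths.\<close>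

definition hstrip :: "(nat \<Rightarrow> nat) \<Rightarrow> (nat \<Rightarrow> nat) \<Rightarrow> bool" where
  "hstrip g f \<longleftrightarrow> (\<forall>i. f (Suc i) \<le> g i \<and> g i \<le> f i)"

definition ssyt :: "(nat \<Rightarrow> nat) \<Rightarrow> (nat \<times> nat \<Rightarrow> nat) set" where
  "ssyt f =
     {T \<in> diagram f \<rightarrow>\<^sub>E UNIV.
        (\<forall>i j j'. j < j' \<longrightarrow> (i, j') \<in> diagram f \<longrightarrow> T (i, j) \<le> T (i, j')) \<and>
        (\<forall>i i' j. i < i' \<longrightarrow> (i', j) \<in> diagram f \<longrightarrow> T (i, j) < T (i', j))}"

definition kostka :: "(nat \<Rightarrow> nat) \<Rightarrow> nat multiset \<Rightarrow> nat" where
  "kostka f M = card {T \<in> ssyt f. image_mset T (mset_set (diagram f)) = M}"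

lemma shapes_antimono: "f \<in> shapes \<Longrightarrow> i \<le> j \<Longrightarrow> f j \<le> f i"
  by (auto simp: shapes_def antimono_def)

lemma shapesE:
  assumes "f \<in> shapes"
  obtains L where "\<And>i. i \<ge> L \<Longrightarrow> f i = 0"
  using assms by (auto simp: shapes_def)

lemma shapesI:
  assumes "\<And>i. f (Suc i) \<le> f i" "\<And>i. i \<ge> L \<Longrightarrow> f i = 0"
  shows "f \<in> shapes"
  using assms by (auto simp: shapes_def decseq_SucI)

lemma diagram_eq_Sigma:
  assumes "\<And>i. i \<ge> L \<Longrightarrow> f i = 0"
  shows "diagram f = Sigma {..<L} (\<lambda>i. {..<f i})"
  using assms unfolding diagram_def
  by auto (metis gr_implies_not_zero not_less)

lemma finite_diagram: "f \<in> shapes \<Longrightarrow> finite (diagram f)"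
  by (metis diagram_eq_Sigma shapesE finite_SigmaI finite_lessThan)

lemma shape_size_eq_sum:
  assumes "\<And>i. i \<ge> L \<Longrightarrow> f i = 0"
  shows "shape_size f = (\<Sum>i<L. f i)"
proof -
  have "diagram f = Sigma {..<L} (\<lambda>i. {..<f i})" by (rule diagram_eq_Sigma[OF assms])
  then show ?thesis by (simp add: shape_size_def card_SigmaI)
qed

lemma shape_le_size:
  assumes "f \<in> shapes"
  shows "f i \<le> shape_size f"
proof -
  have "Pair i ` {..<f i} \<subseteq> diagram f" by (auto simp: diagram_def)
  from card_mono[OF finite_diagram[OF assms] this] show ?thesis
    by (simp add: card_image inj_on_def shape_size_def)
qed

lemma shape_zero_ge_size:
  assumes "f \<in> shapes" "i \<ge> shape_size f"
  shows "f i = 0"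
proof (rule ccontr)
  assume "f i \<noteq> 0"
  then have "f k \<noteq> 0" if "k \<le> i" for k
    using shapes_antimono[OF assms(1) that] by simp
  then have "(\<lambda>k. (k, 0::nat)) ` {..i} \<subseteq> diagram f" by (auto simp: diagram_def)
  from card_mono[OF finite_diagram[OF assms(1)] this] show False
    using assms(2) by (simp add: card_image inj_on_def shape_size_def)
qed

lemma finite_shapes_size_le: "finite {f \<in> shapes. shape_size f \<le> n}"
proof -
  have "{f \<in> shapes. shape_size f \<le> n} \<subseteq>
      {f. \<forall>i. (i \<in> {..<n} \<longrightarrow> f i \<in> {..n}) \<and> (i \<notin> {..<n} \<longrightarrow> f i = 0)}"
    by (auto intro: order_trans[OF shape_le_size] shape_zero_ge_size)
  then show ?thesis
    by (rule finite_subset) (intro finite_set_of_finite_funs finite_lessThan finite_atMost)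
qed

lemma finite_shapes_size: "finite {f \<in> shapes. shape_size f = n}"
  by (rule finite_subset[OF _ finite_shapes_size_le[of n]]) auto

section \<open>Horizontal strips and their local rule\<close>

lemma hstrip_size_le: "hstrip g f \<Longrightarrow> f \<in> shapes \<Longrightarrow> shape_size g \<le> shape_size f"
  unfolding shape_size_def
  by (rule card_mono[OF finite_diagram]) (auto simp: diagram_def hstrip_def intro: less_le_trans)

lemma hstrip_lower_in_shapes:
  assumes "hstrip g f" "f \<in> shapes"
  shows "g \<in> shapes"
proof -
  obtain L where L: "\<And>i. i \<ge> L \<Longrightarrow> f i = 0" using assms(2) by (rule shapesE) blast
  show ?thesis
  proof (rule shapesI)
    show "g (Suc i) \<le> g i" for i
      using assms(1) by (metis hstrip_def order_trans)
    show "g i = 0" if "i \<ge> L" for i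
      using assms(1) L[OF that] by (metis hstrip_def le_zero_eq)
  qed
qed

lemma hstrip_upper_in_shapes:
  assumes "hstrip g f" "g \<in> shapes"
  shows "f \<in> shapes"
proof -
  obtain L where L: "\<And>i. i \<ge> L \<Longrightarrow> g i = 0" using assms(2) by (rule shapesE) blast
  show ?thesis
  proof (rule shapesI)
    show "f (Suc i) \<le> f i" for i
      using assms(1) by (metis hstrip_def order_trans)
    \<comment> \<open>A horizontal strip may open one new row, hence the shift by one.\<close>
    show "f i = 0" if "i \<ge> Suc L" for i
      using assms(1) L[of "i - 1"] that by (metis Suc_le_D Suc_le_mono diff_Suc_1 hstrip_def le_zero_eq)
  qed
qed

text \<open>Size bookkeeping for the reflection in the local rule: row \<open>i\<close> of
  \<open>r\<close> and row \<open>Suc i\<close> of \<open>v\<close> are mirror images in one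
  interval. Summing over the rows and using max + min = sum leaves over only the first row of
  \<open>v\<close>, which has no partner.\<close>

lemma hstrip_square_size:
  fixes l m r v :: "nat \<Rightarrow> nat"
  assumes "l \<in> shapes" "m \<in> shapes"
    and rv: "\<And>i. r i + v (Suc i) = max (l (Suc i)) (m (Suc i)) + min (l i) (m i)"
  shows "shape_size r + shape_size v + max (l 0) (m 0) = shape_size l + shape_size m + v 0"
proof -
  obtain L1 where L1: "\<And>i. i \<ge> L1 \<Longrightarrow> l i = 0" using assms(1) by (rule shapesE) blast
  obtain L2 where L2: "\<And>i. i \<ge> L2 \<Longrightarrow> m i = 0" using assms(2) by (rule shapesE) blast
  define L where "L = max L1 L2"
  have l0: "l i = 0" and m0: "m i = 0" if "i \<ge> L" for i using that L1 L2 by (auto simp: L_def)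
  have r0: "r i = 0" and v0: "v (Suc i) = 0" if "i \<ge> L" for i
    using rv[of i] l0[of i] m0[of i] l0[of "Suc i"] m0[of "Suc i"] that by simp_all
  have v0': "v i = 0" if "i \<ge> Suc L" for i
    using v0[of "i - 1"] that by (cases i) auto
  have "shape_size v = v 0 + (\<Sum>i<L. v (Suc i))"
    using shape_size_eq_sum[of "Suc L" v, OF v0'] by (simp add: sum.lessThan_Suc_shift del: sum.lessThan_Suc)
  moreover have "shape_size r = (\<Sum>i<L. r i)" by (rule shape_size_eq_sum[OF r0])
  moreover have "(\<Sum>i<L. r i) + (\<Sum>i<L. v (Suc i)) =
      (\<Sum>i<L. max (l (Suc i)) (m (Suc i))) + (\<Sum>i<L. min (l i) (m i))"
    by (simp add: sum.distrib[symmetric] rv)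
  moreover have "max (l 0) (m 0) + (\<Sum>i<L. max (l (Suc i)) (m (Suc i))) = (\<Sum>i<Suc L. max (l i) (m i))"
    by (simp add: sum.lessThan_Suc_shift del: sum.lessThan_Suc)
  moreover have "(\<Sum>i<Suc L. max (l i) (m i)) = (\<Sum>i<L. max (l i) (m i))"
    by (simp add: l0 m0)
  moreover have "(\<Sum>i<L. max (l i) (m i)) + (\<Sum>i<L. min (l i) (m i)) = (\<Sum>i<L. l i) + (\<Sum>i<L. m i)"
    by (simp add: sum.distrib[symmetric] max_def min_def) (rule sum.cong, auto)
  moreover have "shape_size l = (\<Sum>i<L. l i)" "shape_size m = (\<Sum>i<L. m i)"
    by (rule shape_size_eq_sum, simp add: l0 m0)+
  ultimately show ?thesis by linarith
qed

text \<open>The local rule behind Pieri's formula and Cauchy's identity: the rows of the upper shape and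
  those of the lower shape range over the same intervals, shifted by one row, and are matched by
  reflecting these intervals. The first row of the upper shape is unbounded.\<close>

lemma card_hstrip_square:
  assumes l: "l \<in> shapes" and m: "m \<in> shapes"
  shows "card {v. hstrip l v \<and> hstrip m v \<and> shape_size v = n} =
         card {r. hstrip r l \<and> hstrip r m \<and> shape_size l + shape_size m \<le> n + shape_size r}"
    (is "card ?V = card ?R")
proof -
  define mx where "mx i = max (l i) (m i)" for i
  define mn where "mn i = min (l i) (m i)" for i
  define F where "F v i = mx (Suc i) + mn i - v (Suc i)" for v :: "nat \<Rightarrow> nat" and i
  \<comment> \<open>The inverse of \<open>F\<close>. Its first row takes up what the prescribed size
    \<open>n\<close> still requires; the inequality in \<open>?R\<close> makes this truncated
    subtraction exact.\<close>
  define H where "H r i = (case i of 0 \<Rightarrow> mx 0 + (n + shape_size r - (shape_size l + shape_size m))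
      | Suc k \<Rightarrow> mx (Suc k) + mn k - r k)" for r :: "nat \<Rightarrow> nat" and i
  have up: "hstrip l v \<and> hstrip m v \<longleftrightarrow> (\<forall>i. mx i \<le> v i \<and> v (Suc i) \<le> mn i)" for v
    by (auto simp: hstrip_def mx_def mn_def)
  have down: "hstrip r l \<and> hstrip r m \<longleftrightarrow> (\<forall>i. mx (Suc i) \<le> r i \<and> r i \<le> mn i)" for r
    by (auto simp: hstrip_def mx_def mn_def)
  have mxmn: "mx (Suc i) \<le> mn i" if "hstrip r l \<and> hstrip r m \<or> hstrip l v \<and> hstrip m v" for i r v
    using that unfolding up down by (meson order_trans)
  have size: "shape_size r + shape_size v + mx 0 = shape_size l + shape_size m + v 0"
    if "\<And>i. r i + v (Suc i) = mx (Suc i) + mn i" for r v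
    using hstrip_square_size[OF l m, of r v] that by (simp add: mx_def mn_def)
  have "bij_betw F ?V ?R"
  proof (rule bij_betw_byWitness[where f' = H])
    show "\<forall>v\<in>?V. H (F v) = v"
    proof
      fix v assume "v \<in> ?V"
      then have v: "\<And>i. mx i \<le> v i" "\<And>i. v (Suc i) \<le> mn i" "shape_size v = n" using up by auto
      have "F v i + v (Suc i) = mx (Suc i) + mn i" for i
        using v(2)[of i] by (simp add: F_def)
      then have s: "shape_size (F v) + n + mx 0 = shape_size l + shape_size m + v 0"
        using size[of "F v" v] v(3) by simp
      show "H (F v) = v"
      proof
        fix i show "H (F v) i = v i"
          using s v(1)[of 0] v(2)[of "i - 1"] v(1)[of i] by (cases i) (auto simp: H_def F_def)
      qed
    qed
    show "\<forall>r\<in>?R. F (H r) = r"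
    proof
      fix r assume "r \<in> ?R"
      then have r: "\<And>i. mx (Suc i) \<le> r i" "\<And>i. r i \<le> mn i" using down by auto
      show "F (H r) = r"
      proof
        fix i show "F (H r) i = r i" using r[of i] by (simp add: F_def H_def)
      qed
    qed
    show "F ` ?V \<subseteq> ?R"
    proof
      fix r assume "r \<in> F ` ?V"
      then obtain v where rv: "r = F v" and "v \<in> ?V" by blast
      then have v: "\<And>i. mx i \<le> v i" "\<And>i. v (Suc i) \<le> mn i" "shape_size v = n" using up by auto
      have "F v i + v (Suc i) = mx (Suc i) + mn i" for i
        using v(2)[of i] by (simp add: F_def)
      then have s: "shape_size (F v) + n + mx 0 = shape_size l + shape_size m + v 0"
        using size[of "F v" v] v(3) by simp
      have "mx (Suc i) \<le> r i \<and> r i \<le> mn i" for i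
        using v(1)[of "Suc i"] v(2)[of i] unfolding F_def rv by linarith
      then show "r \<in> ?R" using s v(1)[of 0] down[of r] rv by simp
    qed
    show "H ` ?R \<subseteq> ?V"
    proof
      fix v assume "v \<in> H ` ?R"
      then obtain r where rv: "v = H r" and rR: "r \<in> ?R" by blast
      then have r: "\<And>i. mx (Suc i) \<le> r i" "\<And>i. r i \<le> mn i" using down by auto
      have "r i + v (Suc i) = mx (Suc i) + mn i" for i
        using r[of i] by (simp add: H_def rv)
      then have s: "shape_size r + shape_size v + mx 0 = shape_size l + shape_size m + v 0"
        using size[of r v] by simp
      have "mx i \<le> v i" for i using r[of "i - 1"] by (cases i) (auto simp: H_def rv)
      moreover have "v (Suc i) \<le> mn i" for i using r[of i] by (auto simp: H_def rv)
      moreover have "shape_size v = n" using s rR by (simp add: rv) (simp add: H_def)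
      ultimately show "v \<in> ?V" using up[of v] by blast
    qed
  qed
  then show ?thesis by (rule bij_betw_same_card)
qed

section \<open>Kostka numbers and the branching rule\<close>

lemma filter_mset_add_replicate: "k \<notin># N \<Longrightarrow> filter_mset (\<lambda>x. x \<noteq> k) (N + replicate_mset n k) = N"
  by (rule multiset_eqI) (auto simp: not_in_iff)

lemma finite_ssyt_content:
  assumes "f \<in> shapes"
  shows "finite {T \<in> ssyt f. image_mset T (mset_set (diagram f)) = M}"
proof (rule finite_subset)
  show "{T \<in> ssyt f. image_mset T (mset_set (diagram f)) = M} \<subseteq> diagram f \<rightarrow>\<^sub>E set_mset M"
    using finite_diagram[OF assms] unfolding ssyt_def PiE_def Pi_def by auto
  show "finite (diagram f \<rightarrow>\<^sub>E set_mset M)"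
    by (rule finite_PiE) (auto simp: finite_diagram assms)
qed

lemma kostka_eq_0:
  assumes "f \<in> shapes" "size M \<noteq> shape_size f"
  shows "kostka f M = 0"
proof -
  have "{T \<in> ssyt f. image_mset T (mset_set (diagram f)) = M} = {}"
    using assms(2) by (auto simp: shape_size_def)
  then show ?thesis by (simp add: kostka_def del: Collect_empty_eq)
qed

lemma diagram_empty_iff: "f \<in> shapes \<Longrightarrow> diagram f = {} \<longleftrightarrow> shape_size f = 0"
  by (simp add: shape_size_def finite_diagram)

lemma shape_size_0_iff: "f \<in> shapes \<Longrightarrow> shape_size f = 0 \<longleftrightarrow> f = (\<lambda>_. 0)"
  by (subst diagram_empty_iff[symmetric]) (auto simp: diagram_def fun_eq_iff)

lemma zero_in_shapes: "(\<lambda>_. 0) \<in> shapes"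
  by (auto simp: shapes_def)

lemma kostka_empty:
  assumes "f \<in> shapes"
  shows "kostka f {#} = (if f = (\<lambda>_. 0) then 1 else 0)"
proof (cases "f = (\<lambda>_. 0)")
  case True
  then have "diagram f = {}" by (auto simp: diagram_def)
  then have "{T \<in> ssyt f. image_mset T (mset_set (diagram f)) = {#}} = {\<lambda>_. undefined}"
    by (auto simp: ssyt_def)
  then show ?thesis using True by (simp add: kostka_def)
next
  case False
  then show ?thesis using kostka_eq_0[of f "{#}"] shape_size_0_iff[OF assms] assms by auto
qed

text \<open>The cells holding the largest letter \<open>k\<close> sit at the ends of rows, and at
  most one of them lies in each column, so they form a horizontal strip; erasing them leaves a
  tableau in the smaller letters.\<close>

lemma kostka_rec:
  assumes f: "f \<in> shapes" and M: "\<forall>x\<in>#M. x < Suc k"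
  shows "kostka f M = (\<Sum>g | hstrip g f \<and> shape_size g + count M k = shape_size f.
           kostka g (filter_mset (\<lambda>x. x \<noteq> k) M))"
proof -
  let ?M' = "filter_mset (\<lambda>x. x \<noteq> k) M"
  define A where "A = {T \<in> ssyt f. image_mset T (mset_set (diagram f)) = M}"
  define Gs where "Gs = {g. hstrip g f \<and> shape_size g + count M k = shape_size f}"
  define B where "B g = {T \<in> ssyt g. image_mset T (mset_set (diagram g)) = ?M'}" for g
  define gT where "gT T = (\<lambda>i. card {j. j < f i \<and> T (i, j) < k})" for T :: "nat \<times> nat \<Rightarrow> nat"
  define E where "E g T = (\<lambda>c\<in>diagram f. if c \<in> diagram g then T c else k)" for g T
  note fin = finite_diagram[OF f]
  have Gshape: "g \<in> shapes" if "g \<in> Gs" for g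
    using that hstrip_lower_in_shapes[OF _ f] by (auto simp: Gs_def)
  have sub: "diagram g \<subseteq> diagram f" if "hstrip g f" for g
    using that by (auto simp: diagram_def hstrip_def intro: less_le_trans)
  have split: "image_mset T (mset_set (diagram f)) =
      image_mset T' (mset_set (diagram g)) + replicate_mset (shape_size f - shape_size g) k"
    if g: "hstrip g f" and "\<And>c. c \<in> diagram g \<Longrightarrow> T c = T' c"
      and "\<And>c. c \<in> diagram f - diagram g \<Longrightarrow> T c = k" for g T T'
  proof -
    have fg: "finite (diagram g)" using fin sub[OF g] by (rule finite_subset[rotated])
    have "mset_set (diagram f) = mset_set (diagram g) + mset_set (diagram f - diagram g)"
      using sub[OF g] fin fg by (metis Diff_disjoint Diff_partition finite_Diff mset_set_Union)
    moreover have "image_mset T (mset_set (diagram g)) = image_mset T' (mset_set (diagram g))"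
      by (rule image_mset_cong) (use that(2) fg in auto)
    moreover have "image_mset T (mset_set (diagram f - diagram g)) =
        image_mset (\<lambda>_. k) (mset_set (diagram f - diagram g))"
      by (rule image_mset_cong) (use that(3) fin in auto)
    moreover have "\<dots> = replicate_mset (card (diagram f - diagram g)) k"
      by (simp add: image_mset_const_eq)
    ultimately show ?thesis
      using sub[OF g] fg by (simp add: card_Diff_subset shape_size_def)
  qed
  have gT: "(i, j) \<in> diagram (gT T) \<longleftrightarrow> (i, j) \<in> diagram f \<and> T (i, j) < k" if T: "T \<in> A" for T i j
  proof -
    \<comment> \<open>Rows increase weakly, so the entries below \<open>k\<close> are an initial
      segment of their row and the number \<open>gT T i\<close> determines which cells they
      occupy.\<close>
    have dc: "j' < f i \<and> T (i, j') < k" if "j' \<le> j" "j < f i" "T (i, j) < k" for j j'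
    proof -
      have "T (i, j') \<le> T (i, j)"
        using T that by (cases "j' = j") (auto simp: A_def ssyt_def diagram_def)
      then show ?thesis using that by simp
    qed
    have "{j. j < f i \<and> T (i, j) < k} = {..<gT T i}"
    proof -
      define X where "X = {j. j < f i \<and> T (i, j) < k}"
      have fX: "finite X" unfolding X_def by (rule finite_subset[of _ "{..<f i}"]) auto
      have X: "j' \<in> X" if "j \<in> X" "j' \<le> j" for j j' using dc that by (auto simp: X_def)
      have "X = {..<card X}"
      proof (cases "X = {}")
        case False
        have "X = {..Max X}"
          using X[of "Max X"] Max_in[OF fX False] Max_ge[OF fX] by auto
        then have "X = {..<Suc (Max X)}" by (simp add: lessThan_Suc_atMost)
        then show ?thesis by (metis card_lessThan)
      qed simp
      then show ?thesis by (simp add: X_def gT_def)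
    qed
    then show ?thesis by (auto simp: diagram_def)
  qed
  have Tle: "T c \<le> k" if "T \<in> A" "c \<in> diagram f" for T c
  proof -
    have "T c \<in># M" using that fin by (auto simp: A_def)
    then show ?thesis using M by auto
  qed
  have gT_strip: "hstrip (gT T) f" if T: "T \<in> A" for T
    unfolding hstrip_def
  proof (intro allI conjI)
    fix i
    show "gT T i \<le> f i"
      using card_mono[of "{..<f i}" "{j. j < f i \<and> T (i, j) < k}"] by (auto simp: gT_def)
    \<comment> \<open>Otherwise the cell of row \<open>Suc i\<close> in column \<open>gT T i\<close>
      has an entry at most \<open>k\<close>, the cell above it an entry below \<open>k\<close>, and
      that cell would lie in a region whose row \<open>i\<close> ends just before this
      column.\<close>
    show "f (Suc i) \<le> gT T i"
    proof (rule ccontr)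
      assume "\<not> f (Suc i) \<le> gT T i"
      then have c: "(Suc i, gT T i) \<in> diagram f" by (auto simp: diagram_def)
      then have "T (i, gT T i) < T (Suc i, gT T i)" using T by (auto simp: A_def ssyt_def)
      also have "\<dots> \<le> k" by (rule Tle[OF T c])
      finally have "T (i, gT T i) < k" .
      moreover have "(i, gT T i) \<in> diagram f"
        using c shapes_antimono[OF f, of i "Suc i"] by (auto simp: diagram_def)
      ultimately have "(i, gT T i) \<in> diagram (gT T)" using gT[OF T] by blast
      then show False by (simp add: diagram_def)
    qed
  qed
  have "bij_betw (\<lambda>T. (gT T, restrict T (diagram (gT T)))) A (Sigma Gs B)"
  proof (rule bij_betw_byWitness[where f' = "\<lambda>(g, T). E g T"])
    show "\<forall>T\<in>A. (\<lambda>(g, T). E g T) (gT T, restrict T (diagram (gT T))) = T"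
    proof
      fix T assume T: "T \<in> A"
      have "E (gT T) (restrict T (diagram (gT T))) c = T c" for c
      proof (cases "c \<in> diagram f")
        case True
        then show ?thesis using gT[OF T, of "fst c" "snd c"] Tle[OF T True] by (auto simp: E_def)
      next
        case False
        moreover have "T \<in> extensional (diagram f)" using T by (simp add: A_def ssyt_def PiE_def)
        ultimately show ?thesis by (simp add: E_def extensional_arb[of T])
      qed
      then show "(\<lambda>(g, T). E g T) (gT T, restrict T (diagram (gT T))) = T" by (simp add: fun_eq_iff)
    qed
    have B: "T c < k" if "g \<in> Gs" "T \<in> B g" "c \<in> diagram g" for g T c
    proof -
      have "T c \<in># image_mset T (mset_set (diagram g))"
        using that(3) finite_diagram[OF Gshape[OF that(1)]] by simp
      also have "image_mset T (mset_set (diagram g)) = ?M'" using that(2) by (simp add: B_def)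
      finally have "T c \<in># ?M'" .
      then show ?thesis using M by (auto simp: less_Suc_eq)
    qed
    have dgE: "gT (E g T) = g" if "g \<in> Gs" "T \<in> B g" for g T
    proof
      fix i
      have "{j. j < f i \<and> E g T (i, j) < k} = {..<g i}"
        using that B[OF that] sub[of g] by (auto simp: E_def diagram_def Gs_def split: if_splits)
      then show "gT (E g T) i = g i" by (simp add: gT_def)
    qed
    show "\<forall>x\<in>Sigma Gs B. (gT (case x of (g, T) \<Rightarrow> E g T),
        restrict (case x of (g, T) \<Rightarrow> E g T) (diagram (gT (case x of (g, T) \<Rightarrow> E g T)))) = x"
    proof
      fix x assume "x \<in> Sigma Gs B"
      then obtain g T where x: "x = (g, T)" and gT: "g \<in> Gs" "T \<in> B g" by blast
      have "restrict (E g T) (diagram g) = T"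
      proof
        fix c
        have "T \<in> extensional (diagram g)" using gT by (simp add: B_def ssyt_def PiE_def)
        then show "restrict (E g T) (diagram g) c = T c"
          using gT(1) sub[of g] by (cases "c \<in> diagram g") (auto simp: E_def Gs_def extensional_arb[of T])
      qed
      then show "(gT (case x of (g, T) \<Rightarrow> E g T),
          restrict (case x of (g, T) \<Rightarrow> E g T) (diagram (gT (case x of (g, T) \<Rightarrow> E g T)))) = x"
        by (simp add: dgE[OF gT] x)
    qed
    show "(\<lambda>T. (gT T, restrict T (diagram (gT T)))) ` A \<subseteq> Sigma Gs B"
    proof safe
      fix T assume T: "T \<in> A"
      let ?g = "gT T" and ?T = "restrict T (diagram (gT T))"
      have s: "M = image_mset ?T (mset_set (diagram ?g)) + replicate_mset (shape_size f - shape_size ?g) k"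
        using split[OF gT_strip[OF T], of T ?T] gT[OF T] Tle[OF T] T by (force simp: A_def)
      have fg: "finite (diagram ?g)" using fin sub[OF gT_strip[OF T]] by (rule finite_subset[rotated])
      have nk: "k \<notin># image_mset ?T (mset_set (diagram ?g))"
        using gT[OF T] fg by auto
      have le: "shape_size ?g \<le> shape_size f" by (rule hstrip_size_le[OF gT_strip[OF T] f])
      have "count M k = shape_size f - shape_size ?g"
        using nk by (subst s) (simp only: not_in_iff count_union count_replicate_mset, simp)
      then show "?g \<in> Gs" using le gT_strip[OF T] by (simp add: Gs_def)
      have "?M' = image_mset ?T (mset_set (diagram ?g))"
        using filter_mset_add_replicate[OF nk] by (subst s)
      moreover have "?T \<in> ssyt ?g"
      proof -
        have *: "(i, j) \<in> diagram ?g" if "(i, j') \<in> diagram ?g" "j < j'" for i j j'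
          using that by (auto simp: diagram_def)
        have **: "(i, j) \<in> diagram ?g" if "(i', j) \<in> diagram ?g" "i < i'" for i i' j
          using that shapes_antimono[OF hstrip_lower_in_shapes[OF gT_strip[OF T] f], of i i']
          by (auto simp: diagram_def)
        have r: "T (i, j) \<le> T (i, j')" if "j < j'" "(i, j') \<in> diagram ?g" for i j j'
          using T that sub[OF gT_strip[OF T]] unfolding A_def ssyt_def by blast
        have c: "T (i, j) < T (i', j)" if "i < i'" "(i', j) \<in> diagram ?g" for i i' j
          using T that sub[OF gT_strip[OF T]] unfolding A_def ssyt_def by blast
        show ?thesis unfolding ssyt_def
        proof (intro CollectI conjI allI impI)
          show "?T \<in> diagram ?g \<rightarrow>\<^sub>E UNIV" by simp
          show "?T (i, j) \<le> ?T (i, j')" if "j < j'" "(i, j') \<in> diagram ?g" for i j j'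
            using r[OF that] *[OF that(2,1)] that(2) by simp
          show "?T (i, j) < ?T (i', j)" if "i < i'" "(i', j) \<in> diagram ?g" for i i' j
            using c[OF that] **[OF that(2,1)] that(2) by simp
        qed
      qed
      ultimately show "?T \<in> B ?g" by (simp add: B_def)
    qed
    show "(\<lambda>(g, T). E g T) ` Sigma Gs B \<subseteq> A"
    proof safe
      fix g T assume gT: "g \<in> Gs" "T \<in> B g"
      have strip: "hstrip g f" using gT by (auto simp: Gs_def)
      have gsh: "g \<in> shapes" using Gshape gT by auto
      have Tg: "T \<in> ssyt g" using gT by (auto simp: B_def)
      have "image_mset (E g T) (mset_set (diagram f)) = ?M' + replicate_mset (count M k) k"
      proof (subst split[OF strip, of _ T])
        show "E g T c = T c" if "c \<in> diagram g" for c
          using that sub[OF strip] by (auto simp: E_def)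
        show "E g T c = k" if "c \<in> diagram f - diagram g" for c
          using that by (auto simp: E_def)
        have "shape_size f - shape_size g = count M k" using gT(1) by (auto simp: Gs_def)
        then show "image_mset T (mset_set (diagram g)) + replicate_mset (shape_size f - shape_size g) k =
            ?M' + replicate_mset (count M k) k"
          using gT(2) by (simp add: B_def)
      qed
      also have "\<dots> = M" by (rule multiset_eqI) auto
      finally have "image_mset (E g T) (mset_set (diagram f)) = M" .
      moreover have "E g T \<in> ssyt f"
        unfolding ssyt_def
      proof (intro CollectI conjI allI impI)
        show "E g T \<in> diagram f \<rightarrow>\<^sub>E UNIV" by (auto simp: E_def)
        fix i j j' :: nat assume j: "j < j'" "(i, j') \<in> diagram f"
        then have c: "(i, j) \<in> diagram f" by (auto simp: diagram_def)
        show "E g T (i, j) \<le> E g T (i, j')"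
        proof (cases "(i, j') \<in> diagram g")
          case True
          then have "(i, j) \<in> diagram g" using j by (auto simp: diagram_def)
          then show ?thesis using True Tg j c by (auto simp: E_def ssyt_def)
        next
          case False
          then show ?thesis using B[OF gT, of "(i, j)"] j c by (auto simp: E_def)
        qed
      next
        fix i i' j :: nat assume i: "i < i'" "(i', j) \<in> diagram f"
        then have c: "(i, j) \<in> diagram f" using shapes_antimono[OF f, of i i'] by (auto simp: diagram_def)
        \<comment> \<open>Of two cells in one column, the upper one always belongs to the smaller
          shape and so holds a letter below \<open>k\<close>.\<close>
        have "f i' \<le> f (Suc i)" using i shapes_antimono[OF f, of "Suc i" i'] by simp
        also have "\<dots> \<le> g i" using strip by (auto simp: hstrip_def)
        finally have g1: "(i, j) \<in> diagram g" using i by (auto simp: diagram_def)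
        show "E g T (i, j) < E g T (i', j)"
          using B[OF gT g1] c g1 i Tg by (auto simp: E_def ssyt_def)
      qed
      ultimately show "E g T \<in> A" by (simp add: A_def)
    qed
  qed
  then have "card A = card (Sigma Gs B)" by (rule bij_betw_same_card)
  also have "\<dots> = (\<Sum>g\<in>Gs. card (B g))"
  proof (rule card_SigmaI)
    show "finite Gs"
      by (rule finite_subset[OF _ finite_shapes_size_le[of "shape_size f"]])
        (use Gshape in \<open>auto simp: Gs_def\<close>)
    show "\<forall>g\<in>Gs. finite (B g)" using finite_ssyt_content[OF Gshape] by (auto simp: B_def)
  qed
  finally show ?thesis by (simp add: A_def B_def Gs_def kostka_def)
qed

section \<open>Pieri's formula\<close>

lemma finite_hstrip_below: "f \<in> shapes \<Longrightarrow> finite {g. hstrip g f \<and> P g}"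
  by (rule finite_subset[OF _ finite_shapes_size_le[of "shape_size f"]])
    (auto intro: hstrip_lower_in_shapes hstrip_size_le)

lemma finite_hstrip_above: "f \<in> shapes \<Longrightarrow> finite {g. hstrip f g \<and> shape_size g = n}"
  by (rule finite_subset[OF _ finite_shapes_size[of n]]) (auto intro: hstrip_upper_in_shapes)

lemma finite_submsets: "finite {A. A \<subseteq># M \<and> P A}"
proof (rule finite_subset)
  show "{A. A \<subseteq># M \<and> P A} \<subseteq> (\<Union>n\<in>{..size M}. multisets_of_size (set_mset M) n)"
    using size_mset_mono set_mset_mono by (fastforce simp: multisets_of_size_def)
  show "finite (\<Union>n\<in>{..size M}. multisets_of_size (set_mset M) n)"
    by (auto intro: finite_multisets_of_size)
qed

text \<open>Sorts submultisets by the multiplicity \<open>t\<close> of the letter \<open>k\<close>,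
  to match the step of \<open>kostka_rec\<close> that removes this letter.\<close>

lemma sum_submsets_split:
  fixes h :: "'a multiset \<Rightarrow> 'b::comm_monoid_add"
  shows "(\<Sum>A | A \<subseteq># M \<and> size A = i. h A) =
    (\<Sum>t | t \<le> i \<and> t \<le> count M k.
       \<Sum>B | B \<subseteq># filter_mset (\<lambda>x. x \<noteq> k) M \<and> size B = i - t. h (B + replicate_mset t k))"
proof -
  let ?M' = "filter_mset (\<lambda>x. x \<noteq> k) M"
  have MM: "M = ?M' + replicate_mset (count M k) k"
    by (rule multiset_eqI) auto
  have fin: "finite {t. t \<le> i \<and> t \<le> count M k}" by (rule finite_subset[of _ "{..i}"]) auto
  have *: "count B k = 0" if "B \<subseteq># ?M'" for B
    using mset_subset_eq_count[OF that, of k] by simp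
  have "(\<Sum>A | A \<subseteq># M \<and> size A = i. h A) =
    (\<Sum>(t, B)\<in>Sigma {t. t \<le> i \<and> t \<le> count M k} (\<lambda>t. {B. B \<subseteq># ?M' \<and> size B = i - t}). h (B + replicate_mset t k))"
  proof (rule sum.reindex_bij_witness[where i = "\<lambda>(t, B). B + replicate_mset t k"
        and j = "\<lambda>A. (count A k, filter_mset (\<lambda>x. x \<noteq> k) A)"])
    fix A assume A: "A \<in> {A. A \<subseteq># M \<and> size A = i}"
    have AA: "A = filter_mset (\<lambda>x. x \<noteq> k) A + replicate_mset (count A k) k"
      by (rule multiset_eqI) auto
    show AA': "(case (count A k, filter_mset (\<lambda>x. x \<noteq> k) A) of (t, B) \<Rightarrow> B + replicate_mset t k) = A"
      using AA by simp
    then show "(case (count A k, filter_mset (\<lambda>x. x \<noteq> k) A) of (t, B) \<Rightarrow> h (B + replicate_mset t k)) = h A"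
      by simp
    have "size A = size (filter_mset (\<lambda>x. x \<noteq> k) A) + count A k"
      by (subst AA) (simp only: size_union size_replicate_mset)
    then show "(count A k, filter_mset (\<lambda>x. x \<noteq> k) A) \<in>
        Sigma {t. t \<le> i \<and> t \<le> count M k} (\<lambda>t. {B. B \<subseteq># ?M' \<and> size B = i - t})"
      using A by (auto intro: multiset_filter_mono mset_subset_eq_count)
  next
    fix b assume "b \<in> Sigma {t. t \<le> i \<and> t \<le> count M k} (\<lambda>t. {B. B \<subseteq># ?M' \<and> size B = i - t})"
    then obtain t B where b: "b = (t, B)" "t \<le> i" "t \<le> count M k" "B \<subseteq># ?M'" "size B = i - t" by auto
    have nB: "count B k = 0" by (rule *[OF b(4)])
    have "filter_mset (\<lambda>x. x \<noteq> k) (B + replicate_mset t k) = B"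
      by (rule filter_mset_add_replicate) (use nB in \<open>simp add: not_in_iff\<close>)
    then show "(count (case b of (t, B) \<Rightarrow> B + replicate_mset t k) k,
        filter_mset (\<lambda>x. x \<noteq> k) (case b of (t, B) \<Rightarrow> B + replicate_mset t k)) = b"
      using nB b(1) by (simp del: filter_union_mset)
    have "B + replicate_mset t k \<subseteq># M"
      by (subst MM, rule subset_mset.add_mono[OF b(4)]) (use b(3) in \<open>simp add: subseteq_mset_def\<close>)
    then show "(case b of (t, B) \<Rightarrow> B + replicate_mset t k) \<in> {A. A \<subseteq># M \<and> size A = i}"
      using b by simp
  qed
  also have "\<dots> = (\<Sum>t | t \<le> i \<and> t \<le> count M k. \<Sum>B | B \<subseteq># ?M' \<and> size B = i - t. h (B + replicate_mset t k))"
    by (rule sum.Sigma[symmetric]) (use fin finite_submsets in auto)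
  finally show ?thesis .
qed

text \<open>The coefficient at \<open>M\<close> of the product of a Schur function with the complete
  symmetric function of degree \<open>i\<close>, whose coefficient is 1 at every multiset
  \<open>A\<close> of size \<open>i\<close>. In the induction on the alphabet, adding a strip to
  \<open>l\<close> and removing the strip of the top letter are interchanged by the local
  rule.\<close>

lemma pieri:
  assumes "\<forall>x\<in>#M. x < k" "l \<in> shapes"
  shows "(\<Sum>v | hstrip l v \<and> shape_size v = shape_size l + i. kostka v M) =
         (\<Sum>A | A \<subseteq># M \<and> size A = i. kostka l (M - A))"
  using assms
proof (induction k arbitrary: M l i)
  case 0
  then have M: "M = {#}" by (cases M) auto
  note l = 0(2)
  have *: "kostka v {#} = (if v = (\<lambda>_. 0) then 1 else 0)" if "hstrip l v" for v
    by (rule kostka_empty[OF hstrip_upper_in_shapes[OF that l]])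
  show ?case
  proof (cases "i = 0")
    case True
    have "(\<Sum>v | hstrip l v \<and> shape_size v = shape_size l + i. kostka v M) =
      (\<Sum>v | hstrip l v \<and> shape_size v = shape_size l + i. if v = (\<lambda>_. 0) then 1 else 0)"
      unfolding M by (rule sum.cong) (use * in auto)
    also have "\<dots> = (if hstrip l (\<lambda>_. 0) \<and> shape_size (\<lambda>_. 0) = shape_size l + i then 1 else 0)"
      by (subst sum.delta) (use finite_hstrip_above[OF l] in auto)
    also have "\<dots> = (if l = (\<lambda>_. 0) then 1 else 0)"
      using True shape_size_0_iff[OF zero_in_shapes] shape_size_0_iff[OF l] by (auto simp: hstrip_def)
    also have "\<dots> = kostka l M" by (simp add: M kostka_empty[OF l])
    also have "\<dots> = (\<Sum>A\<in>{{#}}. kostka l (M - A))" by simp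
    also have "{{#}} = {A. A \<subseteq># M \<and> size A = i}" using True by (auto simp: M)
    finally show ?thesis .
  next
    case False
    have "(\<Sum>v | hstrip l v \<and> shape_size v = shape_size l + i. kostka v M) = 0"
      using kostka_eq_0[OF hstrip_upper_in_shapes[OF _ l]] False by (auto simp: M)
    moreover have "{A. A \<subseteq># M \<and> size A = i} = {}" using False by (auto simp: M)
    ultimately show ?thesis by (simp del: Collect_empty_eq)
  qed
next
  case (Suc k)
  note l = Suc.prems(2)
  define j where "j = count M k"
  define M' where "M' = filter_mset (\<lambda>x. x \<noteq> k) M"
  define n where "n = shape_size l + i"
  define V where "V = {v. hstrip l v \<and> shape_size v = n}"
  define Ms where "Ms = {m \<in> shapes. shape_size m + j = n}"
  define R where "R m = {r. hstrip r l \<and> hstrip r m \<and> shape_size l + shape_size m \<le> n + shape_size r}" for m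
  have finV: "finite V" unfolding V_def by (rule finite_hstrip_above[OF l])
  have finM: "finite Ms" unfolding Ms_def
    by (rule finite_subset[OF _ finite_shapes_size_le[of n]]) auto
  have finR: "finite (R m)" for m unfolding R_def by (rule finite_hstrip_below[OF l])
  have V: "v \<in> shapes" if "v \<in> V" for v
    using that hstrip_upper_in_shapes[OF _ l] by (auto simp: V_def)
  have M'k: "\<forall>x\<in>#M'. x < k" using Suc.prems(1) by (auto simp: M'_def less_Suc_eq)
  have "(\<Sum>v\<in>V. kostka v M) = (\<Sum>v\<in>V. \<Sum>m | m \<in> Ms \<and> hstrip m v. kostka m M')"
  proof (rule sum.cong[OF refl])
    fix v assume v: "v \<in> V"
    have "{g. hstrip g v \<and> shape_size g + count M k = shape_size v} = {m. m \<in> Ms \<and> hstrip m v}"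
      using v hstrip_lower_in_shapes[OF _ V[OF v]] by (auto simp: Ms_def V_def j_def)
    then show "kostka v M = (\<Sum>m | m \<in> Ms \<and> hstrip m v. kostka m M')"
      using kostka_rec[OF V[OF v] Suc.prems(1)] by (simp add: M'_def)
  qed
  also have "\<dots> = (\<Sum>m\<in>Ms. \<Sum>v | v \<in> V \<and> hstrip m v. kostka m M')"
    by (rule sum.swap_restrict[OF finV finM])
  \<comment> \<open>The local rule trades the shapes \<open>v\<close> lying above both
    \<open>l\<close> and \<open>m\<close> for shapes \<open>r\<close> lying below both.\<close>
  also have "\<dots> = (\<Sum>m\<in>Ms. \<Sum>r\<in>R m. kostka m M')"
  proof (rule sum.cong[OF refl])
    fix m assume m: "m \<in> Ms"
    have "{v. v \<in> V \<and> hstrip m v} = {v. hstrip l v \<and> hstrip m v \<and> shape_size v = n}"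
      by (auto simp: V_def)
    then show "(\<Sum>v | v \<in> V \<and> hstrip m v. kostka m M') = (\<Sum>r\<in>R m. kostka m M')"
      using card_hstrip_square[OF l, of m n] m by (simp add: R_def Ms_def)
  qed
  also have "\<dots> = (\<Sum>(m, r)\<in>Sigma Ms R. kostka m M')"
    by (rule sum.Sigma[OF finM]) (use finR in auto)
  \<comment> \<open>The new index \<open>t\<close> is the number of letters \<open>k\<close> that
    will go into \<open>A\<close>: the strip between \<open>r\<close> and \<open>l\<close> holds the
    remaining \<open>j - t\<close> of them, and the strip between \<open>r\<close> and
    \<open>m\<close> has the remaining size \<open>i - t\<close>. The inequality in \<open>R\<close>
    says that \<open>t\<close> is not negative.\<close>
  also have "\<dots> = (\<Sum>(t, r, m)\<in>Sigma {t. t \<le> i \<and> t \<le> j} (\<lambda>t.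
      Sigma {r. hstrip r l \<and> shape_size r + (j - t) = shape_size l}
        (\<lambda>r. {m. hstrip r m \<and> shape_size m = shape_size r + (i - t)})). kostka m M')"
    (is "_ = sum _ ?S")
  proof (rule sum.reindex_bij_witness[where i = "\<lambda>(t, r, m). (m, r)"
        and j = "\<lambda>(m, r). (shape_size r + j - shape_size l, r, m)"])
    fix a assume "a \<in> Sigma Ms R"
    then show "(case case a of (m, r) \<Rightarrow> (shape_size r + j - shape_size l, r, m) of (t, r, m) \<Rightarrow> (m, r)) = a"
      and "(case case a of (m, r) \<Rightarrow> (shape_size r + j - shape_size l, r, m) of (t, r, m) \<Rightarrow> kostka m M') =
         (case a of (m, r) \<Rightarrow> kostka m M')"
      by auto
    obtain m r where a: "a = (m, r)" by (cases a)
    have *: "hstrip r l" "hstrip r m" "shape_size l + shape_size m \<le> n + shape_size r"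
        "m \<in> shapes" "shape_size m + j = n"
      using \<open>a \<in> _\<close> by (auto simp: a R_def Ms_def)
    show "(case a of (m, r) \<Rightarrow> (shape_size r + j - shape_size l, r, m)) \<in> ?S"
      using * hstrip_size_le[OF *(1) l] hstrip_size_le[OF *(2,4)] by (auto simp: a n_def)
  next
    fix b assume b: "b \<in> ?S"
    obtain t r m where b': "b = (t, r, m)" by (cases b)
    have *: "t \<le> i" "t \<le> j" "hstrip r l" "shape_size r + (j - t) = shape_size l" "hstrip r m"
        "shape_size m = shape_size r + (i - t)"
      using b by (auto simp: b')
    show "(case case b of (t, r, m) \<Rightarrow> (m, r) of (m, r) \<Rightarrow> (shape_size r + j - shape_size l, r, m)) = b"
      using * by (auto simp: b')
    show "(case b of (t, r, m) \<Rightarrow> (m, r)) \<in> Sigma Ms R"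
      using * hstrip_upper_in_shapes[OF *(5) hstrip_lower_in_shapes[OF *(3) l]]
      by (auto simp: b' Ms_def R_def n_def)
  qed
  also have "\<dots> = (\<Sum>t | t \<le> i \<and> t \<le> j. \<Sum>r | hstrip r l \<and> shape_size r + (j - t) = shape_size l.
      \<Sum>m | hstrip r m \<and> shape_size m = shape_size r + (i - t). kostka m M')"
  proof -
    have fin: "finite {t. t \<le> i \<and> t \<le> j}" by (rule finite_subset[of _ "{..i}"]) auto
    have fin2: "finite {m. hstrip r m \<and> shape_size m = shape_size r + (i - t)}" if "hstrip r l" for r t
      by (rule finite_hstrip_above[OF hstrip_lower_in_shapes[OF that l]])
    let ?R = "\<lambda>t. {r. hstrip r l \<and> shape_size r + (j - t) = shape_size l}"
    let ?M = "\<lambda>t r. {m. hstrip r m \<and> shape_size m = shape_size r + (i - t)}"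
    have finR: "finite (?R t)" for t by (rule finite_hstrip_below[OF l])
    have finM: "finite (?M t r)" if "r \<in> ?R t" for t r using fin2[of r t] that by blast
    have "(\<Sum>t | t \<le> i \<and> t \<le> j. \<Sum>r\<in>?R t. \<Sum>m\<in>?M t r. kostka m M') =
        (\<Sum>t | t \<le> i \<and> t \<le> j. \<Sum>(r, m)\<in>Sigma (?R t) (?M t). kostka m M')"
      by (rule sum.cong[OF refl], rule sum.Sigma[OF finR]) (use finM in blast)
    also have "\<dots> = (\<Sum>(t, r, m)\<in>Sigma {t. t \<le> i \<and> t \<le> j} (\<lambda>t. Sigma (?R t) (?M t)). kostka m M')"
      by (rule sum.Sigma[OF fin], intro ballI finite_SigmaI finR) (use finM in blast)
    finally show ?thesis by (rule sym)
  qed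
  also have "\<dots> = (\<Sum>t | t \<le> i \<and> t \<le> j. \<Sum>r | hstrip r l \<and> shape_size r + (j - t) = shape_size l.
      \<Sum>B | B \<subseteq># M' \<and> size B = i - t. kostka r (M' - B))"
    by (intro sum.cong refl Suc.IH[OF M'k]) (auto intro: hstrip_lower_in_shapes[OF _ l])
  also have "\<dots> = (\<Sum>t | t \<le> i \<and> t \<le> j. \<Sum>B | B \<subseteq># M' \<and> size B = i - t.
      \<Sum>r | hstrip r l \<and> shape_size r + (j - t) = shape_size l. kostka r (M' - B))"
    by (intro sum.cong refl sum.swap)
  also have "\<dots> = (\<Sum>t | t \<le> i \<and> t \<le> j. \<Sum>B | B \<subseteq># M' \<and> size B = i - t.
      kostka l (M - (B + replicate_mset t k)))"
  proof (intro sum.cong refl)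
    fix t B assume t: "t \<in> {t. t \<le> i \<and> t \<le> j}" and B: "B \<in> {B. B \<subseteq># M' \<and> size B = i - t}"
    let ?N = "M - (B + replicate_mset t k)"
    have cB: "count B k = 0" using B mset_subset_eq_count[of B M' k] by (auto simp: M'_def)
    have "count ?N k = j - t" using cB by (simp add: j_def)
    moreover have "filter_mset (\<lambda>x. x \<noteq> k) ?N = M' - B"
      by (rule multiset_eqI) (use cB in \<open>auto simp: M'_def\<close>)
    moreover have "\<forall>x\<in>#?N. x < Suc k" using Suc.prems(1) by (meson in_diffD)
    ultimately show "(\<Sum>r | hstrip r l \<and> shape_size r + (j - t) = shape_size l. kostka r (M' - B)) = kostka l ?N"
      using kostka_rec[OF l, of ?N k] by simp
  qed
  also have "\<dots> = (\<Sum>A | A \<subseteq># M \<and> size A = i. kostka l (M - A))"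
    unfolding j_def M'_def by (rule sum_submsets_split[symmetric])
  finally show ?case by (simp add: V_def n_def)
qed

section \<open>Cauchy's identity\<close>

text \<open>The number of nonnegative integer matrices with row sums \<open>M\<close> and column
  sums \<open>M'\<close>, that is, a coefficient of the Cauchy kernel, the product of all
  \<open>1 / (1 - x y)\<close> over pairs of variables.\<close>

definition pair_count :: "'a multiset \<Rightarrow> 'b multiset \<Rightarrow> nat" where
  "pair_count M M' = card {P. image_mset fst P = M \<and> image_mset snd P = M'}"

lemma finite_pair_msets:
  fixes M :: "'a multiset" and M' :: "'b multiset"
  shows "finite {P. image_mset fst P = M \<and> image_mset snd P = M'}"
proof (rule finite_subset)
  show "{P. image_mset fst P = M \<and> image_mset snd P = M'} \<subseteq>
      multisets_of_size (set_mset M \<times> set_mset M') (size M)"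
  proof safe
    fix P :: "('a \<times> 'b) multiset"
    have "p \<in> fst ` set_mset P \<times> snd ` set_mset P" if "p \<in># P" for p
      using that by (metis imageI mem_Times_iff)
    then show "P \<in> multisets_of_size (set_mset (image_mset fst P) \<times> set_mset (image_mset snd P))
        (size (image_mset fst P))"
      unfolding multisets_of_size_def by (simp only: set_image_mset subset_iff size_image_mset mem_Collect_eq) simp
  qed
qed (auto intro: finite_multisets_of_size)

lemma pair_count_empty: "pair_count {#} M' = (if M' = {#} then 1 else 0)"
proof -
  have "{P. image_mset fst P = {#} \<and> image_mset snd P = M'} = (if M' = {#} then {{#}} else {})"
    by auto
  then show ?thesis by (auto simp: pair_count_def)
qed

text \<open>The symmetry of the Cauchy kernel in its first alphabet; the symmetry of Schur functions
  will be deduced from it.\<close>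

lemma pair_count_image:
  fixes h :: "'a \<Rightarrow> 'b" and M' :: "'c multiset"
  assumes inj: "inj_on h (set_mset M)"
  shows "pair_count (image_mset h M) M' = pair_count M M'"
proof -
  define g where "g = the_inv_into (set_mset M) h"
  have gh: "g (h x) = x" if "x \<in># M" for x using that inj by (simp add: g_def the_inv_into_f_f)
  have hg: "h (g y) = y" if "y \<in># image_mset h M" for y using that gh by auto
  have "bij_betw (image_mset (map_prod h id)) {P. image_mset fst P = M \<and> image_mset snd P = M'}
      {P. image_mset fst P = image_mset h M \<and> image_mset snd P = M'}" (is "bij_betw ?f ?A ?B")
  proof (rule bij_betw_byWitness[where f' = "image_mset (map_prod g id)"])
    have "image_mset (map_prod g id) (?f P) = P" if "P \<in> ?A" for P
    proof -
      have "g (h (fst p)) = fst p" if "p \<in># P" for p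
      proof -
        have "fst p \<in># image_mset fst P" using that by (metis image_eqI set_image_mset)
        moreover have "image_mset fst P = M" using \<open>P \<in> ?A\<close> by blast
        ultimately show ?thesis using gh by simp
      qed
      then have "image_mset (map_prod g id \<circ> map_prod h id) P = image_mset id P"
        by (intro image_mset_cong) (simp add: map_prod_def split_beta)
      then show ?thesis by (simp add: multiset.map_comp)
    qed
    then show "\<forall>P\<in>?A. image_mset (map_prod g id) (?f P) = P" by blast
    have "?f (image_mset (map_prod g id) P) = P" if "P \<in> ?B" for P
    proof -
      have "x \<in># image_mset h M" if "(x, y) \<in># P" for x y
      proof -
        have "fst (x, y) \<in># image_mset fst P" using that by (metis image_eqI set_image_mset)
        moreover have "image_mset fst P = image_mset h M" using \<open>P \<in> ?B\<close> by blast
        ultimately show ?thesis by (simp only: fst_conv)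
      qed
      then have "image_mset (map_prod h id \<circ> map_prod g id) P = image_mset id P"
        by (intro image_mset_cong) (use hg in auto)
      then show ?thesis by (simp add: multiset.map_comp)
    qed
    then show "\<forall>P\<in>?B. ?f (image_mset (map_prod g id) P) = P" by blast
    have "image_mset fst (?f P) = image_mset h (image_mset fst P)"
      and "image_mset snd (?f P) = image_mset snd P" for P :: "('a \<times> 'c) multiset"
      by (simp_all add: multiset.map_comp)
    then show "?f ` ?A \<subseteq> ?B" by auto
    have "image_mset g (image_mset h M) = M"
      using gh by (simp add: multiset.map_comp cong: image_mset_cong)
    moreover have "image_mset fst (image_mset (map_prod g id) P) = image_mset g (image_mset fst P)"
      and "image_mset snd (image_mset (map_prod g id) P) = image_mset snd P" for P :: "('b \<times> 'c) multiset"
      by (simp_all add: multiset.map_comp)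
    ultimately show "image_mset (map_prod g id) ` ?B \<subseteq> ?A" by auto
  qed
  then show ?thesis unfolding pair_count_def by (rule bij_betw_same_card[symmetric])
qed

text \<open>Deletes one row of the matrix: \<open>A\<close> collects the partners of the copies of
  \<open>k\<close>.\<close>

lemma pair_count_rec:
  fixes M :: "'a multiset" and M' :: "'b multiset"
  shows "pair_count M M' = (\<Sum>A | A \<subseteq># M' \<and> size A = count M k. pair_count (filter_mset (\<lambda>x. x \<noteq> k) M) (M' - A))"
proof -
  define S where "S M M' = {P. image_mset fst P = M \<and> image_mset snd P = M'}" for M :: "'a multiset" and M' :: "'b multiset"
  let ?M = "filter_mset (\<lambda>x. x \<noteq> k) M"
  let ?A = "{A. A \<subseteq># M' \<and> size A = count M k}"
  let ?j = "\<lambda>P :: ('a \<times> 'b) multiset. (image_mset snd (filter_mset (\<lambda>p. fst p = k) P), filter_mset (\<lambda>p. fst p \<noteq> k) P)"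
  let ?i = "\<lambda>(A, P). image_mset (Pair k) A + P"
  have split: "P = filter_mset (\<lambda>p. fst p = k) P + filter_mset (\<lambda>p. fst p \<noteq> k) P" for P :: "('a \<times> 'b) multiset"
    by (rule multiset_partition)
  have "bij_betw ?j (S M M') (Sigma ?A (\<lambda>A. S ?M (M' - A)))"
  proof (rule bij_betw_byWitness[where f' = ?i])
    have "?i (?j P) = P" for P
    proof -
      have "image_mset (Pair k) (image_mset snd (filter_mset (\<lambda>p. fst p = k) P)) =
          image_mset id (filter_mset (\<lambda>p. fst p = k) P)"
        unfolding multiset.map_comp by (rule image_mset_cong) auto
      then show ?thesis using split[of P] by simp
    qed
    then show "\<forall>P\<in>S M M'. ?i (?j P) = P" by blast
    have "?j (?i (A, P)) = (A, P)" if "P \<in> S ?M (M' - A)" for A P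
    proof -
      have "fst p \<noteq> k" if "p \<in># P" for p
      proof -
        have "fst p \<in># image_mset fst P" using that by (metis image_eqI set_image_mset)
        moreover have "image_mset fst P = ?M" using \<open>P \<in> _\<close> unfolding S_def by blast
        ultimately have "fst p \<in># ?M" by simp
        then show ?thesis by simp
      qed
      then have 1: "filter_mset (\<lambda>p. fst p = k) P = {#}" by simp
      then have 2: "filter_mset (\<lambda>p. fst p \<noteq> k) P = P" by (metis split add_0)
      have 3: "filter_mset (\<lambda>p. fst p = k) (image_mset (Pair k) A) = image_mset (Pair k) A"
        and 4: "filter_mset (\<lambda>p. fst p \<noteq> k) (image_mset (Pair k) A) = {#}"
        by (simp_all add: filter_mset_image_mset)
      show ?thesis by (simp add: 1 2 3 4 multiset.map_comp comp_def)
    qed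
    then show "\<forall>x\<in>Sigma ?A (\<lambda>A. S ?M (M' - A)). ?j (?i x) = x" by auto
    show "?j ` S M M' \<subseteq> Sigma ?A (\<lambda>A. S ?M (M' - A))"
    proof safe
      fix P assume P: "P \<in> S M M'"
      let ?P1 = "filter_mset (\<lambda>p. fst p = k) P" and ?P2 = "filter_mset (\<lambda>p. fst p \<noteq> k) P"
      have M: "image_mset fst P = M" and M': "image_mset snd P = M'" using P by (auto simp: S_def)
      have M'2: "M' = image_mset snd ?P1 + image_mset snd ?P2"
        using split[of P] M' by (metis image_mset_union)
      then show "image_mset snd ?P1 \<subseteq># M'" by (metis mset_subset_eq_add_left)
      show "size (image_mset snd ?P1) = count M k"
        unfolding M[symmetric] size_image_mset by (induction P) auto
      have "image_mset fst ?P2 = ?M" by (simp add: M[symmetric] filter_mset_image_mset)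
      moreover have "M' - image_mset snd ?P1 = image_mset snd ?P2"
        by (metis M'2 add_diff_cancel_left')
      ultimately show "?P2 \<in> S ?M (M' - image_mset snd ?P1)" by (simp add: S_def)
    qed
    show "?i ` Sigma ?A (\<lambda>A. S ?M (M' - A)) \<subseteq> S M M'"
    proof safe
      fix A P assume "A \<subseteq># M'" "size A = count M k" and P: "P \<in> S ?M (M' - A)"
      have "image_mset fst (image_mset (Pair k) A) = replicate_mset (count M k) k"
        using \<open>size A = count M k\<close> by (simp add: multiset.map_comp comp_def image_mset_const_eq)
      moreover have "replicate_mset (count M k) k + ?M = M" by (rule multiset_eqI) auto
      ultimately show "image_mset (Pair k) A + P \<in> S M M'"
        using P \<open>A \<subseteq># M'\<close> by (simp add: S_def multiset.map_comp comp_def)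
    qed
  qed
  then have "card (S M M') = card (Sigma ?A (\<lambda>A. S ?M (M' - A)))" by (rule bij_betw_same_card)
  also have "\<dots> = (\<Sum>A\<in>?A. card (S ?M (M' - A)))"
    by (rule card_SigmaI) (simp_all add: finite_submsets S_def finite_pair_msets)
  finally show ?thesis by (simp add: S_def pair_count_def)
qed

text \<open>Both sides obey the same recursion when the top letter of \<open>M\<close> is removed.
  On the left, the branching rule acts on the factor at \<open>M\<close> and Pieri's formula on the
  factor at \<open>M'\<close>.\<close>

lemma cauchy_aux:
  assumes "\<forall>x\<in>#M. x < k"
  shows "(\<Sum>f | f \<in> shapes \<and> shape_size f = size M. kostka f M * kostka f M') = pair_count M M'"
  using assms
proof (induction k arbitrary: M M')
  case 0
  then have M: "M = {#}" by (cases M) auto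
  have "{f. f \<in> shapes \<and> shape_size f = size M} = {\<lambda>_. 0}"
    using M shape_size_0_iff zero_in_shapes by auto
  moreover have "kostka (\<lambda>_. 0) M' = (if M' = {#} then 1 else 0)"
    using kostka_empty[OF zero_in_shapes] kostka_eq_0[OF zero_in_shapes, of M']
      shape_size_0_iff[OF zero_in_shapes] by auto
  ultimately show ?case by (simp add: M pair_count_empty kostka_empty[OF zero_in_shapes])
next
  case (Suc k)
  define M2 where "M2 = filter_mset (\<lambda>x. x \<noteq> k) M"
  define j where "j = count M k"
  have MM: "M = M2 + replicate_mset j k" by (rule multiset_eqI) (auto simp: M2_def j_def)
  have sz: "size M = size M2 + j" by (subst MM) simp
  have M2: "\<forall>x\<in>#M2. x < k" using Suc.prems by (auto simp: M2_def less_Suc_eq)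
  define F where "F = {f \<in> shapes. shape_size f = size M}"
  define G where "G = {f \<in> shapes. shape_size f = size M2}"
  have fin: "finite F" "finite G" unfolding F_def G_def by (auto intro: finite_shapes_size)
  have "(\<Sum>f\<in>F. kostka f M * kostka f M') =
      (\<Sum>f\<in>F. \<Sum>g | g \<in> G \<and> hstrip g f. kostka g M2 * kostka f M')"
  proof (rule sum.cong[OF refl])
    fix f assume f: "f \<in> F"
    then have "{g. hstrip g f \<and> shape_size g + count M k = shape_size f} = {g. g \<in> G \<and> hstrip g f}"
      using sz hstrip_lower_in_shapes by (auto simp: F_def G_def j_def)
    then show "kostka f M * kostka f M' = (\<Sum>g | g \<in> G \<and> hstrip g f. kostka g M2 * kostka f M')"
      using kostka_rec[of f M k] Suc.prems f by (simp add: F_def M2_def sum_distrib_right)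
  qed
  also have "\<dots> = (\<Sum>g\<in>G. \<Sum>f | f \<in> F \<and> hstrip g f. kostka g M2 * kostka f M')"
    by (rule sum.swap_restrict[OF fin])
  also have "\<dots> = (\<Sum>g\<in>G. kostka g M2 * (\<Sum>A | A \<subseteq># M' \<and> size A = j. kostka g (M' - A)))"
  proof (rule sum.cong[OF refl])
    fix g assume g: "g \<in> G"
    then have "{f. f \<in> F \<and> hstrip g f} = {f. hstrip g f \<and> shape_size f = shape_size g + j}"
      using sz hstrip_upper_in_shapes by (auto simp: F_def G_def)
    \<comment> \<open>Pieri's formula asks for some bound on the letters of \<open>M'\<close>; it
      has nothing to do with \<open>k\<close>.\<close>
    moreover obtain k' where "\<forall>x\<in>#M'. x < k'"
      using finite_nat_set_iff_bounded[of "set_mset M'"] by auto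
    ultimately show "(\<Sum>f | f \<in> F \<and> hstrip g f. kostka g M2 * kostka f M') =
        kostka g M2 * (\<Sum>A | A \<subseteq># M' \<and> size A = j. kostka g (M' - A))"
      using pieri[of M' k' g j] g by (simp add: G_def sum_distrib_left[symmetric])
  qed
  also have "\<dots> = (\<Sum>A | A \<subseteq># M' \<and> size A = j. \<Sum>g\<in>G. kostka g M2 * kostka g (M' - A))"
    by (simp add: sum_distrib_left) (rule sum.swap)
  also have "\<dots> = (\<Sum>A | A \<subseteq># M' \<and> size A = j. pair_count M2 (M' - A))"
    using Suc.IH[OF M2] by (simp add: G_def)
  also have "\<dots> = pair_count M M'"
    unfolding pair_count_rec[of M M' k] by (simp add: M2_def j_def)
  finally show ?case by (simp add: F_def)
qed

theorem cauchy:
  "(\<Sum>f | f \<in> shapes \<and> shape_size f = size M. kostka f M * kostka f M') = pair_count M M'"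
proof -
  obtain k where "\<forall>x\<in>#M. x < k"
    using finite_nat_set_iff_bounded[of "set_mset M"] by auto
  then show ?thesis by (rule cauchy_aux)
qed

section \<open>The basis of Schur functions\<close>

text \<open>Among the indices with \<open>x i \<noteq> 0\<close>, take \<open>m\<close> of greatest
  rank. Every other entry of column \<open>m\<close> that could contribute belongs to a row of
  greater rank, where \<open>x\<close> vanishes, so the equation at \<open>m\<close> reads
  \<open>x m = 0\<close>.\<close>

lemma unitriangular_unique:
  fixes K :: "'i \<Rightarrow> 'i \<Rightarrow> 'a::comm_ring_1" and rk :: "'i \<Rightarrow> nat"
  assumes "finite I" and diag: "\<And>i. i \<in> I \<Longrightarrow> K i i = 1"
    and tri: "\<And>i j. i \<in> I \<Longrightarrow> j \<in> I \<Longrightarrow> K i j \<noteq> 0 \<Longrightarrow> i = j \<or> rk j < rk i"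
    and eq: "\<And>j. j \<in> I \<Longrightarrow> (\<Sum>i\<in>I. x i * K i j) = 0"
    and "i \<in> I"
  shows "x i = 0"
proof (rule ccontr)
  assume "x i \<noteq> 0"
  define J where "J = {i \<in> I. x i \<noteq> 0}"
  have J: "finite J" "J \<noteq> {}" using assms(1,5) \<open>x i \<noteq> 0\<close> by (auto simp: J_def)
  have "Max (rk ` J) \<in> rk ` J" using J by simp
  then obtain m where m: "m \<in> J" "rk m = Max (rk ` J)" by (metis imageE)
  then have max: "rk k \<le> rk m" if "k \<in> J" for k using that J by simp
  have "x k * K k m = (if k = m then x m else 0)" if "k \<in> I" for k
  proof (cases "k = m")
    case False
    have "K k m = 0" if "x k \<noteq> 0"
    proof (rule ccontr)
      assume "K k m \<noteq> 0"
      then have "rk m < rk k" using tri[of k m] m(1) \<open>k \<in> I\<close> False by (auto simp: J_def)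
      then show False using max[of k] that \<open>k \<in> I\<close> by (auto simp: J_def)
    qed
    then show ?thesis using False by (cases "x k = 0") auto
  qed (use m(1) diag in \<open>auto simp: J_def\<close>)
  then have "(\<Sum>k\<in>I. x k * K k m) = (\<Sum>k\<in>I. if k = m then x m else 0)" by simp
  also have "\<dots> = x m" using assms(1) m(1) by (simp add: J_def)
  finally show False using eq[of m] m(1) by (auto simp: J_def)
qed

text \<open>Back substitution, with the indices entering by decreasing rank. A new index has the
  lowest rank so far, hence leaves the solved equations alone, and its own equation is solved
  without division because the diagonal is 1. This keeps Schur expansions integral.\<close>

lemma unitriangular_solve:
  fixes K :: "'i \<Rightarrow> 'i \<Rightarrow> 'a::comm_ring_1" and rk :: "'i \<Rightarrow> nat"
  assumes "finite I" and "\<And>i. i \<in> I \<Longrightarrow> K i i = 1"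
    and "\<And>i j. i \<in> I \<Longrightarrow> j \<in> I \<Longrightarrow> K i j \<noteq> 0 \<Longrightarrow> i = j \<or> rk j < rk i"
  shows "\<exists>x. \<forall>j\<in>I. (\<Sum>i\<in>I. x i * K i j) = b j"
  using assms
\<comment> \<open>The minus sign reverses the order of insertion, so that the rank
  decreases.\<close>
proof (induction I rule: finite_ranking_induct[where f = "\<lambda>i. - int (rk i)"])
  case (insert m I)
  note 2 = insert.hyps insert.IH insert.prems
  show ?case
  proof (cases "m \<in> I")
    case True
    then show ?thesis using 2 by (simp add: insert_absorb)
  next
    case False
    obtain x where x: "\<And>j. j \<in> I \<Longrightarrow> (\<Sum>i\<in>I. x i * K i j) = b j"
      using 2(3-5) by (metis insertCI)
    define y where "y = x(m := b m - (\<Sum>i\<in>I. x i * K i m))"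
    have y: "(\<Sum>i\<in>I. y i * K i j) = (\<Sum>i\<in>I. x i * K i j)" for j
      by (rule sum.cong) (use False in \<open>auto simp: y_def\<close>)
    have "(\<Sum>i\<in>insert m I. y i * K i j) = b j" if "j \<in> insert m I" for j
    proof (cases "j = m")
      case True
      then show ?thesis using 2(1,4) False y by (simp add: y_def)
    next
      case jm: False
      then have "j \<in> I" using that by simp
      then have "K m j = 0" using 2(2)[of j] 2(5)[of m j] jm by fastforce
      then show ?thesis using 2(1) False y x[OF \<open>j \<in> I\<close>] by simp
    qed
    then show ?thesis by blast
  qed
qed simp

section \<open>Partitions, contents and the dominance order\<close>

definition part :: "nat list \<Rightarrow> nat \<Rightarrow> nat" where
  "part \<alpha> i = (if i < length \<alpha> then \<alpha> ! i else 0)"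

text \<open>The monomial with exponent vector \<alpha>: the letter \<open>i\<close> occurs as often
  as row \<open>i\<close> has cells.\<close>

definition row_content :: "nat list \<Rightarrow> nat multiset" where
  "row_content \<alpha> = image_mset fst (mset_set (young_diagram \<alpha>))"

definition partial_sum :: "nat list \<Rightarrow> nat \<Rightarrow> nat" where
  "partial_sum \<alpha> r = (\<Sum>i<r. part \<alpha> i)"

definition dominates :: "nat list \<Rightarrow> nat list \<Rightarrow> bool" where
  "dominates \<alpha> \<beta> \<longleftrightarrow> (\<forall>r. partial_sum \<beta> r \<le> partial_sum \<alpha> r)"

text \<open>A linear refinement of dominance. Summing up to \<open>d\<close> is enough, because for
  partitions of \<open>d\<close> all partial sums equal \<open>d\<close> from there on.\<close>

definition dom_rank :: "nat \<Rightarrow> nat list \<Rightarrow> nat" where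
  "dom_rank d \<alpha> = (\<Sum>r\<le>d. partial_sum \<alpha> r)"

lemma young_diagram_eq: "young_diagram \<alpha> = diagram (part \<alpha>)"
  by (auto simp: young_diagram_def diagram_def part_def split: if_splits)

lemma part_in_shapes:
  assumes "is_partition \<alpha>"
  shows "part \<alpha> \<in> shapes"
proof (rule shapesI)
  show "part \<alpha> (Suc i) \<le> part \<alpha> i" for i
    using assms by (auto simp: part_def is_partition_def sorted_wrt_iff_nth_less)
  show "part \<alpha> i = 0" if "i \<ge> length \<alpha>" for i using that by (simp add: part_def)
qed

lemma shape_size_part: "shape_size (part \<alpha>) = sum_list \<alpha>"
proof -
  have "shape_size (part \<alpha>) = (\<Sum>i<length \<alpha>. part \<alpha> i)"
    by (rule shape_size_eq_sum) (simp add: part_def)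
  also have "\<dots> = (\<Sum>i<length \<alpha>. \<alpha> ! i)" by (rule sum.cong) (auto simp: part_def)
  finally show ?thesis by (simp add: sum_list_sum_nth atLeast0LessThan)
qed

lemma part_inj:
  assumes "is_partition \<alpha>" "is_partition \<beta>" "part \<alpha> = part \<beta>"
  shows "\<alpha> = \<beta>"
proof -
  have pos: "part \<gamma> i = 0 \<longleftrightarrow> i \<ge> length \<gamma>" if "is_partition \<gamma>" for \<gamma> i
  proof (cases "i < length \<gamma>")
    case True
    then have "\<gamma> ! i \<in> set \<gamma>" by (rule nth_mem)
    then have "\<gamma> ! i \<noteq> 0" using that by (metis is_partition_def)
    then show ?thesis using True by (simp add: part_def)
  qed (simp add: part_def)
  have "i \<ge> length \<alpha> \<longleftrightarrow> i \<ge> length \<beta>" for i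
    using pos[OF assms(1), of i] pos[OF assms(2), of i] assms(3) by simp
  then have l: "length \<alpha> = length \<beta>" by (metis dual_order.antisym order_refl)
  show ?thesis
  proof (rule nth_equalityI[OF l])
    show "\<alpha> ! i = \<beta> ! i" if "i < length \<alpha>" for i
      using fun_cong[OF assms(3), of i] that l by (simp add: part_def)
  qed
qed

lemma part_surj:
  assumes "f \<in> shapes"
  shows "\<exists>\<alpha>. is_partition \<alpha> \<and> part \<alpha> = f"
proof -
  obtain L0 where "\<And>i. i \<ge> L0 \<Longrightarrow> f i = 0" using assms by (rule shapesE) blast
  then have ex: "f L0 = 0" by simp
  define L where "L = (LEAST i. f i = 0)"
  have L0: "f L = 0" unfolding L_def using ex by (rule LeastI)
  then have L: "f i = 0" if "i \<ge> L" for i using shapes_antimono[OF assms that] by simp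
  have nz: "f i \<noteq> 0" if "i < L" for i using that not_less_Least unfolding L_def by blast
  have "is_partition (map f [0..<L])"
    unfolding is_partition_def
  proof
    show "sorted_wrt (\<ge>) (map f [0..<L])"
      using shapes_antimono[OF assms] by (simp add: sorted_wrt_iff_nth_less)
    show "0 \<notin> set (map f [0..<L])"
    proof
      assume "0 \<in> set (map f [0..<L])"
      then obtain i where "i < L" "f i = 0" by (metis atLeastLessThan_iff imageE set_map set_upt)
      then show False using nz by blast
    qed
  qed
  moreover have "part (map f [0..<L]) = f" using L by (auto simp: part_def fun_eq_iff)
  ultimately show ?thesis by blast
qed

lemma bij_betw_part: "bij_betw part (partitions_of d) {f. f \<in> shapes \<and> shape_size f = d}"
  unfolding bij_betw_def
proof
  show "inj_on part (partitions_of d)"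
    by (rule inj_onI, rule part_inj) (auto simp: partitions_of_def)
  show "part ` partitions_of d = {f. f \<in> shapes \<and> shape_size f = d}"
  proof (intro equalityI subsetI)
    fix f assume "f \<in> part ` partitions_of d"
    then show "f \<in> {f. f \<in> shapes \<and> shape_size f = d}"
      by (auto simp: partitions_of_def part_in_shapes shape_size_part)
  next
    fix f assume f: "f \<in> {f. f \<in> shapes \<and> shape_size f = d}"
    then obtain \<alpha> where "is_partition \<alpha>" "part \<alpha> = f" using part_surj[of f] by blast
    then show "f \<in> part ` partitions_of d"
      using f shape_size_part[of \<alpha>] by (auto simp: partitions_of_def)
  qed
qed

lemma finite_partitions_of: "finite (partitions_of d)"
  using bij_betw_finite[OF bij_betw_part[of d]] finite_shapes_size[of d] by simp

lemma schur_eq_kostka: "schur \<alpha> M = int (kostka (part \<alpha>) M)"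
  by (simp add: schur_def kostka_def semistandard_tableaux_def ssyt_def young_diagram_eq)

lemma schur_eq_0:
  assumes "is_partition \<alpha>" "size M \<noteq> sum_list \<alpha>"
  shows "schur \<alpha> M = 0"
  using kostka_eq_0[OF part_in_shapes[OF assms(1)], of M] assms(2)
  by (simp add: schur_eq_kostka shape_size_part)

lemma schur_cauchy:
  "(\<Sum>\<alpha>\<in>partitions_of (size M). schur \<alpha> M * schur \<alpha> M') = int (pair_count M M')"
  unfolding cauchy[symmetric, of M M'] schur_eq_kostka
  using sum.reindex_bij_betw[OF bij_betw_part, of "\<lambda>f. int (kostka f M) * int (kostka f M')" "size M"]
  by (simp add: of_nat_sum)

lemma finite_young_diagram: "is_partition \<alpha> \<Longrightarrow> finite (young_diagram \<alpha>)"
  by (simp add: young_diagram_eq finite_diagram part_in_shapes)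

lemma size_row_content: "size (row_content \<alpha>) = sum_list \<alpha>"
  using shape_size_part[of \<alpha>] by (simp add: row_content_def young_diagram_eq shape_size_def)

lemma card_rows_below:
  assumes "is_partition \<alpha>"
  shows "card {c \<in> young_diagram \<alpha>. fst c < r} = partial_sum \<alpha> r"
proof -
  have "{c \<in> young_diagram \<alpha>. fst c < r} = Sigma {..<r} (\<lambda>i. {..<part \<alpha> i})"
    by (auto simp: young_diagram_eq diagram_def)
  then show ?thesis by (simp add: card_SigmaI partial_sum_def)
qed

lemma size_filter_image_mset_set:
  "finite A \<Longrightarrow> size (filter_mset P (image_mset f (mset_set A))) = card {x \<in> A. P (f x)}"
  by (simp add: filter_mset_image_mset)

lemma size_row_content_below:
  "is_partition \<alpha> \<Longrightarrow> size (filter_mset (\<lambda>i. i < r) (row_content \<alpha>)) = partial_sum \<alpha> r"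
  by (simp add: row_content_def size_filter_image_mset_set finite_young_diagram card_rows_below)

lemma dominates_antisym:
  assumes "is_partition \<alpha>" "is_partition \<beta>" "dominates \<alpha> \<beta>" "dominates \<beta> \<alpha>"
  shows "\<alpha> = \<beta>"
proof (rule part_inj[OF assms(1,2)])
  have "partial_sum \<alpha> r = partial_sum \<beta> r" for r
    using assms(3,4) by (simp add: dominates_def dual_order.antisym)
  from this[of "Suc _"] this show "part \<alpha> = part \<beta>"
    by (auto simp: partial_sum_def fun_eq_iff)
qed

lemma partial_sum_ge_size:
  assumes "is_partition \<alpha>" "r \<ge> sum_list \<alpha>"
  shows "partial_sum \<alpha> r = sum_list \<alpha>"
proof -
  have "part \<alpha> i = 0" if "i \<ge> r" for i
    using shape_zero_ge_size[OF part_in_shapes[OF assms(1)], of i] that assms(2) by (simp add: shape_size_part)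
  from shape_size_eq_sum[of r "part \<alpha>", OF this] show ?thesis by (simp add: shape_size_part partial_sum_def)
qed

lemma dom_rank_less:
  assumes "\<alpha> \<in> partitions_of d" "\<beta> \<in> partitions_of d" "dominates \<alpha> \<beta>" "\<alpha> \<noteq> \<beta>"
  shows "dom_rank d \<beta> < dom_rank d \<alpha>"
proof -
  have le: "partial_sum \<beta> r \<le> partial_sum \<alpha> r" for r using assms(3) by (simp add: dominates_def)
  have "\<not> dominates \<beta> \<alpha>" using assms dominates_antisym[of \<alpha> \<beta>] by (auto simp: partitions_of_def)
  then obtain r where r: "partial_sum \<beta> r < partial_sum \<alpha> r" by (auto simp: dominates_def not_le)
  have "r \<le> d"
  proof (rule ccontr)
    assume "\<not> r \<le> d"
    then show False
      using r partial_sum_ge_size[of \<alpha> r] partial_sum_ge_size[of \<beta> r] assms by (auto simp: partitions_of_def)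
  qed
  then show ?thesis unfolding dom_rank_def
    by (intro sum_strict_mono_ex1) (use le r in auto)
qed

section \<open>Unitriangularity of the Kostka matrix\<close>

lemma semistandard_tableau_ge_row:
  assumes "T \<in> semistandard_tableaux \<alpha>" "is_partition \<alpha>" "(i, j) \<in> young_diagram \<alpha>"
  shows "i \<le> T (i, j)"
  using assms(3)
proof (induction i)
  case (Suc i)
  have "(i, j) \<in> young_diagram \<alpha>"
    using Suc.prems shapes_antimono[OF part_in_shapes[OF assms(2)], of i "Suc i"]
    by (auto simp: young_diagram_eq diagram_def)
  moreover from this have "T (i, j) < T (Suc i, j)"
    using assms(1) Suc.prems by (auto simp: semistandard_tableaux_def)
  ultimately show ?case using Suc.IH by simp
qed simp

text \<open>Entries below \<open>r\<close> can occupy only the first \<open>r\<close> rows, since an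
  entry is at least its row index; their number is a partial sum of \<beta>, the room available a
  partial sum of \<alpha>.\<close>

lemma schur_row_content_dominates:
  assumes "is_partition \<alpha>" "is_partition \<beta>" "schur \<alpha> (row_content \<beta>) \<noteq> 0"
  shows "dominates \<alpha> \<beta>"
proof -
  have "{T \<in> semistandard_tableaux \<alpha>. image_mset T (mset_set (young_diagram \<alpha>)) = row_content \<beta>} \<noteq> {}"
    using assms(3) by (auto simp: schur_def simp del: Collect_empty_eq intro: card.empty)
  then obtain T where T: "T \<in> semistandard_tableaux \<alpha>" "image_mset T (mset_set (young_diagram \<alpha>)) = row_content \<beta>"
    by blast
  note fin = finite_young_diagram[OF assms(1)]
  show ?thesis unfolding dominates_def
  proof
    fix r
    have "partial_sum \<beta> r = card {c \<in> young_diagram \<alpha>. T c < r}"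
      using size_row_content_below[OF assms(2), of r] T(2) size_filter_image_mset_set[OF fin, of "\<lambda>i. i < r" T]
      by simp
    also have "\<dots> \<le> card {c \<in> young_diagram \<alpha>. fst c < r}"
    proof (rule card_mono)
      show "finite {c \<in> young_diagram \<alpha>. fst c < r}" using fin by simp
      show "{c \<in> young_diagram \<alpha>. T c < r} \<subseteq> {c \<in> young_diagram \<alpha>. fst c < r}"
      proof clarify
        fix i j assume "(i, j) \<in> young_diagram \<alpha>" "T (i, j) < r"
        then show "fst (i, j) < r" using semistandard_tableau_ge_row[OF T(1) assms(1), of i j] by simp
      qed
    qed
    finally show "partial_sum \<beta> r \<le> partial_sum \<alpha> r" by (simp add: card_rows_below[OF assms(1)])
  qed
qed

text \<open>Each entry is at least its row index, while equal contents give equal sums of entries;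
  hence every entry equals its row index.\<close>

lemma schur_row_content_self:
  assumes "is_partition \<alpha>"
  shows "schur \<alpha> (row_content \<alpha>) = 1"
proof -
  note fin = finite_young_diagram[OF assms]
  have "{T \<in> semistandard_tableaux \<alpha>. image_mset T (mset_set (young_diagram \<alpha>)) = row_content \<alpha>} =
      {restrict fst (young_diagram \<alpha>)}" (is "?L = {?R}")
  proof (intro equalityI subsetI)
    fix T assume "T \<in> ?L"
    then have T: "T \<in> semistandard_tableaux \<alpha>" "image_mset T (mset_set (young_diagram \<alpha>)) = row_content \<alpha>" by auto
    have "sum T (young_diagram \<alpha>) = sum fst (young_diagram \<alpha>)"
      using T(2) unfolding row_content_def sum_unfold_sum_mset by simp
    moreover have le: "fst c \<le> T c" if "c \<in> young_diagram \<alpha>" for c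
      using semistandard_tableau_ge_row[OF T(1) assms, of "fst c" "snd c"] that by simp
    ultimately have "T c = fst c" if "c \<in> young_diagram \<alpha>" for c
      using sum_mono_inv[of fst "young_diagram \<alpha>" T c] fin that by auto
    moreover have "T \<in> extensional (young_diagram \<alpha>)" using T(1) by (auto simp: semistandard_tableaux_def PiE_def)
    ultimately have "T = ?R" by (intro extensionalityI[of T "young_diagram \<alpha>"]) auto
    then show "T \<in> {?R}" by simp
  next
    fix T assume "T \<in> {?R}"
    then have TR: "T = ?R" by simp
    have "?R \<in> semistandard_tableaux \<alpha>"
      unfolding semistandard_tableaux_def
    proof (intro CollectI conjI allI impI)
      show "?R \<in> young_diagram \<alpha> \<rightarrow>\<^sub>E UNIV" by simp
      fix i j j' :: nat assume "j < j'" "(i, j') \<in> young_diagram \<alpha>"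
      then show "?R (i, j) \<le> ?R (i, j')" by (auto simp: young_diagram_def)
    next
      fix i i' j :: nat assume i: "i < i'" "(i', j) \<in> young_diagram \<alpha>"
      then have "(i, j) \<in> young_diagram \<alpha>"
        using shapes_antimono[OF part_in_shapes[OF assms], of i i'] by (auto simp: young_diagram_eq diagram_def)
      then show "?R (i, j) < ?R (i', j)" using i by auto
    qed
    moreover have "image_mset ?R (mset_set (young_diagram \<alpha>)) = row_content \<alpha>"
      unfolding row_content_def by (rule image_mset_cong) (use fin in auto)
    ultimately show "T \<in> ?L" by (simp add: TR)
  qed
  then show ?thesis by (simp add: schur_def)
qed

lemma schur_triangular:
  assumes "\<alpha> \<in> partitions_of d" "\<beta> \<in> partitions_of d" "schur \<alpha> (row_content \<beta>) \<noteq> 0"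
  shows "\<alpha> = \<beta> \<or> dom_rank d \<beta> < dom_rank d \<alpha>"
  using dom_rank_less[OF assms(1,2)] schur_row_content_dominates[of \<alpha> \<beta>] assms by (auto simp: partitions_of_def)

text \<open>The form in which coefficients of Schur functions are compared below. The coefficients
  may lie in any ring of characteristic 0, so they may be integers depending on a further monomial
  or character values.\<close>

lemma schur_coeffs_unique:
  fixes x :: "nat list \<Rightarrow> 'a::{comm_ring_1, ring_char_0}"
  assumes "\<And>\<beta>. \<beta> \<in> partitions_of d \<Longrightarrow> (\<Sum>\<alpha>\<in>partitions_of d. x \<alpha> * of_int (schur \<alpha> (row_content \<beta>))) = 0"
    and "\<alpha> \<in> partitions_of d"
  shows "x \<alpha> = 0"
proof (rule unitriangular_unique[where I = "partitions_of d" and rk = "dom_rank d"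
      and K = "\<lambda>\<alpha> \<beta>. of_int (schur \<alpha> (row_content \<beta>))"])
  show "finite (partitions_of d)" by (rule finite_partitions_of)
  show "of_int (schur \<alpha> (row_content \<alpha>)) = (1 :: 'a)" if "\<alpha> \<in> partitions_of d" for \<alpha>
    using that schur_row_content_self by (simp add: partitions_of_def)
  show "\<alpha> = \<beta> \<or> dom_rank d \<beta> < dom_rank d \<alpha>"
    if "\<alpha> \<in> partitions_of d" "\<beta> \<in> partitions_of d" "of_int (schur \<alpha> (row_content \<beta>)) \<noteq> (0 :: 'a)" for \<alpha> \<beta>
    using schur_triangular[OF that(1,2)] that(3) by auto
qed (use assms in auto)

section \<open>Symmetric series and their Schur expansion\<close>

definition symmetric_series :: "power_series \<Rightarrow> bool" where
  "symmetric_series f \<longleftrightarrow> (\<forall>M h. inj_on h (set_mset M) \<longrightarrow> f (image_mset h M) = f M)"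

definition homogeneous :: "nat \<Rightarrow> power_series \<Rightarrow> bool" where
  "homogeneous d f \<longleftrightarrow> (\<forall>M. size M \<noteq> d \<longrightarrow> f M = 0)"

text \<open>Read off from Cauchy's identity in place of Bender-Knuth involutions: pairing the
  difference of the two coefficients with the Schur functions at \<open>row_content \<beta>\<close>
  gives a difference of two equal matrix counts.\<close>

lemma schur_symmetric:
  assumes "is_partition \<alpha>"
  shows "symmetric_series (schur \<alpha>)"
  unfolding symmetric_series_def
proof (intro allI impI)
  fix M and h :: "nat \<Rightarrow> nat" assume h: "inj_on h (set_mset M)"
  show "schur \<alpha> (image_mset h M) = schur \<alpha> M"
  proof (cases "size M = sum_list \<alpha>")
    case True
    let ?d = "size M"
    have "schur \<alpha> (image_mset h M) - schur \<alpha> M = 0"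
    proof (rule schur_coeffs_unique[where d = ?d])
      show "\<alpha> \<in> partitions_of ?d" using assms True by (simp add: partitions_of_def)
      fix \<beta>
      have "(\<Sum>\<alpha>\<in>partitions_of ?d. (schur \<alpha> (image_mset h M) - schur \<alpha> M) * schur \<alpha> (row_content \<beta>)) =
          int (pair_count (image_mset h M) (row_content \<beta>)) - int (pair_count M (row_content \<beta>))"
        using schur_cauchy[of "image_mset h M" "row_content \<beta>"] schur_cauchy[of M "row_content \<beta>"]
        by (simp add: left_diff_distrib sum_subtractf)
      then show "(\<Sum>\<alpha>\<in>partitions_of ?d. (schur \<alpha> (image_mset h M) - schur \<alpha> M) * of_int (schur \<alpha> (row_content \<beta>))) = 0"
        by (simp add: pair_count_image[OF h])
    qed
    then show ?thesis by simp
  next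
    case False
    then show ?thesis using schur_eq_0[OF assms] by simp
  qed
qed

text \<open>Listing the letters by decreasing multiplicity turns any content into that of a
  partition. Hence a symmetric series is determined by its values at the contents
  \<open>row_content \<alpha>\<close>.\<close>

lemma ex_partition_relabel:
  fixes M :: "nat multiset"
  shows "\<exists>\<alpha>\<in>partitions_of (size M). \<exists>h. inj_on h (set_mset (row_content \<alpha>)) \<and> image_mset h (row_content \<alpha>) = M"
proof -
  define ys where "ys = rev (sort_key (count M) (sorted_list_of_set (set_mset M)))"
  define \<alpha> where "\<alpha> = map (count M) ys"
  have ys: "distinct ys" "set ys = set_mset M" by (auto simp: ys_def)
  have "sorted (map (count M) (sort_key (count M) (sorted_list_of_set (set_mset M))))" by simp
  moreover have "\<alpha> = rev (map (count M) (sort_key (count M) (sorted_list_of_set (set_mset M))))"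
    unfolding \<alpha>_def ys_def by (rule rev_map[symmetric])
  ultimately have "sorted_wrt (\<ge>) \<alpha>" by (simp only: sorted_wrt_rev)
  moreover have "0 \<notin> set \<alpha>"
  proof
    assume "0 \<in> set \<alpha>"
    then obtain y where "y \<in> set ys" "count M y = 0" unfolding \<alpha>_def by (metis imageE set_map)
    then show False using ys(2) by (simp add: count_eq_zero_iff)
  qed
  ultimately have \<alpha>: "is_partition \<alpha>" by (simp add: is_partition_def)
  have fin: "finite (young_diagram \<alpha>)" by (rule finite_young_diagram[OF \<alpha>])
  have rc: "count (row_content \<alpha>) i = part \<alpha> i" for i
  proof -
    have "count (row_content \<alpha>) i = size (filter_mset (\<lambda>k. k = i) (row_content \<alpha>))"
      by (simp add: filter_eq_replicate_mset)
    also have "\<dots> = card {c \<in> young_diagram \<alpha>. fst c = i}"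
      by (simp add: row_content_def size_filter_image_mset_set fin)
    also have "{c \<in> young_diagram \<alpha>. fst c = i} = Pair i ` {..<part \<alpha> i}"
      by (auto simp: young_diagram_eq diagram_def)
    finally show ?thesis by (simp add: card_image inj_on_def)
  qed
  have set: "set_mset (row_content \<alpha>) = {..<length ys}"
  proof -
    have "i \<in># row_content \<alpha> \<longleftrightarrow> i < length ys" for i
    proof -
      have "i \<in># row_content \<alpha> \<longleftrightarrow> 0 < part \<alpha> i" unfolding rc[symmetric] by simp
      also have "\<dots> \<longleftrightarrow> i < length ys"
      proof (cases "i < length ys")
        case True
        then have "ys ! i \<in># M" using ys(2) nth_mem by blast
        then show ?thesis using True by (simp add: part_def \<alpha>_def)
      qed (simp add: part_def \<alpha>_def)
      finally show ?thesis .
    qed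
    then show ?thesis by blast
  qed
  have inj: "inj_on (\<lambda>i. ys ! i) {..<length ys}"
    using ys(1) by (auto simp: inj_on_def nth_eq_iff_index_eq)
  have "count (image_mset (\<lambda>i. ys ! i) (row_content \<alpha>)) y = count M y" for y
  proof (cases "y \<in> set ys")
    case True
    then obtain i where i: "i < length ys" "ys ! i = y" by (auto simp: in_set_conv_nth)
    have "{k. k \<in># row_content \<alpha> \<and> y = ys ! k} = {i}"
      unfolding set using i inj_onD[OF inj] by blast
    moreover have "count (row_content \<alpha>) i = count M y"
      unfolding rc using i by (simp add: part_def \<alpha>_def)
    ultimately show ?thesis unfolding count_image_mset' by simp
  next
    case False
    then have "{k. k \<in># row_content \<alpha> \<and> y = ys ! k} = {}" unfolding set by auto
    moreover have "count M y = 0" using False ys(2) by (simp add: not_in_iff)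
    ultimately show ?thesis unfolding count_image_mset' by (simp del: Collect_empty_eq)
  qed
  then have im: "image_mset (\<lambda>i. ys ! i) (row_content \<alpha>) = M" by (rule multiset_eqI)
  have "sum_list \<alpha> = size M" by (metis im size_image_mset size_row_content)
  then have "\<alpha> \<in> partitions_of (size M)" using \<alpha> by (simp add: partitions_of_def)
  moreover have "inj_on (\<lambda>i. ys ! i) (set_mset (row_content \<alpha>))" unfolding set by (rule inj)
  ultimately show ?thesis using im by blast
qed

text \<open>The unitriangular system fixes the coefficients by the values at partition contents;
  symmetry carries the equality to all contents of size \<open>d\<close>, and homogeneity settles
  the others.\<close>

lemma schur_expansion:
  assumes "symmetric_series f" "homogeneous d f"
  obtains x where "\<And>M. f M = (\<Sum>\<alpha>\<in>partitions_of d. x \<alpha> * schur \<alpha> M)"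
proof -
  have "\<exists>x. \<forall>\<beta>\<in>partitions_of d. (\<Sum>\<alpha>\<in>partitions_of d. x \<alpha> * schur \<alpha> (row_content \<beta>)) = f (row_content \<beta>)"
  proof (rule unitriangular_solve[OF finite_partitions_of, where rk = "dom_rank d"])
    show "schur \<alpha> (row_content \<alpha>) = 1" if "\<alpha> \<in> partitions_of d" for \<alpha>
      using that schur_row_content_self by (simp add: partitions_of_def)
  qed (rule schur_triangular)
  then obtain x where x: "\<And>\<beta>. \<beta> \<in> partitions_of d \<Longrightarrow>
      (\<Sum>\<alpha>\<in>partitions_of d. x \<alpha> * schur \<alpha> (row_content \<beta>)) = f (row_content \<beta>)" by blast
  have "f M = (\<Sum>\<alpha>\<in>partitions_of d. x \<alpha> * schur \<alpha> M)" for M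
  proof (cases "size M = d")
    case True
    then obtain \<beta> h where b: "\<beta> \<in> partitions_of d" "inj_on h (set_mset (row_content \<beta>))"
        "image_mset h (row_content \<beta>) = M"
      using ex_partition_relabel[of M] by blast
    have "f M = f (row_content \<beta>)" using assms(1) b by (auto simp: symmetric_series_def)
    also have "\<dots> = (\<Sum>\<alpha>\<in>partitions_of d. x \<alpha> * schur \<alpha> (row_content \<beta>))" by (rule x[OF b(1), symmetric])
    also have "\<dots> = (\<Sum>\<alpha>\<in>partitions_of d. x \<alpha> * schur \<alpha> M)"
      by (rule sum.cong) (use schur_symmetric b in \<open>auto simp: symmetric_series_def partitions_of_def\<close>)
    finally show ?thesis .
  next
    case False
    have "(\<Sum>\<alpha>\<in>partitions_of d. x \<alpha> * schur \<alpha> M) = 0"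
      by (rule sum.neutral) (use False schur_eq_0 in \<open>auto simp: partitions_of_def\<close>)
    then show ?thesis using assms(2) False by (simp add: homogeneous_def)
  qed
  then show ?thesis by (rule that)
qed

lemma image_mset_submsets_bij:
  assumes "inj_on h (set_mset M)"
  shows "bij_betw (image_mset h) {A. A \<subseteq># M} {A. A \<subseteq># image_mset h M}"
proof -
  define g where "g = the_inv_into (set_mset M) h"
  have gh: "g (h x) = x" if "x \<in># M" for x using that assms by (simp add: g_def the_inv_into_f_f)
  have gA: "image_mset g (image_mset h A) = A" if "A \<subseteq># M" for A
  proof -
    have "image_mset (g \<circ> h) A = image_mset id A"
      by (rule image_mset_cong) (use that gh in \<open>auto dest: mset_subset_eqD\<close>)
    then show ?thesis by (simp add: multiset.map_comp)
  qed
  show ?thesis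
  proof (rule bij_betw_byWitness[where f' = "image_mset g"])
    show "\<forall>A\<in>{A. A \<subseteq># M}. image_mset g (image_mset h A) = A" using gA by simp
    show "\<forall>B\<in>{B. B \<subseteq># image_mset h M}. image_mset h (image_mset g B) = B"
    proof safe
      fix B assume "B \<subseteq># image_mset h M"
      have "image_mset (h \<circ> g) B = image_mset id B"
      proof (rule image_mset_cong)
        fix y assume "y \<in># B"
        then have "y \<in># image_mset h M" using \<open>B \<subseteq># _\<close> by (rule mset_subset_eqD[rotated])
        then show "(h \<circ> g) y = id y" using gh by auto
      qed
      then show "image_mset h (image_mset g B) = B" by (simp add: multiset.map_comp)
    qed
    show "image_mset h ` {A. A \<subseteq># M} \<subseteq> {B. B \<subseteq># image_mset h M}"
      by (auto intro: image_mset_subseteq_mono)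
    show "image_mset g ` {B. B \<subseteq># image_mset h M} \<subseteq> {A. A \<subseteq># M}"
      using image_mset_subseteq_mono[of _ "image_mset h M" g] gA[of M] by auto
  qed
qed

lemma symmetric_ps_mult:
  assumes "symmetric_series f" "symmetric_series g"
  shows "symmetric_series (ps_mult f g)"
  unfolding symmetric_series_def
proof (intro allI impI)
  fix M and h :: "nat \<Rightarrow> nat" assume h: "inj_on h (set_mset M)"
  have sub: "inj_on h (set_mset A)" if "A \<subseteq># M" for A
    using that h by (meson inj_on_subset set_mset_mono)
  have "ps_mult f g (image_mset h M) = (\<Sum>A | A \<subseteq># M. f (image_mset h A) * g (image_mset h M - image_mset h A))"
    unfolding ps_mult_def by (rule sum.reindex_bij_betw[OF image_mset_submsets_bij[OF h], symmetric])
  also have "\<dots> = (\<Sum>A | A \<subseteq># M. f A * g (M - A))"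
  proof (rule sum.cong[OF refl])
    fix A assume "A \<in> {A. A \<subseteq># M}"
    then have A: "A \<subseteq># M" by simp
    have "image_mset h M - image_mset h A = image_mset h (M - A)" by (simp add: A image_mset_Diff)
    then show "f (image_mset h A) * g (image_mset h M - image_mset h A) = f A * g (M - A)"
      using assms sub[OF A] sub[OF diff_subset_eq_self[of M A]] by (simp add: symmetric_series_def)
  qed
  finally show "ps_mult f g (image_mset h M) = ps_mult f g M" by (simp add: ps_mult_def)
qed

lemma homogeneous_ps_mult:
  assumes "homogeneous d f" "homogeneous e g"
  shows "homogeneous (d + e) (ps_mult f g)"
  unfolding homogeneous_def
proof (intro allI impI)
  fix M :: "nat multiset" assume M: "size M \<noteq> d + e"
  have "f A * g (M - A) = 0" if "A \<subseteq># M" for A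
  proof (cases "size A = d")
    case True
    then have "size (M - A) \<noteq> e" using M that size_mset_mono[OF that] by (auto simp: size_Diff_submset)
    then show ?thesis using assms(2) by (simp add: homogeneous_def)
  qed (use assms(1) in \<open>simp add: homogeneous_def\<close>)
  then show "ps_mult f g M = 0" unfolding ps_mult_def by (intro sum.neutral) blast
qed

section \<open>Products of Schur functions and Littlewood-Richardson coefficients\<close>

lemma schur_product_Nil: "schur_product [] = ps_one"
  by (simp add: schur_product_def)

lemma schur_product_Cons: "schur_product (\<beta> # \<beta>s) = ps_mult (schur \<beta>) (schur_product \<beta>s)"
  by (simp add: schur_product_def)

lemma schur_product_symmetric_homogeneous:
  assumes "\<forall>\<beta>\<in>set \<beta>s. is_partition \<beta>"
  shows "symmetric_series (schur_product \<beta>s) \<and> homogeneous (sum_list (map sum_list \<beta>s)) (schur_product \<beta>s)"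
  using assms
proof (induction \<beta>s)
  case Nil
  show ?case by (auto simp: schur_product_Nil symmetric_series_def homogeneous_def ps_one_def)
next
  case (Cons \<beta> \<beta>s)
  have "homogeneous (sum_list \<beta>) (schur \<beta>)" using Cons.prems schur_eq_0 by (simp add: homogeneous_def)
  then show ?case
    using Cons schur_symmetric[of \<beta>]
    by (simp add: schur_product_Cons symmetric_ps_mult homogeneous_ps_mult)
qed

text \<open>Evaluating equal Schur functions at each other's row contents gives the value 1 twice,
  so the two partitions dominate each other.\<close>

lemma schur_inj: "inj_on schur (Collect is_partition)"
proof (rule inj_onI)
  fix \<alpha> \<beta> assume *: "\<alpha> \<in> Collect is_partition" "\<beta> \<in> Collect is_partition" "schur \<alpha> = schur \<beta>"
  then have p: "is_partition \<alpha>" "is_partition \<beta>" by auto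
  have "schur \<alpha> (row_content \<beta>) = 1" "schur \<beta> (row_content \<alpha>) = 1"
    using *(3) schur_row_content_self p by simp_all (metis schur_row_content_self)
  then show "\<alpha> = \<beta>"
    using schur_row_content_dominates p by (intro dominates_antisym) auto
qed

lemma sum_fun_apply: "(\<Sum>i\<in>A. f i) x = (\<Sum>i\<in>A. f i x)" for f :: "'i \<Rightarrow> 'b \<Rightarrow> 'a::comm_monoid_add"
  by (induction A rule: infinite_finite_induct) auto

text \<open>Homogeneity separates the degrees: at a content of size \<open>d\<close> only partitions
  of \<open>d\<close> contribute, so a finite relation breaks up into unitriangular systems.\<close>

lemma independent_schur: "fmod.independent (schur ` Collect is_partition)"
  unfolding fmod.independent_explicit_module
proof (intro allI impI)
  fix t u v assume t: "finite t" "t \<subseteq> schur ` Collect is_partition" "v \<in> t"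
    and z: "(\<Sum>v\<in>t. fscale (u v) v) = (0 :: power_series)"
  obtain P where P: "P \<subseteq> Collect is_partition" "t = schur ` P"
    using t(2) by (auto simp: subset_image_iff)
  obtain \<alpha> where \<alpha>: "\<alpha> \<in> P" "v = schur \<alpha>" using t(3) P by auto
  have injP: "inj_on schur P" using schur_inj P(1) by (rule inj_on_subset)
  have finP: "finite P" using t(1) P(2) injP by (simp add: finite_image_iff)
  define d where "d = sum_list \<alpha>"
  \<comment> \<open>Extends the coefficients of the relation by 0 to all partitions of
    \<open>d\<close>.\<close>
  define x where "x \<beta> = (if \<beta> \<in> P then u (schur \<beta>) else 0)" for \<beta>
  have "x \<alpha> = 0"
  proof (rule schur_coeffs_unique[where d = d])
    show "\<alpha> \<in> partitions_of d" using \<alpha> P by (auto simp: d_def partitions_of_def)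
    fix \<mu> assume \<mu>: "\<mu> \<in> partitions_of d"
    have "(\<Sum>\<beta>\<in>P. u (schur \<beta>) * schur \<beta> (row_content \<mu>)) = (\<Sum>v\<in>t. fscale (u v) v) (row_content \<mu>)"
      unfolding sum_fun_apply P(2) by (simp add: sum.reindex[OF injP] fscale_def)
    also have "\<dots> = 0" using z by simp
    finally have 0: "(\<Sum>\<beta>\<in>P. u (schur \<beta>) * schur \<beta> (row_content \<mu>)) = 0" .
    have "(\<Sum>\<beta>\<in>partitions_of d. x \<beta> * schur \<beta> (row_content \<mu>)) =
        (\<Sum>\<beta>\<in>P \<inter> partitions_of d. u (schur \<beta>) * schur \<beta> (row_content \<mu>))"
      by (rule sum.mono_neutral_cong_right) (auto simp: x_def finite_partitions_of)
    also have "\<dots> = (\<Sum>\<beta>\<in>P. u (schur \<beta>) * schur \<beta> (row_content \<mu>))"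
    proof (rule sum.mono_neutral_left[OF finP])
      show "\<forall>\<beta>\<in>P - P \<inter> partitions_of d. u (schur \<beta>) * schur \<beta> (row_content \<mu>) = 0"
      proof
        fix \<beta> assume "\<beta> \<in> P - P \<inter> partitions_of d"
        then have "schur \<beta> (row_content \<mu>) = 0"
          using P(1) \<mu> by (intro schur_eq_0) (auto simp: partitions_of_def size_row_content)
        then show "u (schur \<beta>) * schur \<beta> (row_content \<mu>) = 0" by simp
      qed
    qed auto
    finally show "(\<Sum>\<beta>\<in>partitions_of d. x \<beta> * of_int (schur \<beta> (row_content \<mu>))) = 0" using 0 by simp
  qed
  then show "u v = 0" using \<alpha> by (simp add: x_def)
qed

text \<open>\<open>fmod.representation\<close> is 0 outside the span, so the value of
  \<open>lr_coeff\<close> is meaningful only once an expansion is known; independence then makes any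
  such expansion the one that is meant.\<close>

lemma lr_coeff_eq:
  assumes "schur_product \<beta>s = (\<lambda>M. \<Sum>\<alpha>\<in>partitions_of d. x \<alpha> * schur \<alpha> M)" "is_partition \<mu>"
  shows "lr_coeff \<mu> \<beta>s = (if sum_list \<mu> = d then x \<mu> else 0)"
proof -
  let ?S = "schur ` Collect is_partition"
  have "(\<Sum>\<alpha>\<in>partitions_of d. fscale (x \<alpha>) (schur \<alpha>)) = schur_product \<beta>s"
    unfolding assms(1) by (rule ext) (simp add: sum_fun_apply fscale_def)
  moreover have in_span: "fscale (x \<alpha>) (schur \<alpha>) \<in> fmod.span ?S" if "\<alpha> \<in> partitions_of d" for \<alpha>
    using that by (intro fmod.span_scale fmod.span_base) (auto simp: partitions_of_def)
  ultimately have "fmod.representation ?S (schur_product \<beta>s) =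
      (\<lambda>b. \<Sum>\<alpha>\<in>partitions_of d. fmod.representation ?S (fscale (x \<alpha>) (schur \<alpha>)) b)"
    using fmod.representation_sum[OF independent_schur, of "partitions_of d" "\<lambda>\<alpha>. fscale (x \<alpha>) (schur \<alpha>)"] by simp
  then have "lr_coeff \<mu> \<beta>s = (\<Sum>\<alpha>\<in>partitions_of d. fmod.representation ?S (fscale (x \<alpha>) (schur \<alpha>)) (schur \<mu>))"
    by (simp add: lr_coeff_def)
  also have "\<dots> = (\<Sum>\<alpha>\<in>partitions_of d. if \<alpha> = \<mu> then x \<mu> else 0)"
  proof (rule sum.cong[OF refl])
    fix \<alpha> assume "\<alpha> \<in> partitions_of d"
    then have \<alpha>: "is_partition \<alpha>" by (simp add: partitions_of_def)
    have "schur \<mu> = schur \<alpha> \<longleftrightarrow> \<alpha> = \<mu>" using schur_inj \<alpha> assms(2) by (auto simp: inj_on_def)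
    then show "fmod.representation ?S (fscale (x \<alpha>) (schur \<alpha>)) (schur \<mu>) = (if \<alpha> = \<mu> then x \<mu> else 0)"
      using \<alpha> by (simp add: fmod.representation_scale fmod.representation_basis independent_schur fmod.span_base)
  qed
  also have "\<dots> = (if sum_list \<mu> = d then x \<mu> else 0)"
    using assms(2) by (simp add: finite_partitions_of) (simp add: partitions_of_def)
  finally show ?thesis .
qed

lemma schur_product_expansion:
  assumes "\<forall>\<beta>\<in>set \<beta>s. is_partition \<beta>" "sum_list (map sum_list \<beta>s) = d"
  shows "schur_product \<beta>s M = (\<Sum>\<alpha>\<in>partitions_of d. lr_coeff \<alpha> \<beta>s * schur \<alpha> M)"
    and "is_partition \<mu> \<Longrightarrow> sum_list \<mu> \<noteq> d \<Longrightarrow> lr_coeff \<mu> \<beta>s = 0"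
proof -
  obtain x where x: "\<And>M. schur_product \<beta>s M = (\<Sum>\<alpha>\<in>partitions_of d. x \<alpha> * schur \<alpha> M)"
    using schur_expansion[of "schur_product \<beta>s" d] schur_product_symmetric_homogeneous[OF assms(1)] assms(2)
    by blast
  then have eq: "schur_product \<beta>s = (\<lambda>M. \<Sum>\<alpha>\<in>partitions_of d. x \<alpha> * schur \<alpha> M)" by blast
  show "is_partition \<mu> \<Longrightarrow> sum_list \<mu> \<noteq> d \<Longrightarrow> lr_coeff \<mu> \<beta>s = 0"
    using lr_coeff_eq[OF eq] by simp
  show "schur_product \<beta>s M = (\<Sum>\<alpha>\<in>partitions_of d. lr_coeff \<alpha> \<beta>s * schur \<alpha> M)"
    unfolding x by (rule sum.cong) (auto simp: lr_coeff_eq[OF eq] partitions_of_def)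
qed

lemma sum_swap3: "(\<Sum>b\<in>B. \<Sum>c\<in>C. \<Sum>x\<in>X. f b c x) = (\<Sum>x\<in>X. \<Sum>b\<in>B. \<Sum>c\<in>C. f b c x)"
proof -
  have "(\<Sum>b\<in>B. \<Sum>c\<in>C. \<Sum>x\<in>X. f b c x) = (\<Sum>b\<in>B. \<Sum>x\<in>X. \<Sum>c\<in>C. f b c x)"
    by (intro sum.cong refl sum.swap)
  also have "\<dots> = (\<Sum>x\<in>X. \<Sum>b\<in>B. \<Sum>c\<in>C. f b c x)" by (rule sum.swap)
  finally show ?thesis .
qed

section \<open>Multiplying the alphabet\<close>

text \<open>Its cardinality is a coefficient of the \<open>n\<close>-th power of the Cauchy kernel:
  each of the \<open>n\<close> factors supplies the pairs of one colour.\<close>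

definition coloured_pairs :: "nat \<Rightarrow> 'a multiset \<Rightarrow> 'b multiset \<Rightarrow> ((nat \<times> 'a) \<times> 'b) multiset set" where
  "coloured_pairs n M M' =
     {Q. (\<forall>q\<in>#Q. fst (fst q) < n) \<and> image_mset (\<lambda>q. snd (fst q)) Q = M \<and> image_mset snd Q = M'}"

lemma finite_coloured_pairs: "finite (coloured_pairs n M M')"
proof (rule finite_subset)
  show "coloured_pairs n M M' \<subseteq> multisets_of_size (({..<n} \<times> set_mset M) \<times> set_mset M') (size M)"
  proof
    fix Q assume Q: "Q \<in> coloured_pairs n M M'"
    have "q \<in> ({..<n} \<times> set_mset M) \<times> set_mset M'" if "q \<in># Q" for q
    proof -
      have "snd (fst q) \<in># image_mset (\<lambda>q. snd (fst q)) Q" "snd q \<in># image_mset snd Q"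
        using that by auto
      moreover have "image_mset (\<lambda>q. snd (fst q)) Q = M" "image_mset snd Q = M'" "fst (fst q) < n"
        using Q that by (auto simp: coloured_pairs_def)
      ultimately show ?thesis by (simp add: mem_Times_iff)
    qed
    moreover have "size Q = size M" using Q by (auto simp: coloured_pairs_def)
    ultimately show "Q \<in> multisets_of_size (({..<n} \<times> set_mset M) \<times> set_mset M') (size M)"
      unfolding multisets_of_size_def by blast
  qed
qed (auto intro: finite_multisets_of_size)

lemma card_coloured_pairs_0: "card (coloured_pairs 0 M M') = (if M = {#} \<and> M' = {#} then 1 else 0)"
proof -
  have "coloured_pairs 0 M M' = (if M = {#} \<and> M' = {#} then {{#}} else {})"
  proof (intro equalityI subsetI)
    fix Q assume "Q \<in> coloured_pairs 0 M M'"
    then have q: "\<forall>q\<in>#Q. fst (fst q) < 0" and M: "image_mset (\<lambda>q. snd (fst q)) Q = M" "image_mset snd Q = M'"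
      unfolding coloured_pairs_def by blast+
    have "Q = {#}"
    proof (rule ccontr)
      assume "Q \<noteq> {#}"
      then obtain q where "q \<in># Q" by (rule multiset_nonemptyE)
      then have "fst (fst q) < 0" using q by blast
      then show False by simp
    qed
    then show "Q \<in> (if M = {#} \<and> M' = {#} then {{#}} else {})" using M by auto
  qed (auto simp: coloured_pairs_def split: if_splits)
  then show ?thesis by simp
qed

text \<open>The pairs of the new colour \<open>n\<close> are the contribution of one more factor of
  the kernel, with margins \<open>A\<close> and \<open>A'\<close>; the pairs of smaller colour have
  the complementary margins.\<close>

lemma card_coloured_pairs_Suc:
  fixes M :: "'a multiset" and M' :: "'b multiset"
  shows "card (coloured_pairs (Suc n) M M') =
    (\<Sum>A | A \<subseteq># M. \<Sum>A' | A' \<subseteq># M'. pair_count A A' * card (coloured_pairs n (M - A) (M' - A')))"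
proof -
  let ?P = "\<lambda>A A'. {P. image_mset fst P = A \<and> image_mset snd P = A'}"
  let ?S = "Sigma {A. A \<subseteq># M} (\<lambda>A. Sigma {A'. A' \<subseteq># M'} (\<lambda>A'. ?P A A' \<times> coloured_pairs n (M - A) (M' - A')))"
  let ?e = "\<lambda>q :: (nat \<times> 'a) \<times> 'b. (snd (fst q), snd q)"
  let ?c = "\<lambda>p :: 'a \<times> 'b. ((n, fst p), snd p)"
  let ?top = "\<lambda>Q :: ((nat \<times> 'a) \<times> 'b) multiset. filter_mset (\<lambda>q. fst (fst q) = n) Q"
  let ?low = "\<lambda>Q :: ((nat \<times> 'a) \<times> 'b) multiset. filter_mset (\<lambda>q. fst (fst q) \<noteq> n) Q"
  let ?j = "\<lambda>Q. (image_mset (\<lambda>q. snd (fst q)) (?top Q), image_mset snd (?top Q), image_mset ?e (?top Q), ?low Q)"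
  let ?i = "\<lambda>(A, A', P, Q). image_mset ?c P + Q"
  have "bij_betw ?j (coloured_pairs (Suc n) M M') ?S"
  proof (rule bij_betw_byWitness[where f' = ?i])
    show "\<forall>Q\<in>coloured_pairs (Suc n) M M'. ?i (?j Q) = Q"
    proof
      fix Q :: "((nat \<times> 'a) \<times> 'b) multiset"
      have "image_mset (?c \<circ> ?e) (?top Q) = image_mset id (?top Q)"
        by (rule image_mset_cong) auto
      then have "image_mset ?c (image_mset ?e (?top Q)) = ?top Q" by (simp add: multiset.map_comp)
      then show "?i (?j Q) = Q" by (simp only: prod.case multiset_partition[symmetric])
    qed
    show "\<forall>x\<in>?S. ?j (?i x) = x"
    proof
      fix x assume "x \<in> ?S"
      then obtain A A' P Q where x: "x = (A, A', P, Q)" and P: "P \<in> ?P A A'"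
        and Q: "Q \<in> coloured_pairs n (M - A) (M' - A')" by blast
      have lt: "fst (fst q) < n" if "q \<in># Q" for q using Q that unfolding coloured_pairs_def by blast
      have t: "?top (image_mset ?c P + Q) = image_mset ?c P"
      proof -
        have "?top Q = {#}" using lt by (simp add: less_imp_neq del: split_paired_All)
        moreover have "?top (image_mset ?c P) = image_mset ?c P" by (simp add: filter_mset_image_mset)
        ultimately show ?thesis by simp
      qed
      \<comment> \<open>\<open>?top\<close> and \<open>?low\<close> split any multiset, so knowing
        the top part leaves the rest by cancellation.\<close>
      have l: "?low (image_mset ?c P + Q) = Q"
        using multiset_partition[of "image_mset ?c P + Q" "\<lambda>q. fst (fst q) = n"]
        unfolding t by (rule add_left_imp_eq[OF sym])
      have "image_mset (\<lambda>q. snd (fst q)) (image_mset ?c P) = A" "image_mset snd (image_mset ?c P) = A'"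
        "image_mset ?e (image_mset ?c P) = P"
        using P by (auto simp: multiset.map_comp comp_def)
      then show "?j (?i x) = x" unfolding x prod.case t l by simp
    qed
    show "?j ` coloured_pairs (Suc n) M M' \<subseteq> ?S"
    proof
      fix x assume "x \<in> ?j ` coloured_pairs (Suc n) M M'"
      then obtain Q where x: "x = ?j Q" and Q: "Q \<in> coloured_pairs (Suc n) M M'" by blast
      have M: "M = image_mset (\<lambda>q. snd (fst q)) (?top Q) + image_mset (\<lambda>q. snd (fst q)) (?low Q)"
        and M': "M' = image_mset snd (?top Q) + image_mset snd (?low Q)"
        using Q unfolding coloured_pairs_def image_mset_union[symmetric] multiset_partition[symmetric] by simp_all
      have "\<forall>q\<in>#?low Q. fst (fst q) < n"
        using Q by (auto simp: coloured_pairs_def less_Suc_eq)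
      moreover have "M - image_mset (\<lambda>q. snd (fst q)) (?top Q) = image_mset (\<lambda>q. snd (fst q)) (?low Q)"
        "M' - image_mset snd (?top Q) = image_mset snd (?low Q)"
        using M M' by (metis add_diff_cancel_left')+
      moreover have "image_mset (\<lambda>q. snd (fst q)) (?top Q) \<subseteq># M" "image_mset snd (?top Q) \<subseteq># M'"
        using M M' by (metis mset_subset_eq_add_left)+
      ultimately show "x \<in> ?S" unfolding x by (simp add: coloured_pairs_def multiset.map_comp comp_def)
    qed
    show "?i ` ?S \<subseteq> coloured_pairs (Suc n) M M'"
    proof
      fix x assume "x \<in> ?i ` ?S"
      then obtain A A' P Q where x: "x = image_mset ?c P + Q" and A: "A \<subseteq># M" "A' \<subseteq># M'"
        and P: "image_mset fst P = A" "image_mset snd P = A'"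
        and Q: "\<forall>q\<in>#Q. fst (fst q) < n" "image_mset (\<lambda>q. snd (fst q)) Q = M - A" "image_mset snd Q = M' - A'"
      proof -
        obtain y where "y \<in> ?S" "x = ?i y" using \<open>x \<in> _\<close> by blast
        then show thesis using that by (cases y) (auto simp: coloured_pairs_def)
      qed
      show "x \<in> coloured_pairs (Suc n) M M'"
        using A P Q unfolding x coloured_pairs_def
        by (auto simp: multiset.map_comp comp_def less_Suc_eq)
    qed
  qed
  then have "card (coloured_pairs (Suc n) M M') = card ?S" by (rule bij_betw_same_card)
  also have "\<dots> = (\<Sum>A | A \<subseteq># M. card (Sigma {A'. A' \<subseteq># M'} (\<lambda>A'. ?P A A' \<times> coloured_pairs n (M - A) (M' - A'))))"
    by (intro card_SigmaI ballI finite_SigmaI finite_cartesian_product finite_pair_msets finite_coloured_pairs)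
      (use finite_submsets[of _ "\<lambda>_. True"] in auto)
  also have "\<dots> = (\<Sum>A | A \<subseteq># M. \<Sum>A' | A' \<subseteq># M'. card (?P A A' \<times> coloured_pairs n (M - A) (M' - A')))"
    by (intro sum.cong refl card_SigmaI ballI finite_cartesian_product finite_pair_msets finite_coloured_pairs)
      (use finite_submsets[of _ "\<lambda>_. True"] in auto)
  finally show ?thesis by (simp add: card_cartesian_product pair_count_def)
qed

lemma finite_image_mset_fibre:
  fixes g :: "'a \<Rightarrow> 'b"
  assumes "\<And>y. y \<in># M \<Longrightarrow> finite {x. g x = y}"
  shows "finite {N. image_mset g N = M}"
proof (rule finite_subset)
  show "{N. image_mset g N = M} \<subseteq> multisets_of_size (\<Union>y\<in>set_mset M. {x. g x = y}) (size M)"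
    by (auto simp: multisets_of_size_def)
qed (use assms in auto)

lemma finite_div_fibre: "n > 0 \<Longrightarrow> finite {k :: nat. k div n = y}"
  by (rule finite_subset[of _ "{..<Suc y * n}"]) (auto simp: div_less_iff_less_mult[symmetric] simp del: mult_Suc)

text \<open>A letter \<open>y\<close> and a colour \<open>c < n\<close> merge into the single letter
  \<open>y * n + c\<close>, from which \<open>div\<close> and \<open>mod\<close> recover them. The
  power of the kernel thereby becomes a single kernel over the enlarged alphabet.\<close>

lemma card_coloured_pairs_div:
  fixes M :: "nat multiset" and M' :: "'b multiset"
  assumes n: "n > 0"
  shows "card (coloured_pairs n M M') = (\<Sum>N | image_mset (\<lambda>k. k div n) N = M. pair_count N M')"
proof -
  let ?P = "\<lambda>N. {P. image_mset fst P = N \<and> image_mset snd P = M'}"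
  let ?S = "Sigma {N. image_mset (\<lambda>k. k div n) N = M} ?P"
  let ?g = "\<lambda>q :: (nat \<times> nat) \<times> 'b. (snd (fst q) * n + fst (fst q), snd q)"
  let ?h = "\<lambda>p :: nat \<times> 'b. ((fst p mod n, fst p div n), snd p)"
  have "bij_betw (\<lambda>Q. (image_mset (\<lambda>q. fst (?g q)) Q, image_mset ?g Q)) (coloured_pairs n M M') ?S"
  proof (rule bij_betw_byWitness[where f' = "\<lambda>(N, P). image_mset ?h P"])
    have gh: "image_mset ?g (image_mset ?h P) = P" for P
      by (simp add: multiset.map_comp comp_def)
    show "\<forall>Q\<in>coloured_pairs n M M'. (\<lambda>(N, P). image_mset ?h P) (image_mset (\<lambda>q. fst (?g q)) Q, image_mset ?g Q) = Q"
    proof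
      fix Q assume Q: "Q \<in> coloured_pairs n M M'"
      have "image_mset (?h \<circ> ?g) Q = image_mset id Q"
      proof (rule image_mset_cong)
        fix q assume "q \<in># Q"
        then have "fst (fst q) < n" using Q by (auto simp: coloured_pairs_def)
        then show "(?h \<circ> ?g) q = id q" by (cases q) (auto simp: div_add1_eq)
      qed
      then show "(\<lambda>(N, P). image_mset ?h P) (image_mset (\<lambda>q. fst (?g q)) Q, image_mset ?g Q) = Q"
        by (simp add: multiset.map_comp)
    qed
    show "\<forall>x\<in>?S. (image_mset (\<lambda>q. fst (?g q)) ((\<lambda>(N, P). image_mset ?h P) x), image_mset ?g ((\<lambda>(N, P). image_mset ?h P) x)) = x"
    proof
      fix x assume "x \<in> ?S"
      then obtain P where x: "x = (image_mset fst P, P)" by blast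
      show "(image_mset (\<lambda>q. fst (?g q)) ((\<lambda>(N, P). image_mset ?h P) x),
          image_mset ?g ((\<lambda>(N, P). image_mset ?h P) x)) = x"
        unfolding x prod.case gh by (simp add: multiset.map_comp comp_def)
    qed
    show "(\<lambda>Q. (image_mset (\<lambda>q. fst (?g q)) Q, image_mset ?g Q)) ` coloured_pairs n M M' \<subseteq> ?S"
    proof
      fix x assume "x \<in> (\<lambda>Q. (image_mset (\<lambda>q. fst (?g q)) Q, image_mset ?g Q)) ` coloured_pairs n M M'"
      then obtain Q where x: "x = (image_mset (\<lambda>q. fst (?g q)) Q, image_mset ?g Q)"
        and Q: "Q \<in> coloured_pairs n M M'" by blast
      have "image_mset (\<lambda>q. fst (?g q) div n) Q = image_mset (\<lambda>q. snd (fst q)) Q"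
      proof (rule image_mset_cong)
        fix q assume "q \<in># Q"
        then have "fst (fst q) < n" using Q by (auto simp: coloured_pairs_def)
        then show "fst (?g q) div n = snd (fst q)" by (auto simp: div_add1_eq)
      qed
      then show "x \<in> ?S" using Q by (simp add: x coloured_pairs_def multiset.map_comp comp_def)
    qed
    show "(\<lambda>(N, P). image_mset ?h P) ` ?S \<subseteq> coloured_pairs n M M'"
    proof
      fix x assume "x \<in> (\<lambda>(N, P). image_mset ?h P) ` ?S"
      then obtain P where x: "x = image_mset ?h P" and P: "image_mset (\<lambda>k. k div n) (image_mset fst P) = M"
          "image_mset snd P = M'"
      proof -
        obtain y where "y \<in> ?S" "x = (\<lambda>(N, P). image_mset ?h P) y" using \<open>x \<in> _\<close> by blast
        then show thesis using that by (cases y) simp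
      qed
      show "x \<in> coloured_pairs n M M'"
        using n P unfolding x coloured_pairs_def by (simp add: multiset.map_comp comp_def)
    qed
  qed
  then have "card (coloured_pairs n M M') = card ?S" by (rule bij_betw_same_card)
  also have "\<dots> = (\<Sum>N | image_mset (\<lambda>k. k div n) N = M. card (?P N))"
    by (intro card_SigmaI ballI finite_pair_msets finite_image_mset_fibre finite_div_fibre n)
  finally show ?thesis by (simp add: pair_count_def)
qed

section \<open>The generating function of the matrix\<close>

lemma finite_partitions_le: "finite {\<beta>. is_partition \<beta> \<and> sum_list \<beta> \<le> D}"
proof -
  have "{\<beta>. is_partition \<beta> \<and> sum_list \<beta> \<le> D} = (\<Union>d\<in>{..D}. partitions_of d)"
    by (auto simp: partitions_of_def)
  then show ?thesis by (simp add: finite_partitions_of)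
qed

text \<open>With one index set for all degrees up to \<open>D\<close>, a sum over tuples of
  partitions factors into sums over their components.\<close>

lemma schur_cauchy_le:
  assumes "size A \<le> D"
  shows "(\<Sum>\<beta> | is_partition \<beta> \<and> sum_list \<beta> \<le> D. schur \<beta> A * schur \<beta> A') = int (pair_count A A')"
proof -
  have "(\<Sum>\<beta> | is_partition \<beta> \<and> sum_list \<beta> \<le> D. schur \<beta> A * schur \<beta> A') =
      (\<Sum>\<beta>\<in>partitions_of (size A). schur \<beta> A * schur \<beta> A')"
  proof (rule sum.mono_neutral_right[OF finite_partitions_le])
    show "partitions_of (size A) \<subseteq> {\<beta>. is_partition \<beta> \<and> sum_list \<beta> \<le> D}"
      using assms by (auto simp: partitions_of_def)
    show "\<forall>\<beta>\<in>{\<beta>. is_partition \<beta> \<and> sum_list \<beta> \<le> D} - partitions_of (size A). schur \<beta> A * schur \<beta> A' = 0"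
    proof
      fix \<beta> assume "\<beta> \<in> {\<beta>. is_partition \<beta> \<and> sum_list \<beta> \<le> D} - partitions_of (size A)"
      then have "schur \<beta> A = 0" by (intro schur_eq_0) (auto simp: partitions_of_def)
      then show "schur \<beta> A * schur \<beta> A' = 0" by simp
    qed
  qed
  then show ?thesis by (simp add: schur_cauchy)
qed

lemma lists_length_Suc_eq: "{xs. set xs \<subseteq> A \<and> length xs = Suc n} = (\<lambda>(x, xs). x # xs) ` (A \<times> {xs. set xs \<subseteq> A \<and> length xs = n})"
  by (auto simp: length_Suc_conv image_iff)

lemma sum_lists_Suc:
  "(\<Sum>xs | set xs \<subseteq> A \<and> length xs = Suc n. h xs) = (\<Sum>x\<in>A. \<Sum>xs | set xs \<subseteq> A \<and> length xs = n. h (x # xs))"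
proof -
  have "inj_on (\<lambda>(x, xs). x # xs) (A \<times> {xs. set xs \<subseteq> A \<and> length xs = n})" by (auto simp: inj_on_def)
  then show ?thesis
    unfolding lists_length_Suc_eq sum.cartesian_product by (subst sum.reindex) (auto simp: split_beta)
qed

text \<open>The \<open>n\<close>-th power of Cauchy's identity, built up one component of the tuple
  at a time.\<close>

lemma schur_product_cauchy:
  assumes "size M \<le> D"
  shows "(\<Sum>\<beta>s | set \<beta>s \<subseteq> {\<beta>. is_partition \<beta> \<and> sum_list \<beta> \<le> D} \<and> length \<beta>s = n.
      schur_product \<beta>s M * schur_product \<beta>s M') = int (card (coloured_pairs n M M'))"
  using assms
proof (induction n arbitrary: M M')
  case 0
  have "{\<beta>s :: nat list list. set \<beta>s \<subseteq> {\<beta>. is_partition \<beta> \<and> sum_list \<beta> \<le> D} \<and> length \<beta>s = 0} = {[]}" by auto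
  then show ?case by (simp add: schur_product_Nil ps_one_def card_coloured_pairs_0)
next
  case (Suc n)
  let ?P = "{\<beta>. is_partition \<beta> \<and> sum_list \<beta> \<le> D}"
  let ?L = "{\<beta>s. set \<beta>s \<subseteq> ?P \<and> length \<beta>s = n}"
  have "(\<Sum>\<beta>s | set \<beta>s \<subseteq> ?P \<and> length \<beta>s = Suc n. schur_product \<beta>s M * schur_product \<beta>s M') =
      (\<Sum>\<beta>\<in>?P. \<Sum>\<beta>s\<in>?L. \<Sum>A | A \<subseteq># M. \<Sum>A' | A' \<subseteq># M'.
        (schur \<beta> A * schur \<beta> A') * (schur_product \<beta>s (M - A) * schur_product \<beta>s (M' - A')))"
    unfolding sum_lists_Suc
    unfolding schur_product_Cons ps_mult_def sum_product
    by (intro sum.cong refl) (simp only: mult_ac)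
  also have "\<dots> = (\<Sum>A | A \<subseteq># M. \<Sum>A' | A' \<subseteq># M'. \<Sum>\<beta>\<in>?P. \<Sum>\<beta>s\<in>?L.
        (schur \<beta> A * schur \<beta> A') * (schur_product \<beta>s (M - A) * schur_product \<beta>s (M' - A')))"
    by (subst sum_swap3) (intro sum.cong refl sum_swap3)
  also have "\<dots> = (\<Sum>A | A \<subseteq># M. \<Sum>A' | A' \<subseteq># M'. (\<Sum>\<beta>\<in>?P. schur \<beta> A * schur \<beta> A') *
        (\<Sum>\<beta>s\<in>?L. schur_product \<beta>s (M - A) * schur_product \<beta>s (M' - A')))"
    by (simp only: sum_product)
  also have "\<dots> = (\<Sum>A | A \<subseteq># M. \<Sum>A' | A' \<subseteq># M'. int (pair_count A A') * int (card (coloured_pairs n (M - A) (M' - A'))))"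
  proof (intro sum.cong refl arg_cong2[where f = "(*)"])
    fix A A' assume "A \<in> {A. A \<subseteq># M}" "A' \<in> {A'. A' \<subseteq># M'}"
    then have A: "A \<subseteq># M" by simp
    have "size A \<le> D" using size_mset_mono[OF A] Suc.prems by simp
    then show "(\<Sum>\<beta>\<in>?P. schur \<beta> A * schur \<beta> A') = int (pair_count A A')" by (rule schur_cauchy_le)
    have "size (M - A) \<le> D" using size_Diff_submset[OF A] Suc.prems by simp
    then show "(\<Sum>\<beta>s\<in>?L. schur_product \<beta>s (M - A) * schur_product \<beta>s (M' - A')) =
        int (card (coloured_pairs n (M - A) (M' - A')))" by (rule Suc.IH)
  qed
  also have "\<dots> = int (card (coloured_pairs (Suc n) M M'))"
    by (simp add: card_coloured_pairs_Suc of_nat_sum)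
  finally show ?case .
qed

text \<open>Replaces the index set depending on \<alpha> and \<mu> by a common finite one: a nonzero
  coefficient forces the sizes in the tuple to add up to \<open>d\<close>, so each of them is at
  most \<open>d\<close>. Empty partitions are allowed in the tuple.\<close>

lemma a_coeff_eq_sum:
  assumes "\<alpha> \<in> partitions_of d"
  shows "a_coeff n \<alpha> \<mu> = (\<Sum>\<beta>s | set \<beta>s \<subseteq> {\<beta>. is_partition \<beta> \<and> sum_list \<beta> \<le> d} \<and> length \<beta>s = n.
     lr_coeff \<alpha> \<beta>s * lr_coeff \<mu> \<beta>s)"
  unfolding a_coeff_def
proof (rule sum.mono_neutral_left)
  show "finite {\<beta>s. set \<beta>s \<subseteq> {\<beta>. is_partition \<beta> \<and> sum_list \<beta> \<le> d} \<and> length \<beta>s = n}"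
    by (rule finite_lists_length_eq[OF finite_partitions_le])
  show "{\<beta>s. length \<beta>s = n \<and> (\<forall>\<beta>\<in>set \<beta>s. is_partition \<beta>) \<and> lr_coeff \<alpha> \<beta>s * lr_coeff \<mu> \<beta>s \<noteq> 0}
      \<subseteq> {\<beta>s. set \<beta>s \<subseteq> {\<beta>. is_partition \<beta> \<and> sum_list \<beta> \<le> d} \<and> length \<beta>s = n}"
  proof safe
    fix \<beta>s \<beta> assume \<beta>s: "\<forall>\<beta>\<in>set \<beta>s. is_partition \<beta>" "lr_coeff \<alpha> \<beta>s * lr_coeff \<mu> \<beta>s \<noteq> 0" "\<beta> \<in> set \<beta>s"
    then have "sum_list (map sum_list \<beta>s) = d"
      using schur_product_expansion(2)[OF \<beta>s(1) refl, of \<alpha>] assms by (force simp: partitions_of_def)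
    moreover have "sum_list \<beta> \<le> sum_list (map sum_list \<beta>s)"
      by (rule member_le_sum_list) (use \<beta>s(3) in auto)
    ultimately show "sum_list \<beta> \<le> d" by simp
  qed auto
qed auto

lemma a_coeff_commute: "a_coeff n \<alpha> \<mu> = a_coeff n \<mu> \<alpha>"
  by (simp add: a_coeff_def mult.commute)

lemma schur_product_expansion_size:
  assumes "\<forall>\<beta>\<in>set \<beta>s. is_partition \<beta>"
  shows "schur_product \<beta>s M = (\<Sum>\<alpha>\<in>partitions_of (size M). lr_coeff \<alpha> \<beta>s * schur \<alpha> M)"
proof (cases "sum_list (map sum_list \<beta>s) = size M")
  case True
  then show ?thesis using schur_product_expansion(1)[OF assms True] by simp
next
  case False
  then have "schur_product \<beta>s M = 0"
    using schur_product_symmetric_homogeneous[OF assms] by (auto simp: homogeneous_def)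
  moreover have "(\<Sum>\<alpha>\<in>partitions_of (size M). lr_coeff \<alpha> \<beta>s * schur \<alpha> M) = 0"
    by (rule sum.neutral) (use schur_product_expansion(2)[OF assms refl] False in \<open>auto simp: partitions_of_def\<close>)
  ultimately show ?thesis by simp
qed

text \<open>Since \<open>a_coeff\<close> is a sum of products of two Littlewood-Richardson
  coefficients, the double sum separates, for each tuple, into the Schur expansions of one product
  in two alphabets.\<close>

lemma a_coeff_kernel:
  assumes "size M = d" "size M' = d"
  shows "(\<Sum>\<alpha>\<in>partitions_of d. \<Sum>\<mu>\<in>partitions_of d. a_coeff n \<alpha> \<mu> * (schur \<alpha> M * schur \<mu> M')) =
    int (card (coloured_pairs n M M'))"
proof -
  let ?L = "{\<beta>s. set \<beta>s \<subseteq> {\<beta>. is_partition \<beta> \<and> sum_list \<beta> \<le> d} \<and> length \<beta>s = n}"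
  have "(\<Sum>\<alpha>\<in>partitions_of d. \<Sum>\<mu>\<in>partitions_of d. a_coeff n \<alpha> \<mu> * (schur \<alpha> M * schur \<mu> M')) =
    (\<Sum>\<alpha>\<in>partitions_of d. \<Sum>\<mu>\<in>partitions_of d. \<Sum>\<beta>s\<in>?L. (lr_coeff \<alpha> \<beta>s * schur \<alpha> M) * (lr_coeff \<mu> \<beta>s * schur \<mu> M'))"
    by (intro sum.cong refl) (simp add: a_coeff_eq_sum sum_distrib_left sum_distrib_right mult_ac)
  also have "\<dots> = (\<Sum>\<beta>s\<in>?L. \<Sum>\<alpha>\<in>partitions_of d. \<Sum>\<mu>\<in>partitions_of d. (lr_coeff \<alpha> \<beta>s * schur \<alpha> M) * (lr_coeff \<mu> \<beta>s * schur \<mu> M'))"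
    by (rule sum_swap3)
  also have "\<dots> = (\<Sum>\<beta>s\<in>?L. schur_product \<beta>s M * schur_product \<beta>s M')"
    by (rule sum.cong[OF refl])
      (use assms in \<open>auto simp: sum_product[symmetric] schur_product_expansion_size subset_iff\<close>)
  also have "\<dots> = int (card (coloured_pairs n M M'))"
    by (rule schur_product_cauchy) (simp add: assms)
  finally show ?thesis .
qed

text \<open>In the language of plethysm, this is the expansion of \<open>s\<^sub>\<alpha>[n X]\<close> in Schur functions: the
  variables \<open>k\<close> with the same quotient \<open>k div n\<close> are the \<open>n\<close> copies of one variable.\<close>

lemma schur_multiply_alphabet:
  assumes "n > 0" "\<alpha> \<in> partitions_of (size M)"
  shows "(\<Sum>\<mu>\<in>partitions_of (size M). a_coeff n \<alpha> \<mu> * schur \<mu> M) =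
    (\<Sum>N | image_mset (\<lambda>k. k div n) N = M. schur \<alpha> N)"
proof -
  let ?d = "size M" and ?N = "{N. image_mset (\<lambda>k. k div n) N = M}"
  define x where "x \<alpha> = (\<Sum>\<mu>\<in>partitions_of ?d. a_coeff n \<alpha> \<mu> * schur \<mu> M) - (\<Sum>N\<in>?N. schur \<alpha> N)" for \<alpha>
  have "x \<alpha> = 0"
  proof (rule schur_coeffs_unique[OF _ assms(2)])
    fix \<beta> assume \<beta>: "\<beta> \<in> partitions_of ?d"
    then have size: "size (row_content \<beta>) = ?d" by (simp add: size_row_content partitions_of_def)
    have "(\<Sum>\<alpha>\<in>partitions_of ?d. (\<Sum>\<mu>\<in>partitions_of ?d. a_coeff n \<alpha> \<mu> * schur \<mu> M) * schur \<alpha> (row_content \<beta>)) =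
        (\<Sum>\<alpha>\<in>partitions_of ?d. \<Sum>\<mu>\<in>partitions_of ?d. a_coeff n \<mu> \<alpha> * (schur \<mu> M * schur \<alpha> (row_content \<beta>)))"
      unfolding sum_distrib_right by (intro sum.cong refl) (subst a_coeff_commute, rule mult.assoc)
    also have "\<dots> = int (card (coloured_pairs n M (row_content \<beta>)))"
      by (subst sum.swap) (rule a_coeff_kernel[OF refl size])
    \<comment> \<open>The turning point: the coloured pairs, so far a power of the kernel, are now
      counted as ordinary pairs whose first letters come from the enlarged alphabet.\<close>
    also have "\<dots> = (\<Sum>N\<in>?N. int (pair_count N (row_content \<beta>)))"
      by (simp add: card_coloured_pairs_div[OF assms(1)])
    also have "\<dots> = (\<Sum>N\<in>?N. \<Sum>\<alpha>\<in>partitions_of ?d. schur \<alpha> N * schur \<alpha> (row_content \<beta>))"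
      by (rule sum.cong[OF refl]) (auto simp: schur_cauchy[symmetric])
    also have "\<dots> = (\<Sum>\<alpha>\<in>partitions_of ?d. (\<Sum>N\<in>?N. schur \<alpha> N) * schur \<alpha> (row_content \<beta>))"
      by (subst sum.swap) (simp add: sum_distrib_right)
    finally show "(\<Sum>\<alpha>\<in>partitions_of ?d. x \<alpha> * of_int (schur \<alpha> (row_content \<beta>))) = 0"
      by (simp add: x_def left_diff_distrib sum_subtractf)
  qed
  then show ?thesis by (simp add: x_def)
qed

section \<open>Convolution on the symmetric group\<close>

text \<open>The notation for inverses in \<^theory>\<open>HOL-Algebra.Group\<close> hides \<open>inv\<close>.\<close>

abbreviation pinv :: "('a \<Rightarrow> 'a) \<Rightarrow> 'a \<Rightarrow> 'a" where
  "pinv p \<equiv> inv_into UNIV p"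

lemma permutes_inv_comp_left: "p permutes S \<Longrightarrow> pinv p \<circ> (p \<circ> x) = x"
  by (simp add: comp_assoc[symmetric] permutes_inv_o)

lemma permutes_comp_inv_left: "p permutes S \<Longrightarrow> p \<circ> (pinv p \<circ> x) = x"
  by (simp add: comp_assoc[symmetric] permutes_inv_o)

lemma permutes_inv_comp: "p permutes S \<Longrightarrow> q permutes S \<Longrightarrow> pinv (p \<circ> q) = pinv q \<circ> pinv p"
  by (simp add: o_inv_distrib permutes_bij)

lemmas permutes_group_simps = permutes_inv_comp_left permutes_comp_inv_left permutes_inv_comp
  permutes_compose permutes_inv permutes_inv_o permutes_inv_inv comp_assoc permutes_id

lemma sum_permutes_left:
  "q permutes S \<Longrightarrow> (\<Sum>p | p permutes S. f (q \<circ> p)) = (\<Sum>p | p permutes S. f p)"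
  by (rule sum.reindex_bij_witness[where i = "\<lambda>p. pinv q \<circ> p" and j = "\<lambda>p. q \<circ> p"])
    (auto simp: permutes_group_simps)

lemma sum_permutes_right:
  "q permutes S \<Longrightarrow> (\<Sum>p | p permutes S. f (p \<circ> q)) = (\<Sum>p | p permutes S. f p)"
  by (rule sum.reindex_bij_witness[where i = "\<lambda>p. p \<circ> pinv q" and j = "\<lambda>p. p \<circ> q"])
    (auto simp: permutes_group_simps)

lemma sum_permutes_inv: "(\<Sum>p | p permutes S. f (pinv p)) = (\<Sum>p | p permutes S. f p)"
  by (rule sum.reindex_bij_witness[where i = pinv and j = pinv]) (auto simp: permutes_group_simps)

definition conv :: "nat set \<Rightarrow> ((nat \<Rightarrow> nat) \<Rightarrow> 'a::comm_ring_1) \<Rightarrow> ((nat \<Rightarrow> nat) \<Rightarrow> 'a) \<Rightarrow> (nat \<Rightarrow> nat) \<Rightarrow> 'a" where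
  "conv S f g x = (\<Sum>y | y permutes S. f y * g (pinv y \<circ> x))"

text \<open>The product of \<open>u\<close>, the group element \<open>x\<close> and \<open>v\<close> in the group algebra.\<close>

definition conv3 :: "nat set \<Rightarrow> ((nat \<Rightarrow> nat) \<Rightarrow> 'a::comm_ring_1) \<Rightarrow> (nat \<Rightarrow> nat) \<Rightarrow> ((nat \<Rightarrow> nat) \<Rightarrow> 'a) \<Rightarrow> (nat \<Rightarrow> nat) \<Rightarrow> 'a" where
  "conv3 S u x v z = (\<Sum>y | y permutes S. u y * v (pinv x \<circ> (pinv y \<circ> z)))"

text \<open>The shape of the character of a left ideal generated by an element \<open>f\<close> with
  \<open>f f = k f\<close>: the trace of \<sigma> is this sum, taken at the inverse of \<sigma>,
  divided by \<open>k\<close>.\<close>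

definition class_sum :: "nat set \<Rightarrow> ((nat \<Rightarrow> nat) \<Rightarrow> 'a::comm_ring_1) \<Rightarrow> (nat \<Rightarrow> nat) \<Rightarrow> 'a" where
  "class_sum S f \<sigma> = (\<Sum>x | x permutes S. f (pinv x \<circ> (\<sigma> \<circ> x)))"

text \<open>The sum on the right is the trace of the linear map \<open>z\<close> to
  \<open>u z v\<close> on the group algebra. Of the two conjugating permutations only their quotient
  matters, and the free one contributes the factorial.\<close>

lemma class_sum_inner:
  assumes "finite S"
  shows "(\<Sum>\<sigma> | \<sigma> permutes S. class_sum S u \<sigma> * class_sum S v (pinv \<sigma>)) =
    of_nat (fact (card S)) * (\<Sum>z | z permutes S. conv3 S u z v z)"
proof -
  let ?G = "{p. p permutes S}"
  have "(\<Sum>\<sigma>\<in>?G. class_sum S u \<sigma> * class_sum S v (pinv \<sigma>)) =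
      (\<Sum>\<sigma>\<in>?G. \<Sum>x\<in>?G. \<Sum>y\<in>?G. u (pinv x \<circ> (\<sigma> \<circ> x)) * v (pinv y \<circ> (pinv \<sigma> \<circ> y)))"
    by (simp add: class_sum_def sum_product)
  also have "\<dots> = (\<Sum>x\<in>?G. \<Sum>\<sigma>\<in>?G. \<Sum>y\<in>?G. u (pinv x \<circ> (\<sigma> \<circ> x)) * v (pinv y \<circ> (pinv \<sigma> \<circ> y)))"
    by (rule sum.swap)
  also have "\<dots> = (\<Sum>x\<in>?G. \<Sum>\<tau>\<in>?G. \<Sum>z\<in>?G. u \<tau> * v (pinv z \<circ> (pinv \<tau> \<circ> z)))"
  proof (rule sum.cong[OF refl])
    fix x assume "x \<in> ?G"
    then have x: "x permutes S" by simp
    have "(\<Sum>\<sigma>\<in>?G. \<Sum>y\<in>?G. u (pinv x \<circ> (\<sigma> \<circ> x)) * v (pinv y \<circ> (pinv \<sigma> \<circ> y))) =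
        (\<Sum>\<tau>\<in>?G. \<Sum>y\<in>?G. u \<tau> * v (pinv y \<circ> (x \<circ> (pinv \<tau> \<circ> (pinv x \<circ> y)))))"
      by (rule sum.reindex_bij_witness[where i = "\<lambda>\<tau>. x \<circ> (\<tau> \<circ> pinv x)" and j = "\<lambda>\<sigma>. pinv x \<circ> (\<sigma> \<circ> x)"])
        (use x in \<open>auto simp: permutes_group_simps permutes_inv_comp[where S = S]\<close>)
    also have "\<dots> = (\<Sum>\<tau>\<in>?G. \<Sum>z\<in>?G. u \<tau> * v (pinv z \<circ> (pinv \<tau> \<circ> z)))"
    proof (rule sum.cong[OF refl])
      fix \<tau>
      show "(\<Sum>y\<in>?G. u \<tau> * v (pinv y \<circ> (x \<circ> (pinv \<tau> \<circ> (pinv x \<circ> y))))) =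
          (\<Sum>z\<in>?G. u \<tau> * v (pinv z \<circ> (pinv \<tau> \<circ> z)))"
        by (subst sum_permutes_left[OF x, symmetric], rule sum.cong)
          (use x in \<open>auto simp: permutes_group_simps\<close>)
    qed
    finally show "(\<Sum>\<sigma>\<in>?G. \<Sum>y\<in>?G. u (pinv x \<circ> (\<sigma> \<circ> x)) * v (pinv y \<circ> (pinv \<sigma> \<circ> y))) =
        (\<Sum>\<tau>\<in>?G. \<Sum>z\<in>?G. u \<tau> * v (pinv z \<circ> (pinv \<tau> \<circ> z)))" .
  qed
  also have "\<dots> = of_nat (card ?G) * (\<Sum>\<tau>\<in>?G. \<Sum>z\<in>?G. u \<tau> * v (pinv z \<circ> (pinv \<tau> \<circ> z)))" by simp
  also have "(\<Sum>\<tau>\<in>?G. \<Sum>z\<in>?G. u \<tau> * v (pinv z \<circ> (pinv \<tau> \<circ> z))) = (\<Sum>z\<in>?G. conv3 S u z v z)"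
    unfolding conv3_def by (rule sum.swap)
  finally show ?thesis using card_permutations[OF refl assms] by simp
qed

section \<open>Young subgroups and functions transforming under them\<close>

definition stab :: "nat set \<Rightarrow> (nat \<Rightarrow> 'b) \<Rightarrow> (nat \<Rightarrow> nat) set" where
  "stab S \<rho> = {p. p permutes S \<and> (\<forall>i\<in>S. \<rho> (p i) = \<rho> i)}"

lemma stab_permutes: "p \<in> stab S \<rho> \<Longrightarrow> p permutes S"
  by (simp add: stab_def)

lemma stab_id: "id \<in> stab S \<rho>"
  by (simp add: stab_def permutes_id)

lemma stab_comp: "p \<in> stab S \<rho> \<Longrightarrow> q \<in> stab S \<rho> \<Longrightarrow> p \<circ> q \<in> stab S \<rho>"
  by (auto simp: stab_def permutes_compose permutes_in_image)

lemma stab_inv: "p \<in> stab S \<rho> \<Longrightarrow> pinv p \<in> stab S \<rho>"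
proof -
  assume p: "p \<in> stab S \<rho>"
  then have pS: "p permutes S" by (rule stab_permutes)
  have "\<rho> (pinv p i) = \<rho> i" if "i \<in> S" for i
  proof -
    have "pinv p i \<in> S" using that permutes_in_image[OF permutes_inv[OF pS]] by simp
    then have "\<rho> (p (pinv p i)) = \<rho> (pinv p i)" using p unfolding stab_def by blast
    then show ?thesis by (simp add: permutes_inverses(1)[OF pS])
  qed
  then show ?thesis using permutes_inv[OF pS] by (simp add: stab_def)
qed

lemma stab_comp_left_iff: "p \<in> stab S \<rho> \<Longrightarrow> p \<circ> x \<in> stab S \<rho> \<longleftrightarrow> x \<in> stab S \<rho>"
  by (metis stab_comp stab_inv permutes_inv_comp_left stab_permutes)

lemma stab_comp_right_iff:
  assumes "p \<in> stab S \<rho>"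
  shows "x \<circ> p \<in> stab S \<rho> \<longleftrightarrow> x \<in> stab S \<rho>"
proof
  assume "x \<circ> p \<in> stab S \<rho>"
  then have "(x \<circ> p) \<circ> pinv p \<in> stab S \<rho>" by (rule stab_comp[OF _ stab_inv[OF assms]])
  then show "x \<in> stab S \<rho>" by (simp add: comp_assoc permutes_inv_o[OF stab_permutes[OF assms]])
qed (use assms stab_comp in blast)

lemma stab_inv_iff: "x permutes S \<Longrightarrow> pinv x \<in> stab S \<rho> \<longleftrightarrow> x \<in> stab S \<rho>"
  using stab_inv permutes_inv_inv by metis

definition left_inv :: "nat set \<Rightarrow> (nat \<Rightarrow> 'b) \<Rightarrow> ((nat \<Rightarrow> nat) \<Rightarrow> 'a::comm_ring_1) \<Rightarrow> bool" where
  "left_inv S \<rho> f \<longleftrightarrow> (\<forall>p\<in>stab S \<rho>. \<forall>x. x permutes S \<longrightarrow> f (p \<circ> x) = f x)"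

definition right_alt :: "nat set \<Rightarrow> (nat \<Rightarrow> 'b) \<Rightarrow> ((nat \<Rightarrow> nat) \<Rightarrow> 'a::comm_ring_1) \<Rightarrow> bool" where
  "right_alt S \<gamma> f \<longleftrightarrow> (\<forall>q\<in>stab S \<gamma>. \<forall>x. x permutes S \<longrightarrow> f (x \<circ> q) = of_int (sign q) * f x)"

lemma conv_left_inv:
  assumes "left_inv S \<rho> f"
  shows "left_inv S \<rho> (conv S f g)"
  unfolding left_inv_def
proof (intro ballI allI impI)
  fix p x assume p: "p \<in> stab S \<rho>" and x: "x permutes S"
  have pS: "p permutes S" using p by (rule stab_permutes)
  have "conv S f g (p \<circ> x) = (\<Sum>y | y permutes S. f (p \<circ> y) * g (pinv (p \<circ> y) \<circ> (p \<circ> x)))"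
    unfolding conv_def by (rule sum_permutes_left[OF pS, symmetric])
  also have "\<dots> = conv S f g x"
    unfolding conv_def
    by (rule sum.cong) (use assms p pS x in \<open>auto simp: left_inv_def permutes_group_simps\<close>)
  finally show "conv S f g (p \<circ> x) = conv S f g x" .
qed

lemma conv_right_alt:
  assumes "right_alt S \<gamma> g"
  shows "right_alt S \<gamma> (conv S f g)"
  unfolding right_alt_def
proof (intro ballI allI impI)
  fix q x assume q: "q \<in> stab S \<gamma>" and x: "x permutes S"
  show "conv S f g (x \<circ> q) = of_int (sign q) * conv S f g x"
    unfolding conv_def sum_distrib_left
  proof (rule sum.cong[OF refl])
    fix y assume "y \<in> {y. y permutes S}"
    then have "g ((pinv y \<circ> x) \<circ> q) = of_int (sign q) * g (pinv y \<circ> x)"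
      using assms q x by (auto simp: right_alt_def permutes_compose permutes_inv)
    then show "f y * g (pinv y \<circ> (x \<circ> q)) = of_int (sign q) * (f y * g (pinv y \<circ> x))"
      by (simp add: comp_assoc mult_ac)
  qed
qed

lemma conv3_left_inv:
  assumes "left_inv S \<rho> u" "x permutes S"
  shows "left_inv S \<rho> (conv3 S u x v)"
proof -
  have "conv3 S u x v = conv S u (\<lambda>w. v (pinv x \<circ> w))"
    by (simp add: conv3_def conv_def fun_eq_iff)
  then show ?thesis using conv_left_inv[OF assms(1)] by simp
qed

text \<open>Together with \<open>conv3_left_inv\<close>: for every group element \<open>x\<close>,
  the product \<open>u x v\<close> inherits the left behaviour of \<open>u\<close> and the right
  behaviour of \<open>v\<close>. This is what makes the traces in \<open>class_sum_inner\<close>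
  computable.\<close>

lemma conv3_right_alt:
  assumes "right_alt S \<gamma> v" "x permutes S"
  shows "right_alt S \<gamma> (conv3 S u x v)"
proof -
  have "conv3 S u x v = conv S u (\<lambda>w. v (pinv x \<circ> w))"
    by (simp add: conv3_def conv_def fun_eq_iff)
  moreover have "right_alt S \<gamma> (\<lambda>w. v (pinv x \<circ> w))"
    using assms unfolding right_alt_def by (simp add: comp_assoc[symmetric] permutes_compose permutes_inv)
  ultimately show ?thesis using conv_right_alt by metis
qed

text \<open>If two points of a row of \<open>x\<close> lie in one column, the transposition exchanging them acts on
  \<open>x\<close> both from the left and from the right, with opposite effects on \<open>f\<close>.\<close>

lemma vanish_if_transposition:
  fixes f :: "(nat \<Rightarrow> nat) \<Rightarrow> 'a::{idom, ring_char_0}"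
  assumes "left_inv S \<rho> f" "right_alt S \<gamma> f" "x permutes S"
    and ij: "i \<in> S" "j \<in> S" "i \<noteq> j" "\<gamma> i = \<gamma> j" "\<rho> (x i) = \<rho> (x j)"
  shows "f x = 0"
proof -
  let ?t = "transpose i j" and ?s = "transpose (x i) (x j)"
  have xS: "x i \<in> S" "x j \<in> S" using ij assms(3) by (simp_all add: permutes_in_image)
  have t: "?t \<in> stab S \<gamma>"
    unfolding stab_def using ij by (auto simp: permutes_swap_id transpose_def)
  have s: "?s \<in> stab S \<rho>"
    unfolding stab_def using ij xS by (auto simp: permutes_swap_id transpose_def)
  \<comment> \<open>Conjugation by \<open>x\<close> carries the transposition of the two points to
    that of their images.\<close>
  have comm: "?s \<circ> x = x \<circ> ?t"
    using permutes_inj[OF assms(3)] by (auto simp: fun_eq_iff transpose_def dest: injD)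
  have "f x = f (?s \<circ> x)" using assms(1,3) s by (simp add: left_inv_def)
  also have "\<dots> = f (x \<circ> ?t)" by (simp only: comm)
  also have "\<dots> = - f x" using assms(2,3) t ij(3) by (simp add: right_alt_def sign_swap_id)
  finally have "f x + f x = 0" by simp
  then have "2 * f x = 0" by simp
  then show ?thesis by simp
qed

text \<open>A tableau stored through its inverse: \<rho> and \<gamma> give the row and the column of
  each entry. In this form the row and column groups are \<open>stab S \<rho>\<close> and
  \<open>stab S \<gamma>\<close>.\<close>

definition young_filling :: "nat set \<Rightarrow> (nat \<Rightarrow> nat) \<Rightarrow> (nat \<Rightarrow> nat) \<Rightarrow> (nat \<Rightarrow> nat) \<Rightarrow> bool" where
  "young_filling S f \<rho> \<gamma> \<longleftrightarrow> finite S \<and> f \<in> shapes \<and> bij_betw (\<lambda>i. (\<rho> i, \<gamma> i)) S (diagram f)"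

lemma young_filling_in_diagram:
  assumes "young_filling S f \<rho> \<gamma>" "i \<in> S"
  shows "(\<rho> i, \<gamma> i) \<in> diagram f"
proof -
  have "bij_betw (\<lambda>i. (\<rho> i, \<gamma> i)) S (diagram f)" using assms(1) by (simp add: young_filling_def)
  from bij_betw_apply[OF this assms(2)] show ?thesis .
qed

section \<open>Column-injective colourings and von Neumann's lemma\<close>

lemma card_column_below:
  assumes "young_filling S f \<rho> \<gamma>"
  shows "card {i \<in> S. \<gamma> i = j \<and> \<rho> i < r} = card {k. j < f k \<and> k < r}"
proof -
  have bij: "bij_betw (\<lambda>i. (\<rho> i, \<gamma> i)) S (diagram f)" using assms by (simp add: young_filling_def)
  have "bij_betw \<rho> {i \<in> S. \<gamma> i = j \<and> \<rho> i < r} {k. j < f k \<and> k < r}"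
    unfolding bij_betw_def
  proof
    show "inj_on \<rho> {i \<in> S. \<gamma> i = j \<and> \<rho> i < r}"
    proof (rule inj_onI)
      fix i i' assume *: "i \<in> {i \<in> S. \<gamma> i = j \<and> \<rho> i < r}" "i' \<in> {i \<in> S. \<gamma> i = j \<and> \<rho> i < r}" "\<rho> i = \<rho> i'"
      show "i = i'" by (rule inj_onD[OF bij_betw_imp_inj_on[OF bij]]) (use * in auto)
    qed
    show "\<rho> ` {i \<in> S. \<gamma> i = j \<and> \<rho> i < r} = {k. j < f k \<and> k < r}"
    proof (intro equalityI subsetI)
      fix k assume "k \<in> \<rho> ` {i \<in> S. \<gamma> i = j \<and> \<rho> i < r}"
      then obtain i where i: "i \<in> S" "\<gamma> i = j" "\<rho> i < r" "k = \<rho> i" by blast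
      then have "(\<rho> i, \<gamma> i) \<in> diagram f" using bij_betw_apply[OF bij i(1)] by simp
      then show "k \<in> {k. j < f k \<and> k < r}" using i by (simp add: diagram_def)
    next
      fix k assume k: "k \<in> {k. j < f k \<and> k < r}"
      then have "(k, j) \<in> (\<lambda>i. (\<rho> i, \<gamma> i)) ` S"
        using bij_betw_imp_surj_on[OF bij] by (simp add: diagram_def)
      then obtain i where "i \<in> S" "\<rho> i = k" "\<gamma> i = j" by blast
      then show "k \<in> \<rho> ` {i \<in> S. \<gamma> i = j \<and> \<rho> i < r}" using k by blast
    qed
  qed
  then show ?thesis by (rule bij_betw_same_card)
qed

lemma column_eq_lessThan:
  assumes "f \<in> shapes"
  shows "\<exists>h. \<forall>k. j < f k \<longleftrightarrow> k < h"
proof -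
  obtain L where L: "\<And>i. i \<ge> L \<Longrightarrow> f i = 0" using assms by (rule shapesE) blast
  define h where "h = (LEAST k. f k \<le> j)"
  have "f L \<le> j" using L by simp
  then have h: "f h \<le> j" unfolding h_def by (rule LeastI)
  have "j < f k \<longleftrightarrow> k < h" for k
  proof
    assume "j < f k"
    show "k < h"
    proof (rule ccontr)
      assume "\<not> k < h"
      then have "f k \<le> f h" by (intro shapes_antimono[OF assms]) simp
      then show False using h \<open>j < f k\<close> by simp
    qed
  next
    assume "k < h"
    then have "\<not> f k \<le> j" unfolding h_def by (rule not_less_Least)
    then show "j < f k" by simp
  qed
  then show ?thesis by blast
qed

text \<open>In a column of height \<open>h\<close>, at most \<open>m\<close> entries have a colour
  below \<open>m\<close>, because the colours are distinct there, and at most \<open>h\<close>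
  entries exist. The row index attains the minimum of both bounds.\<close>

lemma card_column_colouring_le:
  assumes F: "young_filling S f \<rho> \<gamma>" and inj: "inj_on (\<lambda>i. (\<gamma> i, r i)) S"
  shows "card {i \<in> S. \<gamma> i = j \<and> r i < m} \<le> card {i \<in> S. \<gamma> i = j \<and> \<rho> i < m}"
proof -
  have finS: "finite S" and f: "f \<in> shapes" using F by (auto simp: young_filling_def)
  obtain h where "\<forall>k. j < f k \<longleftrightarrow> k < h" using column_eq_lessThan[OF f] by blast
  then have h: "j < f k \<longleftrightarrow> k < h" for k by blast
  have right: "card {i \<in> S. \<gamma> i = j \<and> \<rho> i < m} = min h m" for m
  proof -
    have "{k. j < f k \<and> k < m} = {..<min h m}" by (intro equalityI subsetI) (simp_all add: h)
    then show ?thesis using card_column_below[OF F, of j m] by simp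
  qed
  have "card {i \<in> S. \<gamma> i = j \<and> r i < m} \<le> m"
  proof -
    have "inj_on r {i \<in> S. \<gamma> i = j \<and> r i < m}"
    proof (rule inj_onI)
      fix i i' assume *: "i \<in> {i \<in> S. \<gamma> i = j \<and> r i < m}" "i' \<in> {i \<in> S. \<gamma> i = j \<and> r i < m}" "r i = r i'"
      show "i = i'" by (rule inj_onD[OF inj]) (use * in auto)
    qed
    then have "card {i \<in> S. \<gamma> i = j \<and> r i < m} \<le> card {..<m}"
      by (rule card_inj_on_le) auto
    then show ?thesis by simp
  qed
  moreover have "card {i \<in> S. \<gamma> i = j \<and> r i < m} \<le> h"
  proof -
    have "{i \<in> S. \<gamma> i = j} \<subseteq> {i \<in> S. \<gamma> i = j \<and> \<rho> i < h}"
    proof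
      fix i assume i: "i \<in> {i \<in> S. \<gamma> i = j}"
      then have "(\<rho> i, \<gamma> i) \<in> diagram f"
        by (intro young_filling_in_diagram[OF F]) simp
      then have "\<gamma> i < f (\<rho> i)" by (simp add: diagram_def)
      moreover have "\<gamma> i = j" using i by blast
      ultimately have "\<rho> i < h" using h[of "\<rho> i"] by blast
      then show "i \<in> {i \<in> S. \<gamma> i = j \<and> \<rho> i < h}" using i by blast
    qed
    then have "{i \<in> S. \<gamma> i = j \<and> r i < m} \<subseteq> {i \<in> S. \<gamma> i = j \<and> \<rho> i < h}" by blast
    then have "card {i \<in> S. \<gamma> i = j \<and> r i < m} \<le> card {i \<in> S. \<gamma> i = j \<and> \<rho> i < h}"
      using finS by (intro card_mono) auto
    then show ?thesis using right[of h] by simp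
  qed
  ultimately show ?thesis using right[of m] by simp
qed

lemma card_eq_sum_columns:
  assumes "finite S"
  shows "card {i \<in> S. P i} = (\<Sum>j\<in>\<gamma> ` S. card {i \<in> S. \<gamma> i = j \<and> P i})"
proof -
  have "card {i \<in> S. P i} = card (\<Union>j\<in>\<gamma> ` S. {i \<in> S. \<gamma> i = j \<and> P i})"
    by (rule arg_cong[where f = card]) auto
  also have "\<dots> = (\<Sum>j\<in>\<gamma> ` S. card {i \<in> S. \<gamma> i = j \<and> P i})"
    by (rule card_UN_disjoint) (use assms in auto)
  finally show ?thesis .
qed

lemma card_colouring_le:
  assumes F: "young_filling S f \<rho> \<gamma>" and inj: "inj_on (\<lambda>i. (\<gamma> i, r i)) S"
  shows "card {i \<in> S. r i < m} \<le> card {i \<in> S. \<rho> i < m}"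
proof -
  have finS: "finite S" using F by (simp add: young_filling_def)
  have "card {i \<in> S. r i < m} = (\<Sum>j\<in>\<gamma> ` S. card {i \<in> S. \<gamma> i = j \<and> r i < m})"
    by (rule card_eq_sum_columns[OF finS])
  also have "\<dots> \<le> (\<Sum>j\<in>\<gamma> ` S. card {i \<in> S. \<gamma> i = j \<and> \<rho> i < m})"
    by (rule sum_mono) (rule card_column_colouring_le[OF F inj])
  also have "\<dots> = card {i \<in> S. \<rho> i < m}"
    by (rule card_eq_sum_columns[OF finS, symmetric])
  finally show ?thesis .
qed

text \<open>If the columnwise inequalities add up to an equality, each of them is an equality. So in
  a column of height \<open>h\<close> all colours are below \<open>h\<close>, and being distinct
  they fill the column.\<close>

lemma colouring_image:
  assumes F: "young_filling S f \<rho> \<gamma>" and inj: "inj_on (\<lambda>i. (\<gamma> i, r i)) S"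
    and eq: "\<And>m. card {i \<in> S. r i < m} = card {i \<in> S. \<rho> i < m}"
  shows "bij_betw (\<lambda>i. (r i, \<gamma> i)) S (diagram f)"
proof -
  have finS: "finite S" and f: "f \<in> shapes" and bij: "bij_betw (\<lambda>i. (\<rho> i, \<gamma> i)) S (diagram f)"
    using F by (auto simp: young_filling_def)
  \<comment> \<open>Equality of two sums that compare termwise forces equality of the terms.\<close>
  have col: "card {i \<in> S. \<gamma> i = j \<and> r i < m} = card {i \<in> S. \<gamma> i = j \<and> \<rho> i < m}" if "j \<in> \<gamma> ` S" for j m
    by (rule sum_mono_inv[where I = "\<gamma> ` S"])
      (use eq[of m] card_eq_sum_columns[OF finS, of "\<lambda>i. r i < m" \<gamma>] card_eq_sum_columns[OF finS, of "\<lambda>i. \<rho> i < m" \<gamma>]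
        card_column_colouring_le[OF F inj] that finS in auto)
  have inj': "inj_on (\<lambda>i. (r i, \<gamma> i)) S" using inj by (auto simp: inj_on_def)
  have "(\<lambda>i. (r i, \<gamma> i)) ` S \<subseteq> diagram f"
  proof
    fix c assume "c \<in> (\<lambda>i. (r i, \<gamma> i)) ` S"
    then obtain i where i: "i \<in> S" "c = (r i, \<gamma> i)" by blast
    obtain h where "\<forall>k. \<gamma> i < f k \<longleftrightarrow> k < h" using column_eq_lessThan[OF f] by blast
    then have h: "\<gamma> i < f k \<longleftrightarrow> k < h" for k by blast
    let ?C = "{k \<in> S. \<gamma> k = \<gamma> i}"
    have \<rho>h: "\<rho> k < h" if "k \<in> ?C" for k
    proof -
      have "(\<rho> k, \<gamma> k) \<in> diagram f" by (rule young_filling_in_diagram[OF F]) (use that in simp)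
      then have "\<gamma> k < f (\<rho> k)" by (simp add: diagram_def)
      moreover have "\<gamma> k = \<gamma> i" using that by blast
      ultimately show ?thesis using h[of "\<rho> k"] by simp
    qed
    have "card {k \<in> S. \<gamma> k = \<gamma> i \<and> r k < h} = card {k \<in> S. \<gamma> k = \<gamma> i \<and> \<rho> k < h}"
      using i by (intro col) auto
    also have "{k \<in> S. \<gamma> k = \<gamma> i \<and> \<rho> k < h} = ?C" using \<rho>h by blast
    finally have "{k \<in> S. \<gamma> k = \<gamma> i \<and> r k < h} = ?C"
      using finS by (intro card_subset_eq) auto
    then have "r i < h" using i by blast
    then show "c \<in> diagram f" using h[of "r i"] i(2) by (simp add: diagram_def)
  qed
  moreover have "card ((\<lambda>i. (r i, \<gamma> i)) ` S) = card (diagram f)"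
    using card_image[OF inj'] bij_betw_same_card[OF bij] by simp
  ultimately have "(\<lambda>i. (r i, \<gamma> i)) ` S = diagram f"
    by (intro card_subset_eq finite_diagram f)
  then show ?thesis using inj' by (simp add: bij_betw_def)
qed

lemma card_permuted:
  assumes "x permutes S"
  shows "card {i \<in> S. P (x i)} = card {i \<in> S. P i}"
proof (rule bij_betw_same_card)
  show "bij_betw x {i \<in> S. P (x i)} {i \<in> S. P i}"
  proof (rule bij_betw_byWitness[where f' = "pinv x"])
    show "x ` {i \<in> S. P (x i)} \<subseteq> {i \<in> S. P i}"
      using permutes_in_image[OF assms] by auto
    show "pinv x ` {i \<in> S. P i} \<subseteq> {i \<in> S. P (x i)}"
      using permutes_in_image[OF permutes_inv[OF assms]] permutes_inverses(1)[OF assms] by auto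
  qed (use permutes_inverses[OF assms] in auto)
qed

text \<open>Colour the entry \<open>i\<close> by \<rho> of \<open>x i\<close>. Either two entries of
  a column share their colour, and a transposition makes \<open>f x\<close> vanish, or the colouring
  is injective on columns, which the counts forbid. In applications \<open>m\<close> witnesses the
  failure of dominance.\<close>

lemma vanish_unless_dominates:
  fixes f :: "(nat \<Rightarrow> nat) \<Rightarrow> 'a::{idom, ring_char_0}"
  assumes F: "young_filling S g \<rho>' \<gamma>" and f: "left_inv S \<rho> f" "right_alt S \<gamma> f" and x: "x permutes S"
    and m: "card {i \<in> S. \<rho>' i < m} < card {i \<in> S. \<rho> i < m}"
  shows "f x = 0"
proof (cases "inj_on (\<lambda>i. (\<gamma> i, \<rho> (x i))) S")
  case True
  have "card {i \<in> S. \<rho> (x i) < m} \<le> card {i \<in> S. \<rho>' i < m}" by (rule card_colouring_le[OF F True])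
  also have "\<dots> < card {i \<in> S. \<rho> (x i) < m}" using m card_permuted[OF x, of "\<lambda>i. \<rho> i < m"] by simp
  finally show ?thesis by simp
next
  case False
  then obtain i j where "i \<in> S" "j \<in> S" "i \<noteq> j" "\<gamma> i = \<gamma> j" "\<rho> (x i) = \<rho> (x j)"
    by (auto simp: inj_on_def)
  then show ?thesis by (rule vanish_if_transposition[OF f x])
qed

text \<open>Von Neumann's lemma. Either a transposition forces both functions to vanish at
  \<open>x\<close>, or \<open>x = p \<circ> q\<close> with \<open>p\<close> preserving rows and
  \<open>q\<close> preserving columns, and then both values are the sign of \<open>q\<close> times
  the value at \<open>id\<close>.\<close>

lemma eq_multiple_of_biinvariant:
  fixes f c :: "(nat \<Rightarrow> nat) \<Rightarrow> 'a::{idom, ring_char_0}"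
  assumes F: "young_filling S g \<rho> \<gamma>" and f: "left_inv S \<rho> f" "right_alt S \<gamma> f"
    and c: "left_inv S \<rho> c" "right_alt S \<gamma> c" "c id = 1" and x: "x permutes S"
  shows "f x = f id * c x"
proof (cases "inj_on (\<lambda>i. (\<gamma> i, \<rho> (x i))) S")
  case True
  let ?c = "\<lambda>i. (\<rho> i, \<gamma> i)" and ?r = "\<lambda>i. (\<rho> (x i), \<gamma> i)"
  have bij: "bij_betw ?c S (diagram g)" using F by (simp add: young_filling_def)
  have bij2: "bij_betw ?r S (diagram g)"
  proof (rule colouring_image[OF F True])
    fix m
    show "card {i \<in> S. \<rho> (x i) < m} = card {i \<in> S. \<rho> i < m}" by (rule card_permuted[OF x])
  qed
  \<comment> \<open>\<open>q\<close> moves \<open>i\<close> inside its column to the row that \<rho>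
    assigns to \<open>x i\<close>; what remains of \<open>x\<close> after undoing \<open>q\<close>
    preserves rows.\<close>
  define q where "q i = (if i \<in> S then inv_into S ?c (?r i) else i)" for i
  have "bij_betw (inv_into S ?c \<circ> ?r) S S"
    by (rule bij_betw_trans[OF bij2 bij_betw_inv_into[OF bij]])
  then have "bij_betw q S S"
    by (rule bij_betw_cong[THEN iffD1, rotated]) (simp add: q_def)
  then have q: "q permutes S"
    by (rule bij_imp_permutes) (simp add: q_def)
  have cq: "?c (q i) = ?r i" if "i \<in> S" for i
  proof -
    have "?r i \<in> ?c ` S"
      using bij_betw_apply[OF bij2 that] bij_betw_imp_surj_on[OF bij] by simp
    then have "?c (inv_into S ?c (?r i)) = ?r i" by (rule f_inv_into_f)
    then show ?thesis using that by (simp add: q_def)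
  qed
  have qC: "q \<in> stab S \<gamma>" using q cq by (simp add: stab_def)
  define p where "p = x \<circ> pinv q"
  have xpq: "x = p \<circ> q" using q by (simp add: p_def comp_assoc permutes_inv_o)
  have pS: "p permutes S" using q x by (simp add: p_def permutes_compose permutes_inv)
  have "p \<in> stab S \<rho>"
    unfolding stab_def
  proof (intro CollectI conjI ballI pS)
    fix i assume "i \<in> S"
    then have "pinv q i \<in> S" using permutes_in_image[OF permutes_inv[OF q]] by simp
    then have "\<rho> (q (pinv q i)) = \<rho> (x (pinv q i))" using cq by simp
    then show "\<rho> (p i) = \<rho> i" by (simp add: p_def permutes_inverses[OF q])
  qed
  then have pq: "h x = of_int (sign q) * h id" if "left_inv S \<rho> h" "right_alt S \<gamma> h" for h :: "(nat \<Rightarrow> nat) \<Rightarrow> 'a"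
    using that q qC permutes_id[of S] unfolding xpq left_inv_def right_alt_def by (metis id_comp)
  show ?thesis using pq[OF f] pq[OF c(1,2)] c(3) by simp
next
  case False
  then obtain i j where ij: "i \<in> S" "j \<in> S" "i \<noteq> j" "\<gamma> i = \<gamma> j" "\<rho> (x i) = \<rho> (x j)"
    by (auto simp: inj_on_def)
  show ?thesis
    using vanish_if_transposition[OF f x ij] vanish_if_transposition[OF c(1,2) x ij] by simp
qed

section \<open>Invariant colourings\<close>

definition colourings :: "nat set \<Rightarrow> 'b multiset \<Rightarrow> (nat \<Rightarrow> 'b) set" where
  "colourings S M = {h \<in> S \<rightarrow>\<^sub>E UNIV. image_mset h (mset_set S) = M}"

definition fixed_colourings :: "nat set \<Rightarrow> 'b multiset \<Rightarrow> (nat \<Rightarrow> nat) \<Rightarrow> nat" where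
  "fixed_colourings S M \<sigma> = card {h \<in> colourings S M. \<sigma> \<in> stab S h}"

lemma colourings_value: "finite S \<Longrightarrow> h \<in> colourings S M \<Longrightarrow> i \<in> S \<Longrightarrow> h i \<in># M"
proof -
  assume *: "finite S" "h \<in> colourings S M" "i \<in> S"
  have "h i \<in># image_mset h (mset_set S)" using *(1,3) by simp
  also have "image_mset h (mset_set S) = M" using *(2) by (simp add: colourings_def)
  finally show ?thesis .
qed

lemma finite_colourings:
  assumes "finite S"
  shows "finite (colourings S M)"
proof (rule finite_subset)
  show "colourings S M \<subseteq> S \<rightarrow>\<^sub>E set_mset M"
  proof
    fix h assume h: "h \<in> colourings S M"
    then have "h \<in> extensional S" by (simp add: colourings_def PiE_def)
    then show "h \<in> S \<rightarrow>\<^sub>E set_mset M" using colourings_value[OF assms h] by (simp add: PiE_iff)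
  qed
  show "finite (S \<rightarrow>\<^sub>E set_mset M)" using assms by (intro finite_PiE) auto
qed

lemma image_mset_permutes:
  assumes "finite S" "x permutes S"
  shows "image_mset (\<lambda>i. h (x i)) (mset_set S) = image_mset h (mset_set S)"
proof -
  have "image_mset x (mset_set S) = mset_set S"
    using permutes_image[OF assms(2)] permutes_inj_on[OF assms(2)] by (simp add: image_mset_mset_set)
  moreover have "image_mset (\<lambda>i. h (x i)) (mset_set S) = image_mset h (image_mset x (mset_set S))"
    by (simp add: multiset.map_comp comp_def)
  ultimately show ?thesis by simp
qed

text \<open>The permutations carrying one colouring to another form a coset of the stabilizer; it is
  nonempty because the contents agree.\<close>

lemma card_transporter:
  assumes S: "finite S" and eq: "image_mset h (mset_set S) = image_mset \<rho> (mset_set S)"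
  shows "card {x. x permutes S \<and> (\<forall>i\<in>S. h (x i) = \<rho> i)} = card (stab S \<rho>)"
proof -
  obtain x0 where x0: "x0 permutes S" "\<And>i. i \<in> S \<Longrightarrow> \<rho> i = h (x0 i)"
    using image_mset_eq_implies_permutes[OF S eq[symmetric]] by metis
  have "bij_betw (\<lambda>x. pinv x0 \<circ> x) {x. x permutes S \<and> (\<forall>i\<in>S. h (x i) = \<rho> i)} (stab S \<rho>)"
  proof (rule bij_betw_byWitness[where f' = "\<lambda>p. x0 \<circ> p"])
    show "(\<lambda>x. pinv x0 \<circ> x) ` {x. x permutes S \<and> (\<forall>i\<in>S. h (x i) = \<rho> i)} \<subseteq> stab S \<rho>"
    proof
      fix p assume "p \<in> (\<lambda>x. pinv x0 \<circ> x) ` {x. x permutes S \<and> (\<forall>i\<in>S. h (x i) = \<rho> i)}"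
      then obtain x where p: "p = pinv x0 \<circ> x" and x: "x permutes S" "\<And>i. i \<in> S \<Longrightarrow> h (x i) = \<rho> i" by blast
      have pS: "p permutes S" unfolding p by (intro permutes_compose permutes_inv x x0)
      have "\<rho> (p i) = \<rho> i" if "i \<in> S" for i
      proof -
        have "\<rho> (p i) = h (x0 (p i))" by (rule x0(2)) (use that permutes_in_image[OF pS] in simp)
        also have "x0 (p i) = x i" by (simp add: p permutes_inverses(1)[OF x0(1)])
        finally show ?thesis using x(2)[OF that] by simp
      qed
      then show "p \<in> stab S \<rho>" using pS by (simp add: stab_def)
    qed
    show "(\<lambda>p. x0 \<circ> p) ` stab S \<rho> \<subseteq> {x. x permutes S \<and> (\<forall>i\<in>S. h (x i) = \<rho> i)}"
    proof
      fix x assume "x \<in> (\<lambda>p. x0 \<circ> p) ` stab S \<rho>"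
      then obtain p where x: "x = x0 \<circ> p" and p: "p \<in> stab S \<rho>" by blast
      have pS: "p permutes S" by (rule stab_permutes[OF p])
      have "h (x i) = \<rho> i" if "i \<in> S" for i
        using x0(2)[of "p i"] p that permutes_in_image[OF pS, of i] by (simp add: x stab_def)
      then show "x \<in> {x. x permutes S \<and> (\<forall>i\<in>S. h (x i) = \<rho> i)}"
        using permutes_compose[OF pS x0(1)] by (simp add: x)
    qed
  qed (use permutes_inv_comp_left[OF x0(1)] permutes_comp_inv_left[OF x0(1)] in auto)
  then show ?thesis by (rule bij_betw_same_card)
qed

text \<open>The colourings of content \<open>M\<close> are a single orbit, and each of them is
  reached by as many permutations as its stabilizer has elements.\<close>

lemma sum_over_orbit:
  fixes F :: "(nat \<Rightarrow> 'b) \<Rightarrow> 'a::comm_semiring_1"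
  assumes S: "finite S" and h0: "image_mset h0 (mset_set S) = M"
  shows "(\<Sum>x | x permutes S. F (restrict (\<lambda>i. h0 (x i)) S)) = (\<Sum>h\<in>colourings S M. of_nat (card (stab S h)) * F h)"
proof -
  let ?r = "\<lambda>x. restrict (\<lambda>i. h0 (x i)) S"
  have mem: "?r x \<in> colourings S M" if "x permutes S" for x
  proof -
    have "image_mset (?r x) (mset_set S) = image_mset (\<lambda>i. h0 (x i)) (mset_set S)"
      by (rule image_mset_cong) (use S in simp)
    then show ?thesis using image_mset_permutes[OF S that, of h0] h0 by (simp add: colourings_def)
  qed
  have "(\<Sum>x | x permutes S. F (?r x)) = (\<Sum>h\<in>colourings S M. \<Sum>x\<in>{x \<in> {x. x permutes S}. ?r x = h}. F (?r x))"
    by (rule sum.group[symmetric]) (use S mem finite_colourings finite_permutations in auto)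
  also have "\<dots> = (\<Sum>h\<in>colourings S M. \<Sum>x | x permutes S \<and> (\<forall>i\<in>S. h0 (x i) = h i). F h)"
  proof (rule sum.cong[OF refl])
    fix h assume h: "h \<in> colourings S M"
    have "?r x = h \<longleftrightarrow> (\<forall>i\<in>S. h0 (x i) = h i)" for x
    proof
      assume "\<forall>i\<in>S. h0 (x i) = h i"
      moreover have "h \<in> extensional S" using h by (simp add: colourings_def PiE_def)
      ultimately show "?r x = h" by (intro extensionalityI[where A = S]) auto
    qed auto
    then have "{x \<in> {x. x permutes S}. ?r x = h} = {x. x permutes S \<and> (\<forall>i\<in>S. h0 (x i) = h i)}" by blast
    then show "(\<Sum>x\<in>{x \<in> {x. x permutes S}. ?r x = h}. F (?r x)) = (\<Sum>x | x permutes S \<and> (\<forall>i\<in>S. h0 (x i) = h i). F h)"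
      by (intro sum.cong) auto
  qed
  also have "\<dots> = (\<Sum>h\<in>colourings S M. of_nat (card (stab S h)) * F h)"
  proof (rule sum.cong[OF refl])
    fix h assume h: "h \<in> colourings S M"
    then have "card {x. x permutes S \<and> (\<forall>i\<in>S. h0 (x i) = h i)} = card (stab S h)"
      by (intro card_transporter[OF S]) (simp add: h0 colourings_def)
    then show "(\<Sum>x | x permutes S \<and> (\<forall>i\<in>S. h0 (x i) = h i). F h) = of_nat (card (stab S h)) * F h" by simp
  qed
  finally show ?thesis .
qed

lemma ex_colouring:
  assumes "finite S" "size M = card S"
  shows "\<exists>h. image_mset h (mset_set S) = M"
proof -
  obtain xs where xs: "mset xs = M" using ex_mset by blast
  obtain f where f: "bij_betw f S {..<card S}" using assms(1) ex_bij_betw_finite_nat[of S] by (metis atLeast0LessThan)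
  have l: "length xs = card S" using assms(2) xs by (metis size_mset)
  have "image_mset (\<lambda>i. xs ! f i) (mset_set S) = image_mset ((!) xs) (image_mset f (mset_set S))"
    by (simp add: multiset.map_comp comp_def)
  also have "image_mset f (mset_set S) = mset_set {..<card S}"
    using f by (simp add: bij_betw_def image_mset_mset_set)
  also have "image_mset ((!) xs) (mset_set {..<card S}) = mset (map ((!) xs) [0..<length xs])"
    by (simp add: l atLeast0LessThan)
  also have "\<dots> = M" by (simp add: map_nth xs)
  finally show ?thesis by blast
qed

text \<open>Burnside's count for a transitive action: the average number of fixed colourings is
  1.\<close>

lemma sum_fixed_colourings:
  assumes S: "finite S" and M: "size M = card S"
  shows "(\<Sum>\<sigma> | \<sigma> permutes S. fixed_colourings S M \<sigma>) = fact (card S)"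
proof -
  obtain h0 where h0: "image_mset h0 (mset_set S) = M" using ex_colouring[OF assms] by blast
  note fin = finite_colourings[OF S, of M] finite_permutations[OF S]
  have "(\<Sum>\<sigma> | \<sigma> permutes S. fixed_colourings S M \<sigma>) =
      (\<Sum>\<sigma>\<in>{\<sigma>. \<sigma> permutes S}. \<Sum>h | h \<in> colourings S M \<and> \<sigma> \<in> stab S h. 1)"
    by (simp add: fixed_colourings_def)
  also have "\<dots> = (\<Sum>h\<in>colourings S M. \<Sum>\<sigma> | \<sigma> \<in> {\<sigma>. \<sigma> permutes S} \<and> \<sigma> \<in> stab S h. 1)"
    by (rule sum.swap_restrict[OF fin(2,1)])
  also have "\<dots> = (\<Sum>h\<in>colourings S M. card (stab S h))"
  proof (rule sum.cong[OF refl])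
    fix h
    have "{\<sigma>. \<sigma> \<in> {\<sigma>. \<sigma> permutes S} \<and> \<sigma> \<in> stab S h} = stab S h" using stab_permutes by blast
    then show "(\<Sum>\<sigma> | \<sigma> \<in> {\<sigma>. \<sigma> permutes S} \<and> \<sigma> \<in> stab S h. 1) = card (stab S h)" by simp
  qed
  also have "\<dots> = (\<Sum>x | x permutes S. 1)"
    using sum_over_orbit[OF S h0, of "\<lambda>_. 1 :: nat"] by simp
  finally show ?thesis using card_permutations[OF refl S] by simp
qed

lemma finite_stab: "finite S \<Longrightarrow> finite (stab S \<rho>)"
  by (rule finite_subset[OF _ finite_permutations[of S]]) (auto simp: stab_def)

text \<open>Inducing the trivial character of a Young subgroup gives the permutation character on
  colourings. The class sum omits the division by the order of the subgroup, hence the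
  factor.\<close>

lemma class_sum_stab:
  assumes S: "finite S" and \<sigma>: "\<sigma> permutes S"
  shows "class_sum S (\<lambda>p. if p \<in> stab S \<rho> then 1 else 0) \<sigma> =
    (of_nat (card (stab S \<rho>) * fixed_colourings S (image_mset \<rho> (mset_set S)) \<sigma>) :: 'a::comm_ring_1)"
proof -
  let ?M = "image_mset \<rho> (mset_set S)"
  \<comment> \<open>A conjugate of \<sigma> preserves \<rho> exactly if \<sigma> preserves the
    transported colouring.\<close>
  have conj: "pinv x \<circ> (\<sigma> \<circ> x) \<in> stab S \<rho> \<longleftrightarrow> \<sigma> \<in> stab S (restrict (\<lambda>i. \<rho> (pinv x i)) S)" if x: "x permutes S" for x
  proof -
    have "pinv x \<circ> (\<sigma> \<circ> x) permutes S" using x \<sigma> by (intro permutes_compose permutes_inv)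
    then have "pinv x \<circ> (\<sigma> \<circ> x) \<in> stab S \<rho> \<longleftrightarrow> (\<forall>i\<in>S. \<rho> (pinv x (\<sigma> (x i))) = \<rho> i)" by (simp add: stab_def)
    also have "\<dots> \<longleftrightarrow> (\<forall>k\<in>S. \<rho> (pinv x (\<sigma> k)) = \<rho> (pinv x k))"
    proof
      assume L: "\<forall>i\<in>S. \<rho> (pinv x (\<sigma> (x i))) = \<rho> i"
      show "\<forall>k\<in>S. \<rho> (pinv x (\<sigma> k)) = \<rho> (pinv x k)"
      proof
        fix k assume "k \<in> S"
        then have "pinv x k \<in> S" using permutes_in_image[OF permutes_inv[OF x]] by simp
        then have "\<rho> (pinv x (\<sigma> (x (pinv x k)))) = \<rho> (pinv x k)" using L by blast
        then show "\<rho> (pinv x (\<sigma> k)) = \<rho> (pinv x k)" by (simp add: permutes_inverses(1)[OF x])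
      qed
    next
      assume R: "\<forall>k\<in>S. \<rho> (pinv x (\<sigma> k)) = \<rho> (pinv x k)"
      show "\<forall>i\<in>S. \<rho> (pinv x (\<sigma> (x i))) = \<rho> i"
      proof
        fix i assume "i \<in> S"
        then have "x i \<in> S" using permutes_in_image[OF x] by simp
        then have "\<rho> (pinv x (\<sigma> (x i))) = \<rho> (pinv x (x i))" using R by blast
        then show "\<rho> (pinv x (\<sigma> (x i))) = \<rho> i" by (simp add: permutes_inverses(2)[OF x])
      qed
    qed
    also have "\<dots> \<longleftrightarrow> \<sigma> \<in> stab S (restrict (\<lambda>i. \<rho> (pinv x i)) S)"
      using \<sigma> permutes_in_image[OF \<sigma>] by (simp add: stab_def)
    finally show ?thesis .
  qed
  have stab_card: "card (stab S h) = card (stab S \<rho>)" if "h \<in> colourings S ?M" for h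
  proof -
    have e: "image_mset h (mset_set S) = ?M" using that by (simp add: colourings_def)
    have "bij_betw pinv {x. x permutes S \<and> (\<forall>i\<in>S. h (x i) = \<rho> i)} {x. x permutes S \<and> (\<forall>i\<in>S. \<rho> (x i) = h i)}"
    proof (rule bij_betw_byWitness[where f' = pinv])
      have *: "\<forall>i\<in>S. k (pinv x i) = g i" if "x permutes S" "\<forall>i\<in>S. g (x i) = k i" for x and g k :: "nat \<Rightarrow> 'b"
      proof
        fix i assume "i \<in> S"
        then have "pinv x i \<in> S" using permutes_in_image[OF permutes_inv[OF that(1)]] by simp
        then have "g (x (pinv x i)) = k (pinv x i)" using that(2) by blast
        then show "k (pinv x i) = g i" by (simp add: permutes_inverses(1)[OF that(1)])
      qed
      show "pinv ` {x. x permutes S \<and> (\<forall>i\<in>S. h (x i) = \<rho> i)} \<subseteq> {x. x permutes S \<and> (\<forall>i\<in>S. \<rho> (x i) = h i)}"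
        using * permutes_inv by blast
      show "pinv ` {x. x permutes S \<and> (\<forall>i\<in>S. \<rho> (x i) = h i)} \<subseteq> {x. x permutes S \<and> (\<forall>i\<in>S. h (x i) = \<rho> i)}"
        using * permutes_inv by blast
    qed (auto simp: permutes_inv_inv)
    then have "card {x. x permutes S \<and> (\<forall>i\<in>S. h (x i) = \<rho> i)} = card {x. x permutes S \<and> (\<forall>i\<in>S. \<rho> (x i) = h i)}"
      by (rule bij_betw_same_card)
    then show ?thesis using card_transporter[OF S e] card_transporter[OF S e[symmetric]] by simp
  qed
  let ?F = "\<lambda>h. if \<sigma> \<in> stab S h then 1 else (0::'a)"
  have "class_sum S (\<lambda>p. if p \<in> stab S \<rho> then 1 else 0) \<sigma> = (\<Sum>x | x permutes S. ?F (restrict (\<lambda>i. \<rho> (pinv x i)) S))"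
    unfolding class_sum_def by (rule sum.cong) (use conj in auto)
  also have "\<dots> = (\<Sum>x | x permutes S. ?F (restrict (\<lambda>i. \<rho> (x i)) S))"
    by (rule sum_permutes_inv)
  also have "\<dots> = (\<Sum>h\<in>colourings S ?M. of_nat (card (stab S h)) * ?F h)"
    by (rule sum_over_orbit[OF S refl])
  also have "\<dots> = (\<Sum>h\<in>colourings S ?M. of_nat (card (stab S \<rho>)) * ?F h)"
    by (rule sum.cong) (use stab_card in auto)
  also have "\<dots> = of_nat (card (stab S \<rho>)) * (\<Sum>h\<in>colourings S ?M. ?F h)"
    by (rule sum_distrib_left[symmetric])
  also have "(\<Sum>h\<in>colourings S ?M. ?F h) = of_nat (fixed_colourings S ?M \<sigma>)"
    unfolding fixed_colourings_def using finite_colourings[OF S, of ?M]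
    by (simp add: sum.If_cases Int_def)
  finally show ?thesis by simp
qed

text \<open>A pair of invariant colourings is one invariant colouring by pairs, whose content
  \<open>Q\<close> has the two given margins.\<close>

lemma fixed_colourings_mult:
  fixes M :: "'b multiset" and M' :: "'c multiset"
  assumes S: "finite S"
  shows "fixed_colourings S M \<sigma> * fixed_colourings S M' \<sigma> =
    (\<Sum>Q | image_mset fst Q = M \<and> image_mset snd Q = M'. fixed_colourings S Q \<sigma>)"
proof -
  let ?X = "\<lambda>Q. {g \<in> colourings S Q. \<sigma> \<in> stab S g}"
  let ?A = "{Q. image_mset fst Q = M \<and> image_mset snd Q = M'}"
  let ?f = "\<lambda>(h, h'). restrict (\<lambda>i. (h i, h' i)) S"
  let ?g = "\<lambda>g :: nat \<Rightarrow> 'b \<times> 'c. (restrict (\<lambda>i. fst (g i)) S, restrict (\<lambda>i. snd (g i)) S)"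
  have im: "image_mset (restrict k S) (mset_set S) = image_mset k (mset_set S)" for k :: "nat \<Rightarrow> 'd"
    by (rule image_mset_cong) (use S in simp)
  have stab_r: "\<sigma> \<in> stab S (restrict k S) \<longleftrightarrow> \<sigma> permutes S \<and> (\<forall>i\<in>S. k (\<sigma> i) = k i)" for k :: "nat \<Rightarrow> 'd"
    using permutes_in_image[of \<sigma> S] by (auto simp: stab_def)
  have "bij_betw ?f (?X M \<times> ?X M') (\<Union>Q\<in>?A. ?X Q)"
  proof (rule bij_betw_byWitness[where f' = ?g])
    show "\<forall>a\<in>?X M \<times> ?X M'. ?g (?f a) = a"
    proof
      fix a assume a: "a \<in> ?X M \<times> ?X M'"
      then obtain h h' where hh: "a = (h, h')" "h \<in> extensional S" "h' \<in> extensional S"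
        by (auto simp: colourings_def PiE_def)
      have "restrict (\<lambda>i. fst (?f a i)) S = h" "restrict (\<lambda>i. snd (?f a i)) S = h'"
        using hh by (auto intro!: extensionalityI[where A = S])
      then show "?g (?f a) = a" by (simp add: hh(1))
    qed
    show "\<forall>g\<in>\<Union>Q\<in>?A. ?X Q. ?f (?g g) = g"
    proof
      fix g assume "g \<in> (\<Union>Q\<in>?A. ?X Q)"
      then have "g \<in> extensional S" by (auto simp: colourings_def PiE_def)
      then show "?f (?g g) = g" unfolding prod.case by (intro extensionalityI[where A = S]) auto
    qed
    show "?f ` (?X M \<times> ?X M') \<subseteq> (\<Union>Q\<in>?A. ?X Q)"
    proof
      fix g assume "g \<in> ?f ` (?X M \<times> ?X M')"
      then obtain h h' where g: "g = restrict (\<lambda>i. (h i, h' i)) S" and h: "h \<in> ?X M" "h' \<in> ?X M'" by auto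
      let ?Q = "image_mset (\<lambda>i. (h i, h' i)) (mset_set S)"
      have "image_mset fst ?Q = M" "image_mset snd ?Q = M'"
        using h by (simp_all add: colourings_def multiset.map_comp comp_def)
      moreover have "g \<in> ?X ?Q"
        using h unfolding g mem_Collect_eq stab_r by (simp add: colourings_def im stab_def)
      ultimately show "g \<in> (\<Union>Q\<in>?A. ?X Q)" by blast
    qed
    show "?g ` (\<Union>Q\<in>?A. ?X Q) \<subseteq> ?X M \<times> ?X M'"
    proof
      fix a assume "a \<in> ?g ` (\<Union>Q\<in>?A. ?X Q)"
      then obtain g Q where a: "a = ?g g" and Q: "Q \<in> ?A" and g: "g \<in> ?X Q" by blast
      have "image_mset (\<lambda>i. fst (g i)) (mset_set S) = M" "image_mset (\<lambda>i. snd (g i)) (mset_set S) = M'"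
        using Q g by (auto simp: colourings_def multiset.map_comp comp_def)
      then show "a \<in> ?X M \<times> ?X M'"
        using g unfolding a mem_Times_iff fst_conv snd_conv mem_Collect_eq stab_r
        by (simp add: colourings_def im stab_def)
    qed
  qed
  then have "card (?X M \<times> ?X M') = card (\<Union>Q\<in>?A. ?X Q)" by (rule bij_betw_same_card)
  also have "\<dots> = (\<Sum>Q\<in>?A. card (?X Q))"
  proof (rule card_UN_disjoint)
    show "finite ?A" by (rule finite_pair_msets)
    show "\<forall>Q\<in>?A. finite (?X Q)" by (auto intro!: finite_colourings S)
    show "\<forall>Q\<in>?A. \<forall>Q'\<in>?A. Q \<noteq> Q' \<longrightarrow> ?X Q \<inter> ?X Q' = {}" unfolding colourings_def by blast
  qed
  finally show ?thesis by (simp add: fixed_colourings_def card_cartesian_product)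
qed

text \<open>The Gram matrix of the permutation characters is, up to the group order, the Cauchy
  kernel: each joint content \<open>Q\<close> is one orbit and counts once by Burnside.\<close>

lemma fixed_colourings_inner:
  assumes S: "finite S" and M: "size M = card S"
  shows "(\<Sum>\<sigma> | \<sigma> permutes S. fixed_colourings S M \<sigma> * fixed_colourings S M' \<sigma>) = fact (card S) * pair_count M M'"
proof -
  let ?A = "{Q. image_mset fst Q = M \<and> image_mset snd Q = M'}"
  have "(\<Sum>\<sigma> | \<sigma> permutes S. fixed_colourings S M \<sigma> * fixed_colourings S M' \<sigma>) =
      (\<Sum>Q\<in>?A. \<Sum>\<sigma> | \<sigma> permutes S. fixed_colourings S Q \<sigma>)"
    unfolding fixed_colourings_mult[OF S] by (rule sum.swap)
  also have "\<dots> = (\<Sum>Q\<in>?A. fact (card S))"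
  proof (rule sum.cong[OF refl])
    fix Q assume "Q \<in> ?A"
    then have "size Q = size M" by auto
    then show "(\<Sum>\<sigma> | \<sigma> permutes S. fixed_colourings S Q \<sigma>) = fact (card S)"
      using sum_fixed_colourings[OF S, of Q] M by simp
  qed
  finally show ?thesis by (simp add: pair_count_def)
qed

lemma fixed_colourings_relabel:
  assumes S: "finite S" and \<sigma>: "\<sigma> permutes S" and inj: "inj_on k (set_mset M)"
  shows "fixed_colourings S (image_mset k M) \<sigma> = fixed_colourings S M \<sigma>"
proof -
  let ?X = "\<lambda>M. {g \<in> colourings S M. \<sigma> \<in> stab S g}"
  define l where "l = the_inv_into (set_mset M) k"
  have lk: "l (k x) = x" if "x \<in># M" for x using that inj by (simp add: l_def the_inv_into_f_f)
  have kl: "k (l y) = y" if "y \<in># image_mset k M" for y using that lk by auto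
  have im: "image_mset (restrict k S) (mset_set S) = image_mset k (mset_set S)" for k :: "nat \<Rightarrow> 'd"
    by (rule image_mset_cong) (use S in simp)
  have lM: "image_mset l (image_mset k M) = M"
  proof -
    have "image_mset (\<lambda>x. l (k x)) M = image_mset (\<lambda>x. x) M" by (rule image_mset_cong) (rule lk)
    then show ?thesis by (simp add: multiset.map_comp comp_def)
  qed
  have mem: "restrict (\<lambda>i. g (h i)) S \<in> ?X (image_mset g N)" if "h \<in> ?X N" for g :: "'e \<Rightarrow> 'd" and h N
  proof -
    have "image_mset (\<lambda>i. g (h i)) (mset_set S) = image_mset g N"
      using that by (auto simp: colourings_def multiset.map_comp comp_def)
    then show ?thesis
      using that permutes_in_image[OF \<sigma>] by (simp add: colourings_def im stab_def)
  qed
  have "bij_betw (\<lambda>h. restrict (\<lambda>i. k (h i)) S) (?X M) (?X (image_mset k M))"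
  proof (rule bij_betw_byWitness[where f' = "\<lambda>h. restrict (\<lambda>i. l (h i)) S"])
    have ext: "h \<in> extensional S" if "h \<in> ?X N" for h N using that by (simp add: colourings_def PiE_def)
    show "\<forall>h\<in>?X M. restrict (\<lambda>i. l (restrict (\<lambda>i. k (h i)) S i)) S = h"
    proof
      fix h assume h: "h \<in> ?X M"
      then have "h i \<in># M" if "i \<in> S" for i using that colourings_value[OF S] by blast
      then show "restrict (\<lambda>i. l (restrict (\<lambda>i. k (h i)) S i)) S = h"
        by (intro extensionalityI[OF _ ext[OF h]]) (auto simp: lk)
    qed
    show "\<forall>h\<in>?X (image_mset k M). restrict (\<lambda>i. k (restrict (\<lambda>i. l (h i)) S i)) S = h"
    proof
      fix h assume h: "h \<in> ?X (image_mset k M)"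
      then have "h i \<in># image_mset k M" if "i \<in> S" for i using that colourings_value[OF S] by blast
      then have "k (l (h i)) = h i" if "i \<in> S" for i using that kl by blast
      then show "restrict (\<lambda>i. k (restrict (\<lambda>i. l (h i)) S i)) S = h"
        by (intro extensionalityI[OF _ ext[OF h]]) auto
    qed
    show "(\<lambda>h. restrict (\<lambda>i. k (h i)) S) ` ?X M \<subseteq> ?X (image_mset k M)" using mem by blast
    show "(\<lambda>h. restrict (\<lambda>i. l (h i)) S) ` ?X (image_mset k M) \<subseteq> ?X M"
      using mem[of _ "image_mset k M" l] unfolding lM by blast
  qed
  then show ?thesis unfolding fixed_colourings_def by (rule bij_betw_same_card[symmetric])
qed

text \<open>A colouring with letters \<open>h i * n + c i\<close> is invariant exactly if both
  \<open>h\<close> and \<open>c\<close> are. The choices of \<open>c\<close> do not depend on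
  \<open>M\<close>, so multiplying the alphabet multiplies the power sum function by their
  number.\<close>

lemma sum_fixed_colourings_div:
  fixes M :: "nat multiset" and n :: nat
  assumes S: "finite S" and \<sigma>: "\<sigma> permutes S" and n: "n > 0"
  shows "(\<Sum>N | image_mset (\<lambda>k. k div n) N = M. fixed_colourings S N \<sigma>) =
    card {c \<in> S \<rightarrow>\<^sub>E {..<n}. \<sigma> \<in> stab S c} * fixed_colourings S M \<sigma>"
proof -
  let ?X = "\<lambda>M. {g \<in> colourings S M. \<sigma> \<in> stab S g}"
  let ?C = "{c \<in> S \<rightarrow>\<^sub>E {..<n}. \<sigma> \<in> stab S c}"
  let ?A = "{N. image_mset (\<lambda>k. k div n) N = M}"
  let ?f = "\<lambda>(c, h). restrict (\<lambda>i. h i * n + c i) S"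
  let ?g = "\<lambda>g. (restrict (\<lambda>i. g i mod n) S, restrict (\<lambda>i. g i div n) S)"
  have im: "image_mset (restrict k S) (mset_set S) = image_mset k (mset_set S)" for k :: "nat \<Rightarrow> 'd"
    by (rule image_mset_cong) (use S in simp)
  have "bij_betw ?f (?C \<times> ?X M) (\<Union>N\<in>?A. ?X N)"
  proof (rule bij_betw_byWitness[where f' = ?g])
    show "\<forall>a\<in>?C \<times> ?X M. ?g (?f a) = a"
    proof
      fix a assume a: "a \<in> ?C \<times> ?X M"
      then obtain c h where ch: "a = (c, h)" "c \<in> extensional S" "h \<in> extensional S" "\<And>i. i \<in> S \<Longrightarrow> c i < n"
        by (auto simp: colourings_def PiE_def)
      have "restrict (\<lambda>i. ?f a i mod n) S = c"
        by (rule extensionalityI[OF _ ch(2)]) (use ch(1,4) in auto)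
      moreover have "restrict (\<lambda>i. ?f a i div n) S = h"
        by (rule extensionalityI[OF _ ch(3)]) (use ch(1,4) n in auto)
      ultimately show "?g (?f a) = a" by (simp add: ch(1))
    qed
    show "\<forall>g\<in>\<Union>N\<in>?A. ?X N. ?f (?g g) = g"
    proof
      fix g assume "g \<in> (\<Union>N\<in>?A. ?X N)"
      then have "g \<in> extensional S" by (auto simp: colourings_def PiE_def)
      then show "?f (?g g) = g" unfolding prod.case by (intro extensionalityI[where A = S]) auto
    qed
    show "?f ` (?C \<times> ?X M) \<subseteq> (\<Union>N\<in>?A. ?X N)"
    proof
      fix g assume "g \<in> ?f ` (?C \<times> ?X M)"
      then obtain c h where g: "g = restrict (\<lambda>i. h i * n + c i) S" and c: "c \<in> ?C" and h: "h \<in> ?X M" by auto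
      let ?N = "image_mset (\<lambda>i. h i * n + c i) (mset_set S)"
      have "image_mset (\<lambda>i. (h i * n + c i) div n) (mset_set S) = image_mset h (mset_set S)"
        by (rule image_mset_cong) (use S c in \<open>auto simp: PiE_iff\<close>)
      then have "?N \<in> ?A" using h by (simp add: colourings_def multiset.map_comp comp_def)
      moreover have "g \<in> ?X ?N"
        using h c permutes_in_image[OF \<sigma>] unfolding g by (simp add: colourings_def im stab_def)
      ultimately show "g \<in> (\<Union>N\<in>?A. ?X N)" by blast
    qed
    show "?g ` (\<Union>N\<in>?A. ?X N) \<subseteq> ?C \<times> ?X M"
    proof
      fix a assume "a \<in> ?g ` (\<Union>N\<in>?A. ?X N)"
      then obtain g N where a: "a = ?g g" and N: "N \<in> ?A" and g: "g \<in> ?X N" by blast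
      have "image_mset (\<lambda>i. g i div n) (mset_set S) = M"
        using N g by (auto simp: colourings_def multiset.map_comp comp_def)
      then show "a \<in> ?C \<times> ?X M"
        using g n permutes_in_image[OF \<sigma>] unfolding a by (simp add: colourings_def im stab_def)
    qed
  qed
  then have "card (?C \<times> ?X M) = card (\<Union>N\<in>?A. ?X N)" by (rule bij_betw_same_card)
  also have "\<dots> = (\<Sum>N\<in>?A. card (?X N))"
  proof (rule card_UN_disjoint)
    show "finite ?A" by (intro finite_image_mset_fibre finite_div_fibre n)
    show "\<forall>Q\<in>?A. finite (?X Q)" by (auto intro!: finite_colourings S)
    show "\<forall>Q\<in>?A. \<forall>Q'\<in>?A. Q \<noteq> Q' \<longrightarrow> ?X Q \<inter> ?X Q' = {}" unfolding colourings_def by blast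
  qed
  finally show ?thesis by (simp add: fixed_colourings_def card_cartesian_product)
qed

section \<open>Characters of Young symmetrizers\<close>

definition row_sum :: "nat set \<Rightarrow> (nat \<Rightarrow> nat) \<Rightarrow> (nat \<Rightarrow> nat) \<Rightarrow> 'a::comm_ring_1" where
  "row_sum S \<rho> = (\<lambda>p. if p \<in> stab S \<rho> then 1 else 0)"

definition col_sum :: "nat set \<Rightarrow> (nat \<Rightarrow> nat) \<Rightarrow> (nat \<Rightarrow> nat) \<Rightarrow> 'a::comm_ring_1" where
  "col_sum S \<gamma> = (\<lambda>p. if p \<in> stab S \<gamma> then of_int (sign p) else 0)"

definition ysym :: "nat set \<Rightarrow> (nat \<Rightarrow> nat) \<Rightarrow> (nat \<Rightarrow> nat) \<Rightarrow> (nat \<Rightarrow> nat) \<Rightarrow> 'a::comm_ring_1" where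
  "ysym S \<rho> \<gamma> = conv S (row_sum S \<rho>) (col_sum S \<gamma>)"

text \<open>The factor \<open>k\<close> with \<open>c c = k c\<close> for the Young symmetrizer
  \<open>c\<close>, read off at \<open>id\<close>, where \<open>c\<close> has the value 1. It is the
  group order over the dimension, hence the product of the hook lengths.\<close>

definition hook_scalar :: "nat set \<Rightarrow> (nat \<Rightarrow> nat) \<Rightarrow> (nat \<Rightarrow> nat) \<Rightarrow> 'a::comm_ring_1" where
  "hook_scalar S \<rho> \<gamma> = conv S (ysym S \<rho> \<gamma>) (ysym S \<rho> \<gamma>) id"

text \<open>The trace of \<sigma> on the left ideal generated by the Young symmetrizer, as
  \<open>irrep_character_eq\<close> confirms.\<close>

definition ychar :: "nat set \<Rightarrow> (nat \<Rightarrow> nat) \<Rightarrow> (nat \<Rightarrow> nat) \<Rightarrow> (nat \<Rightarrow> nat) \<Rightarrow> 'a::field" where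
  "ychar S \<rho> \<gamma> \<sigma> = class_sum S (ysym S \<rho> \<gamma>) \<sigma> / hook_scalar S \<rho> \<gamma>"

section \<open>Integrality and rationality of the values\<close>

lemma row_sum_of_int: "row_sum S \<rho> x = of_int (row_sum S \<rho> x)"
  by (simp add: row_sum_def)

lemma col_sum_of_int: "col_sum S \<gamma> x = of_int (col_sum S \<gamma> x)"
  by (simp add: col_sum_def)

lemma ysym_of_int: "ysym S \<rho> \<gamma> x = of_int (ysym S \<rho> \<gamma> x)"
  unfolding ysym_def conv_def of_int_sum of_int_mult
  by (simp only: row_sum_of_int[symmetric] col_sum_of_int[symmetric])

lemma hook_scalar_of_int: "hook_scalar S \<rho> \<gamma> = of_int (hook_scalar S \<rho> \<gamma>)"
  unfolding hook_scalar_def conv_def of_int_sum of_int_mult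
  by (simp only: ysym_of_int[symmetric])

lemma class_sum_ysym_of_int: "class_sum S (ysym S \<rho> \<gamma>) \<sigma> = of_int (class_sum S (ysym S \<rho> \<gamma>) \<sigma>)"
  unfolding class_sum_def of_int_sum by (simp only: ysym_of_int[symmetric])

text \<open>Arguments by positivity of norms take place over the rationals; this carries their
  outcome to an arbitrary field of characteristic 0.\<close>

lemma ychar_of_rat: "ychar S \<rho> \<gamma> \<sigma> = (of_rat (ychar S \<rho> \<gamma> \<sigma>) :: 'a::field_char_0)"
proof -
  have "(of_rat (ychar S \<rho> \<gamma> \<sigma>) :: 'a) =
      of_rat (of_int (class_sum S (ysym S \<rho> \<gamma>) \<sigma>) / of_int (hook_scalar S \<rho> \<gamma>))"
    unfolding ychar_def by (subst class_sum_ysym_of_int, subst hook_scalar_of_int) (rule refl)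
  also have "\<dots> = of_int (class_sum S (ysym S \<rho> \<gamma>) \<sigma>) / of_int (hook_scalar S \<rho> \<gamma>)"
    by (simp add: of_rat_divide)
  also have "\<dots> = ychar S \<rho> \<gamma> \<sigma>"
    unfolding ychar_def by (simp only: class_sum_ysym_of_int[symmetric] hook_scalar_of_int[symmetric])
  finally show ?thesis by simp
qed

section \<open>Products and inner products of Young symmetrizers\<close>

lemma left_inv_row_sum: "left_inv S \<rho> (row_sum S \<rho>)"
  by (simp add: left_inv_def row_sum_def stab_comp_left_iff)

lemma right_alt_col_sum:
  assumes "finite S"
  shows "right_alt S \<gamma> (col_sum S \<gamma>)"
  unfolding right_alt_def
proof (intro ballI allI impI)
  fix q x assume q: "q \<in> stab S \<gamma>" and x: "x permutes S"
  have "permutation q" "permutation x"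
    using q x assms stab_permutes permutation_permutes by blast+
  then show "col_sum S \<gamma> (x \<circ> q) = of_int (sign q) * col_sum S \<gamma> x"
    by (simp add: col_sum_def stab_comp_right_iff[OF q] sign_compose mult.commute)
qed

lemma left_inv_ysym: "left_inv S \<rho> (ysym S \<rho> \<gamma>)"
  unfolding ysym_def by (rule conv_left_inv[OF left_inv_row_sum])

lemma right_alt_ysym: "finite S \<Longrightarrow> right_alt S \<gamma> (ysym S \<rho> \<gamma>)"
  unfolding ysym_def by (rule conv_right_alt[OF right_alt_col_sum])

lemma stab_row_col:
  assumes F: "young_filling S f \<rho> \<gamma>" and p: "p \<in> stab S \<rho>" "p \<in> stab S \<gamma>"
  shows "p = id"
proof -
  have bij: "bij_betw (\<lambda>i. (\<rho> i, \<gamma> i)) S (diagram f)" using F by (simp add: young_filling_def)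
  have pS: "p permutes S" by (rule stab_permutes[OF p(1)])
  have "p i = i" for i
  proof (cases "i \<in> S")
    case True
    show ?thesis
      by (rule inj_onD[OF bij_betw_imp_inj_on[OF bij]])
        (use True p permutes_in_image[OF pS] in \<open>auto simp: stab_def\<close>)
  next
    case False
    then show ?thesis using pS by (simp add: permutes_def)
  qed
  then show ?thesis by (simp add: fun_eq_iff)
qed

text \<open>A permutation preserving rows and columns fixes every cell, so \<open>id\<close> arises
  as row permutation times column permutation in only one way.\<close>

lemma ysym_id:
  assumes F: "young_filling S f \<rho> \<gamma>"
  shows "ysym S \<rho> \<gamma> id = (1 :: 'a::comm_ring_1)"
proof -
  have S: "finite S" using F by (simp add: young_filling_def)
  have "row_sum S \<rho> y * col_sum S \<gamma> (pinv y \<circ> id) = (if y = id then 1 else 0 :: 'a)" if "y permutes S" for y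
  proof (cases "y = id")
    case True
    then show ?thesis by (simp add: row_sum_def col_sum_def stab_id)
  next
    case False
    have "y \<notin> stab S \<rho> \<or> pinv y \<notin> stab S \<gamma>"
      using stab_row_col[OF F, of y] False stab_inv_iff[OF that, of \<gamma>] by blast
    then show ?thesis using False by (auto simp: row_sum_def col_sum_def)
  qed
  then have "ysym S \<rho> \<gamma> id = (\<Sum>y | y permutes S. if y = id then 1 else 0 :: 'a)"
    unfolding ysym_def conv_def by (intro sum.cong) auto
  also have "\<dots> = 1" using finite_permutations[OF S] by (simp add: permutes_id)
  finally show ?thesis .
qed

lemma conv_ysym_ysym:
  fixes \<rho> \<gamma> :: "nat \<Rightarrow> nat"
  assumes F: "young_filling S f \<rho> \<gamma>" and x: "x permutes S"
  shows "conv S (ysym S \<rho> \<gamma>) (ysym S \<rho> \<gamma>) x = (hook_scalar S \<rho> \<gamma> * ysym S \<rho> \<gamma> x :: 'a::{idom, ring_char_0})"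
proof -
  have S: "finite S" using F by (simp add: young_filling_def)
  show ?thesis unfolding hook_scalar_def
    by (rule eq_multiple_of_biinvariant[OF F conv_left_inv[OF left_inv_ysym] conv_right_alt[OF right_alt_ysym[OF S]]
          left_inv_ysym right_alt_ysym[OF S] ysym_id[OF F] x])
qed

lemma conv_row_sum_ysym:
  assumes S: "finite S" and x: "x permutes S"
  shows "conv S (row_sum S \<rho>) (ysym S \<rho> \<gamma>) x = of_nat (card (stab S \<rho>)) * ysym S \<rho> \<gamma> x"
proof -
  have "conv S (row_sum S \<rho>) (ysym S \<rho> \<gamma>) x = (\<Sum>y | y permutes S. if y \<in> stab S \<rho> then ysym S \<rho> \<gamma> x else 0)"
    unfolding conv_def
  proof (rule sum.cong[OF refl])
    fix y
    show "row_sum S \<rho> y * ysym S \<rho> \<gamma> (pinv y \<circ> x) = (if y \<in> stab S \<rho> then ysym S \<rho> \<gamma> x else 0)"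
      using left_inv_ysym[of S \<rho> \<gamma>] stab_inv[of y S \<rho>] x by (auto simp: row_sum_def left_inv_def)
  qed
  also have "\<dots> = (\<Sum>y\<in>stab S \<rho>. ysym S \<rho> \<gamma> x)"
    by (rule sum.mono_neutral_cong_right) (use finite_permutations[OF S] in \<open>auto simp: stab_def\<close>)
  finally show ?thesis by simp
qed

text \<open>By von Neumann's lemma, \<open>u z v\<close> is its value at \<open>id\<close> times the
  Young symmetrizer \<open>c\<close>. Taking the coefficient at \<open>z\<close> and summing over
  \<open>z\<close> reassembles the product \<open>u c v\<close>, evaluated at
  \<open>id\<close>.\<close>

lemma sum_conv3_same:
  fixes u v :: "(nat \<Rightarrow> nat) \<Rightarrow> 'a::{idom, ring_char_0}"
  assumes F: "young_filling S f \<rho> \<gamma>" and u: "left_inv S \<rho> u" and v: "right_alt S \<gamma> v"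
  shows "(\<Sum>z | z permutes S. conv3 S u z v z) = conv S u (conv S (ysym S \<rho> \<gamma>) v) id"
proof -
  have S: "finite S" using F by (simp add: young_filling_def)
  let ?c = "ysym S \<rho> \<gamma> :: _ \<Rightarrow> 'a"
  have "(\<Sum>z | z permutes S. conv3 S u z v z) = (\<Sum>z | z permutes S. conv3 S u z v id * ?c z)"
  proof (rule sum.cong[OF refl])
    fix z assume "z \<in> {z. z permutes S}"
    then have z: "z permutes S" by simp
    show "conv3 S u z v z = conv3 S u z v id * ?c z"
      by (rule eq_multiple_of_biinvariant[OF F conv3_left_inv[OF u z] conv3_right_alt[OF v z]
            left_inv_ysym right_alt_ysym[OF S] ysym_id[OF F] z])
  qed
  also have "\<dots> = (\<Sum>z | z permutes S. \<Sum>y | y permutes S. u y * (?c z * v (pinv z \<circ> (pinv y \<circ> id))))"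
    unfolding conv3_def sum_distrib_right by (intro sum.cong refl) (simp only: mult_ac)
  also have "\<dots> = (\<Sum>y | y permutes S. \<Sum>z | z permutes S. u y * (?c z * v (pinv z \<circ> (pinv y \<circ> id))))"
    by (rule sum.swap)
  also have "\<dots> = conv S u (conv S ?c v) id"
    by (simp add: conv_def sum_distrib_left)
  finally show ?thesis .
qed

text \<open>Inversion fixes the row sum \<open>a\<close> and the signed column sum \<open>b\<close>
  and turns \<open>a b\<close> into \<open>b a\<close>; a sum over conjugates does not see the order
  of the factors.\<close>

lemma ysym_pinv_symmetric:
  assumes \<sigma>: "\<sigma> permutes S" and S: "finite S"
  shows "class_sum S (ysym S \<rho> \<gamma>) (pinv \<sigma>) = (class_sum S (ysym S \<rho> \<gamma>) \<sigma> :: 'a::comm_ring_1)"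
proof -
  let ?G = "{p. p permutes S}"
  let ?a = "row_sum S \<rho> :: _ \<Rightarrow> 'a" and ?b = "col_sum S \<gamma> :: _ \<Rightarrow> 'a"
  have a: "?a (pinv y) = ?a y" if "y permutes S" for y
    using stab_inv_iff[OF that, of \<rho>] by (simp add: row_sum_def)
  have b: "?b (pinv y) = ?b y" if "y permutes S" for y
  proof -
    have "permutation y" using that S permutation_permutes by blast
    then show ?thesis using stab_inv_iff[OF that, of \<gamma>] sign_inverse[of y] by (simp add: col_sum_def)
  qed
  have "class_sum S (ysym S \<rho> \<gamma>) (pinv \<sigma>) = (\<Sum>x\<in>?G. \<Sum>y\<in>?G. ?a y * ?b (pinv x \<circ> (\<sigma> \<circ> (x \<circ> y))))"
    unfolding class_sum_def ysym_def conv_def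
  proof (intro sum.cong refl)
    fix x y assume "x \<in> ?G" "y \<in> ?G"
    then have x: "x permutes S" and y: "y permutes S" by auto
    have "pinv (pinv x \<circ> (\<sigma> \<circ> (x \<circ> y))) = pinv y \<circ> (pinv x \<circ> (pinv \<sigma> \<circ> x))"
      using x y \<sigma> by (simp add: permutes_inv_comp[where S = S] permutes_compose permutes_inv permutes_inv_inv comp_assoc)
    moreover have "pinv x \<circ> (\<sigma> \<circ> (x \<circ> y)) permutes S"
      using x y \<sigma> by (intro permutes_compose permutes_inv)
    ultimately have "?b (pinv y \<circ> (pinv x \<circ> (pinv \<sigma> \<circ> x))) = ?b (pinv x \<circ> (\<sigma> \<circ> (x \<circ> y)))" using b by metis
    then show "?a y * ?b (pinv y \<circ> (pinv x \<circ> (pinv \<sigma> \<circ> x))) = ?a y * ?b (pinv x \<circ> (\<sigma> \<circ> (x \<circ> y)))" by simp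
  qed
  also have "\<dots> = (\<Sum>y\<in>?G. \<Sum>x\<in>?G. ?a y * ?b (pinv x \<circ> (\<sigma> \<circ> (x \<circ> y))))" by (rule sum.swap)
  \<comment> \<open>Substituting \<open>x \<circ> pinv y\<close> for \<open>x\<close> moves
    \<open>y\<close> from the right end to the left end.\<close>
  also have "\<dots> = (\<Sum>y\<in>?G. \<Sum>x\<in>?G. ?a y * ?b (y \<circ> (pinv x \<circ> (\<sigma> \<circ> x))))"
  proof (rule sum.cong[OF refl])
    fix y assume "y \<in> ?G"
    then have y: "y permutes S" by simp
    show "(\<Sum>x\<in>?G. ?a y * ?b (pinv x \<circ> (\<sigma> \<circ> (x \<circ> y)))) = (\<Sum>x\<in>?G. ?a y * ?b (y \<circ> (pinv x \<circ> (\<sigma> \<circ> x))))"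
      by (subst sum_permutes_right[OF permutes_inv[OF y], symmetric], rule sum.cong)
        (use y \<sigma> in \<open>auto simp: permutes_group_simps permutes_inv_comp[where S = S]\<close>)
  qed
  also have "\<dots> = (\<Sum>y\<in>?G. \<Sum>x\<in>?G. ?a y * ?b (pinv y \<circ> (pinv x \<circ> (\<sigma> \<circ> x))))"
    by (subst sum_permutes_inv[symmetric], rule sum.cong)
      (auto simp: a permutes_inv_inv)
  also have "\<dots> = (\<Sum>x\<in>?G. \<Sum>y\<in>?G. ?a y * ?b (pinv y \<circ> (pinv x \<circ> (\<sigma> \<circ> x))))" by (rule sum.swap)
  finally show ?thesis by (simp add: class_sum_def ysym_def conv_def)
qed

lemma conv_cong:
  assumes "\<And>x. x permutes S \<Longrightarrow> g x = h x" "x permutes S"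
  shows "conv S f g x = conv S f h x"
  unfolding conv_def by (rule sum.cong) (use assms in \<open>auto simp: permutes_compose permutes_inv\<close>)

lemma conv_scale_right: "conv S f (\<lambda>x. k * g x) x = k * conv S f g x"
  by (simp add: conv_def sum_distrib_left mult_ac)

lemma conv_conv_ysym:
  fixes \<rho> \<gamma> :: "nat \<Rightarrow> nat" and u :: "(nat \<Rightarrow> nat) \<Rightarrow> 'a::{idom, ring_char_0}"
  assumes F: "young_filling S f \<rho> \<gamma>"
  shows "conv S u (conv S (ysym S \<rho> \<gamma>) (ysym S \<rho> \<gamma>)) id = hook_scalar S \<rho> \<gamma> * conv S u (ysym S \<rho> \<gamma>) id"
proof -
  have "conv S u (conv S (ysym S \<rho> \<gamma>) (ysym S \<rho> \<gamma>)) id = conv S u (\<lambda>x. hook_scalar S \<rho> \<gamma> * ysym S \<rho> \<gamma> x) id"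
    by (rule conv_cong) (auto simp: conv_ysym_ysym[OF F] permutes_id)
  then show ?thesis by (simp add: conv_scale_right)
qed

text \<open>For \<open>u = v = c\<close> the trace is the cube of \<open>c\<close> at
  \<open>id\<close>, which is the square of the scalar.\<close>

lemma inner_ysym_same:
  assumes F: "young_filling S f \<rho> \<gamma>"
  shows "(\<Sum>\<sigma> | \<sigma> permutes S. class_sum S (ysym S \<rho> \<gamma>) \<sigma> * class_sum S (ysym S \<rho> \<gamma>) \<sigma>) =
    (of_nat (fact (card S)) * (hook_scalar S \<rho> \<gamma>)^2 :: 'a::{idom, ring_char_0})"
proof -
  have S: "finite S" using F by (simp add: young_filling_def)
  have "(\<Sum>\<sigma> | \<sigma> permutes S. class_sum S (ysym S \<rho> \<gamma>) \<sigma> * class_sum S (ysym S \<rho> \<gamma>) \<sigma>) =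
      (\<Sum>\<sigma> | \<sigma> permutes S. class_sum S (ysym S \<rho> \<gamma>) \<sigma> * (class_sum S (ysym S \<rho> \<gamma>) (pinv \<sigma>) :: 'a))"
    by (rule sum.cong) (auto simp: ysym_pinv_symmetric S)
  also have "\<dots> = of_nat (fact (card S)) * conv S (ysym S \<rho> \<gamma>) (conv S (ysym S \<rho> \<gamma>) (ysym S \<rho> \<gamma>)) id"
    by (simp only: class_sum_inner[OF S] sum_conv3_same[OF F left_inv_ysym right_alt_ysym[OF S]])
  also have "\<dots> = of_nat (fact (card S)) * (hook_scalar S \<rho> \<gamma> * hook_scalar S \<rho> \<gamma>)"
    unfolding conv_conv_ysym[OF F] by (simp only: hook_scalar_def)
  finally show ?thesis by (simp add: power2_eq_square)
qed

text \<open>For the row sum \<open>a\<close> in place of \<open>u\<close>, the trace is that of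
  \<open>a c c\<close> at \<open>id\<close>; one factor \<open>c\<close> is absorbed by the scalar,
  and \<open>a\<close> by the left invariance of \<open>c\<close>. After normalization this is the
  diagonal entry 1.\<close>

lemma inner_row_sum_ysym_same:
  assumes F: "young_filling S f \<rho> \<gamma>"
  shows "(\<Sum>\<sigma> | \<sigma> permutes S. class_sum S (row_sum S \<rho>) \<sigma> * class_sum S (ysym S \<rho> \<gamma>) \<sigma>) =
    (of_nat (fact (card S)) * (of_nat (card (stab S \<rho>)) * hook_scalar S \<rho> \<gamma>) :: 'a::{idom, ring_char_0})"
proof -
  have S: "finite S" using F by (simp add: young_filling_def)
  have "(\<Sum>\<sigma> | \<sigma> permutes S. class_sum S (row_sum S \<rho>) \<sigma> * class_sum S (ysym S \<rho> \<gamma>) \<sigma>) =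
      (\<Sum>\<sigma> | \<sigma> permutes S. class_sum S (row_sum S \<rho>) \<sigma> * (class_sum S (ysym S \<rho> \<gamma>) (pinv \<sigma>) :: 'a))"
    by (rule sum.cong) (auto simp: ysym_pinv_symmetric S)
  also have "\<dots> = of_nat (fact (card S)) * conv S (row_sum S \<rho>) (conv S (ysym S \<rho> \<gamma>) (ysym S \<rho> \<gamma>)) id"
    by (simp only: class_sum_inner[OF S] sum_conv3_same[OF F left_inv_row_sum right_alt_ysym[OF S]])
  also have "\<dots> = of_nat (fact (card S)) * (hook_scalar S \<rho> \<gamma> * of_nat (card (stab S \<rho>)))"
    unfolding conv_conv_ysym[OF F] conv_row_sum_ysym[OF S permutes_id] ysym_id[OF F] by simp
  finally show ?thesis by (simp add: mult.commute)
qed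

text \<open>Failure of dominance kills \<open>u z v\<close> at \<open>z\<close> for every
  \<open>z\<close>, so the whole trace is a sum of zeros.\<close>

lemma inner_vanish:
  fixes u :: "(nat \<Rightarrow> nat) \<Rightarrow> 'a::{idom, ring_char_0}"
  assumes F: "young_filling S f \<rho>' \<gamma>" and u: "left_inv S \<rho> u"
    and m: "card {i \<in> S. \<rho>' i < m} < card {i \<in> S. \<rho> i < m}"
  shows "(\<Sum>\<sigma> | \<sigma> permutes S. class_sum S u \<sigma> * class_sum S (ysym S \<rho>' \<gamma>) \<sigma>) = 0"
proof -
  have S: "finite S" using F by (simp add: young_filling_def)
  have "(\<Sum>\<sigma> | \<sigma> permutes S. class_sum S u \<sigma> * class_sum S (ysym S \<rho>' \<gamma>) \<sigma>) =
      (\<Sum>\<sigma> | \<sigma> permutes S. class_sum S u \<sigma> * class_sum S (ysym S \<rho>' \<gamma>) (pinv \<sigma>))"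
    by (rule sum.cong) (auto simp: ysym_pinv_symmetric S)
  also have "\<dots> = of_nat (fact (card S)) * (\<Sum>z | z permutes S. conv3 S u z (ysym S \<rho>' \<gamma>) z)"
    by (rule class_sum_inner[OF S])
  also have "(\<Sum>z | z permutes S. conv3 S u z (ysym S \<rho>' \<gamma>) z) = 0"
  proof (rule sum.neutral, rule ballI)
    fix z assume "z \<in> {z. z permutes S}"
    then have z: "z permutes S" by simp
    show "conv3 S u z (ysym S \<rho>' \<gamma>) z = 0"
      by (rule vanish_unless_dominates[OF F conv3_left_inv[OF u z] conv3_right_alt[OF right_alt_ysym[OF S] z] z m])
  qed
  finally show ?thesis by simp
qed

text \<open>Over the integers a zero scalar would give the class sum norm 0, yet its value at
  \<open>id\<close> is the group order. Being an integer, the scalar stays nonzero in characteristic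
  0.\<close>

lemma hook_scalar_nonzero:
  assumes F: "young_filling S f \<rho> \<gamma>"
  shows "hook_scalar S \<rho> \<gamma> \<noteq> (0 :: 'a::{idom, ring_char_0})"
proof -
  have S: "finite S" using F by (simp add: young_filling_def)
  have "hook_scalar S \<rho> \<gamma> \<noteq> (0 :: int)"
  proof
    assume "hook_scalar S \<rho> \<gamma> = (0 :: int)"
    then have "(\<Sum>\<sigma> | \<sigma> permutes S. (class_sum S (ysym S \<rho> \<gamma>) \<sigma> :: int)^2) = 0"
      using inner_ysym_same[OF F, where 'a = int] by (simp add: power2_eq_square)
    then have "\<forall>\<sigma>\<in>{\<sigma>. \<sigma> permutes S}. (class_sum S (ysym S \<rho> \<gamma>) \<sigma> :: int)^2 = 0"
      using sum_nonneg_eq_0_iff[OF finite_permutations[OF S], of "\<lambda>\<sigma>. (class_sum S (ysym S \<rho> \<gamma>) \<sigma> :: int)^2"] by simp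
    then have "class_sum S (ysym S \<rho> \<gamma>) id = (0 :: int)" using permutes_id by auto
    moreover have "class_sum S (ysym S \<rho> \<gamma>) id = (\<Sum>x | x permutes S. 1 :: int)"
      unfolding class_sum_def
      by (rule sum.cong) (auto simp: permutes_inv_o ysym_id[OF F])
    ultimately show False using card_permutations[OF refl S] by simp
  qed
  then show ?thesis by (subst hook_scalar_of_int) simp
qed

section \<open>The Specht module\<close>

text \<open>Here \<open>P g\<close> is the image of the standard basis vector at \<open>g\<close> under a projection onto \<open>W\<close>.\<close>

lemma trace_on_projection:
  fixes W :: "('b \<Rightarrow> 'a::field) set" and P :: "'b \<Rightarrow> 'b \<Rightarrow> 'a"
  assumes G: "finite G" and W: "fmod.subspace W"
    and P: "\<And>g. g \<in> G \<Longrightarrow> P g \<in> W"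
    and id: "\<And>w. w \<in> W \<Longrightarrow> w = (\<Sum>g\<in>G. fscale (w g) (P g))"
    and T: "\<And>w. w \<in> W \<Longrightarrow> T w \<in> W"
    and lin: "\<And>B c. finite B \<Longrightarrow> T (\<Sum>b\<in>B. fscale (c b) b) = (\<Sum>b\<in>B. fscale (c b) (T b))"
  shows "trace_on W T = (\<Sum>g\<in>G. T (P g) g)"
proof -
  interpret vs: vector_space "fscale :: 'a \<Rightarrow> ('b \<Rightarrow> 'a) \<Rightarrow> 'b \<Rightarrow> 'a"
    by standard (auto simp: fscale_def fun_eq_iff algebra_simps)
  define B where "B = (SOME B. fmod.independent B \<and> fmod.span B = W)"
  have "\<exists>B. fmod.independent B \<and> fmod.span B = W"
    using vs.maximal_independent_subset[of W] W by (metis fmod.span_subspace)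
  then have "fmod.independent B \<and> fmod.span B = W" unfolding B_def by (rule someI_ex)
  then have B: "fmod.independent B" and span: "fmod.span B = W" by auto
  have BW: "b \<in> W" if "b \<in> B" for b using that span fmod.span_base by blast
  have "B \<subseteq> fmod.span (P ` G)"
  proof
    fix b assume "b \<in> B"
    then have "b = (\<Sum>g\<in>G. fscale (b g) (P g))" by (intro id BW)
    also have "\<dots> \<in> fmod.span (P ` G)"
      by (intro fmod.span_sum fmod.span_scale fmod.span_base) auto
    finally show "b \<in> fmod.span (P ` G)" .
  qed
  then have finB: "finite B"
    using vs.independent_span_bound[of "P ` G" B] G B by auto
  let ?r = "fmod.representation B"
  have rep: "(\<Sum>b\<in>B. fscale (?r w b) b) = w" if "w \<in> W" for w
    by (rule fmod.sum_representation_eq) (use B span that finB in auto)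
  have "(\<Sum>g\<in>G. T (P g) g) = (\<Sum>g\<in>G. \<Sum>b\<in>B. ?r (P g) b * T b g)"
  proof (rule sum.cong[OF refl])
    fix g assume g: "g \<in> G"
    have "T (P g) = T (\<Sum>b\<in>B. fscale (?r (P g) b) b)" using rep[OF P[OF g]] by simp
    also have "\<dots> = (\<Sum>b\<in>B. fscale (?r (P g) b) (T b))" by (rule lin[OF finB])
    finally show "T (P g) g = (\<Sum>b\<in>B. ?r (P g) b * T b g)" by (simp add: sum_fun_apply fscale_def)
  qed
  \<comment> \<open>Exchanging the sums is the identity of the traces of \<open>T P\<close> and
    \<open>P T\<close>; the latter restricts to \<open>T\<close> on \<open>W\<close>.\<close>
  also have "\<dots> = (\<Sum>b\<in>B. \<Sum>g\<in>G. ?r (P g) b * T b g)" by (rule sum.swap)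
  also have "\<dots> = (\<Sum>b\<in>B. ?r (T b) b)"
  proof (rule sum.cong[OF refl])
    fix b assume b: "b \<in> B"
    have "?r (T b) = ?r (\<Sum>g\<in>G. fscale (T b g) (P g))" using id[OF T[OF BW[OF b]]] by simp
    also have "\<dots> = (\<lambda>b'. \<Sum>g\<in>G. ?r (fscale (T b g) (P g)) b')"
      by (rule fmod.representation_sum[OF B]) (use P span fmod.span_scale in auto)
    finally show "(\<Sum>g\<in>G. ?r (P g) b * T b g) = ?r (T b) b"
      using P span by (simp add: fmod.representation_scale[OF B] mult.commute)
  qed
  finally show ?thesis by (simp add: trace_on_def Let_def B_def)
qed

lemma ga_mult_eq_conv:
  "ga_mult d f g x = (if x permutes {1..d} then conv {1..d} f g x else 0)"
proof (cases "x permutes {1..d}")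
  case True
  have "ga_mult d f g x = (\<Sum>y | y permutes {1..d}. f y * g (pinv y \<circ> x))"
    unfolding ga_mult_def sym_group_carrier
    by (rule sum.reindex_bij_witness[where i = "\<lambda>y. (y, pinv y \<circ> x)" and j = fst])
      (use True in \<open>auto simp: permutes_group_simps\<close>)
  then show ?thesis using True by (simp add: conv_def)
next
  case False
  then have "{(y, z). y \<in> carrier (sym_group d) \<and> z \<in> carrier (sym_group d) \<and> y \<circ> z = x} = {}"
    by (auto simp: sym_group_carrier permutes_compose)
  then show ?thesis using False by (simp add: ga_mult_def del: Collect_empty_eq)
qed

lemma conv_assoc:
  assumes x: "x permutes S"
  shows "conv S (conv S f g) h x = conv S f (conv S g h) x"
proof -
  let ?G = "{p. p permutes S}"
  have "conv S (conv S f g) h x = (\<Sum>y\<in>?G. \<Sum>z\<in>?G. f z * (g (pinv z \<circ> y) * h (pinv y \<circ> x)))"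
    by (simp add: conv_def sum_distrib_right mult.assoc)
  also have "\<dots> = (\<Sum>z\<in>?G. \<Sum>y\<in>?G. f z * (g (pinv z \<circ> y) * h (pinv y \<circ> x)))" by (rule sum.swap)
  also have "\<dots> = (\<Sum>z\<in>?G. \<Sum>w\<in>?G. f z * (g w * h (pinv w \<circ> (pinv z \<circ> x))))"
  proof (rule sum.cong[OF refl])
    fix z assume "z \<in> ?G"
    then have z: "z permutes S" by simp
    show "(\<Sum>y\<in>?G. f z * (g (pinv z \<circ> y) * h (pinv y \<circ> x))) = (\<Sum>w\<in>?G. f z * (g w * h (pinv w \<circ> (pinv z \<circ> x))))"
      by (subst sum_permutes_left[OF z, symmetric], rule sum.cong)
        (use z in \<open>auto simp: permutes_group_simps permutes_inv_comp[where S = S]\<close>)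
  qed
  finally show ?thesis by (simp add: conv_def sum_distrib_left)
qed

section \<open>The canonical tableau and its row and column groups\<close>

definition row_of :: "nat list \<Rightarrow> nat \<Rightarrow> nat" where
  "row_of \<alpha> k = fst (inv_into (young_diagram \<alpha>) (canonical_tableau \<alpha>) k)"

definition col_of :: "nat list \<Rightarrow> nat \<Rightarrow> nat" where
  "col_of \<alpha> k = snd (inv_into (young_diagram \<alpha>) (canonical_tableau \<alpha>) k)"

lemma sum_list_take_mono: "i \<le> j \<Longrightarrow> sum_list (take i \<alpha>) \<le> sum_list (take j (\<alpha> :: nat list))"
  by (metis le_add1 le_add_diff_inverse sum_list_append take_add)

lemma canonical_tableau_bounds:
  assumes "(i, j) \<in> young_diagram \<alpha>"
  shows "sum_list (take i \<alpha>) < canonical_tableau \<alpha> (i, j)"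
    and "canonical_tableau \<alpha> (i, j) \<le> sum_list (take (Suc i) \<alpha>)"
  using assms by (auto simp: canonical_tableau_def young_diagram_def take_Suc_conv_app_nth)

text \<open>The rows occupy consecutive intervals bounded by the partial sums, so entries of
  different rows differ; counting cells then gives surjectivity.\<close>

lemma bij_betw_canonical_tableau:
  assumes "is_partition \<alpha>"
  shows "bij_betw (canonical_tableau \<alpha>) (young_diagram \<alpha>) {1..sum_list \<alpha>}"
proof -
  have less: "canonical_tableau \<alpha> (i, j) < canonical_tableau \<alpha> (i', j')"
    if "(i, j) \<in> young_diagram \<alpha>" "(i', j') \<in> young_diagram \<alpha>" "i < i'" for i j i' j'
  proof -
    have "canonical_tableau \<alpha> (i, j) \<le> sum_list (take (Suc i) \<alpha>)" by (rule canonical_tableau_bounds[OF that(1)])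
    also have "\<dots> \<le> sum_list (take i' \<alpha>)" using that(3) by (intro sum_list_take_mono) simp
    also have "\<dots> < canonical_tableau \<alpha> (i', j')" by (rule canonical_tableau_bounds[OF that(2)])
    finally show ?thesis .
  qed
  have inj: "inj_on (canonical_tableau \<alpha>) (young_diagram \<alpha>)"
  proof (rule inj_onI)
    fix c c' assume c: "c \<in> young_diagram \<alpha>" "c' \<in> young_diagram \<alpha>"
      and eq: "canonical_tableau \<alpha> c = canonical_tableau \<alpha> c'"
    obtain i j i' j' where ij: "c = (i, j)" "c' = (i', j')" by (metis surj_pair)
    have "i = i'" using less[of i j i' j'] less[of i' j' i j] c eq unfolding ij by (metis linorder_neqE_nat less_irrefl)
    then show "c = c'" using eq unfolding ij by (simp add: canonical_tableau_def)
  qed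
  moreover have "canonical_tableau \<alpha> ` young_diagram \<alpha> \<subseteq> {1..sum_list \<alpha>}"
  proof
    fix k assume "k \<in> canonical_tableau \<alpha> ` young_diagram \<alpha>"
    then obtain i j where c: "(i, j) \<in> young_diagram \<alpha>" "k = canonical_tableau \<alpha> (i, j)" by auto
    have "k \<le> sum_list (take (Suc i) \<alpha>)" unfolding c(2) by (rule canonical_tableau_bounds[OF c(1)])
    also have "\<dots> \<le> sum_list (take (max (Suc i) (length \<alpha>)) \<alpha>)" by (rule sum_list_take_mono) simp
    also have "\<dots> = sum_list \<alpha>" by simp
    finally show "k \<in> {1..sum_list \<alpha>}" using c by (simp add: canonical_tableau_def)
  qed
  moreover have "card (canonical_tableau \<alpha> ` young_diagram \<alpha>) = card {1..sum_list \<alpha>}"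
    using card_image[OF inj] shape_size_part[of \<alpha>] by (simp add: shape_size_def young_diagram_eq)
  ultimately show ?thesis by (simp add: bij_betw_def card_subset_eq)
qed

lemma bij_betw_row_col:
  assumes "is_partition \<alpha>"
  shows "bij_betw (\<lambda>k. (row_of \<alpha> k, col_of \<alpha> k)) {1..sum_list \<alpha>} (young_diagram \<alpha>)"
  using bij_betw_inv_into[OF bij_betw_canonical_tableau[OF assms]] by (simp add: row_of_def col_of_def)

lemma young_filling_canonical:
  assumes "is_partition \<alpha>"
  shows "young_filling {1..sum_list \<alpha>} (part \<alpha>) (row_of \<alpha>) (col_of \<alpha>)"
  using bij_betw_row_col[OF assms] part_in_shapes[OF assms] by (simp add: young_filling_def young_diagram_eq)

lemma image_mset_row_of:
  assumes "is_partition \<alpha>"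
  shows "image_mset (row_of \<alpha>) (mset_set {1..sum_list \<alpha>}) = row_content \<alpha>"
proof -
  have "image_mset (\<lambda>k. (row_of \<alpha> k, col_of \<alpha> k)) (mset_set {1..sum_list \<alpha>}) = mset_set (young_diagram \<alpha>)"
    using bij_betw_row_col[OF assms] by (simp add: bij_betw_def image_mset_mset_set)
  then have "row_content \<alpha> = image_mset fst (image_mset (\<lambda>k. (row_of \<alpha> k, col_of \<alpha> k)) (mset_set {1..sum_list \<alpha>}))"
    by (simp add: row_content_def)
  then show ?thesis by (simp add: multiset.map_comp comp_def)
qed

text \<open>Reconciles the setwise description of the row and column groups with
  \<open>stab\<close>. An injective map sending a finite fibre into itself is onto it.\<close>

lemma preserves_fibres_iff:
  assumes "finite S" "g permutes S"
  shows "(\<forall>i. g ` {k \<in> S. r k = i} = {k \<in> S. r k = i}) \<longleftrightarrow> g \<in> stab S r"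
proof
  assume L: "\<forall>i. g ` {k \<in> S. r k = i} = {k \<in> S. r k = i}"
  have "r (g k) = r k" if "k \<in> S" for k
  proof -
    have "g k \<in> g ` {l \<in> S. r l = r k}" using that by blast
    then show ?thesis using L by blast
  qed
  then show "g \<in> stab S r" using assms(2) by (simp add: stab_def)
next
  assume "g \<in> stab S r"
  then have "g ` {k \<in> S. r k = i} \<subseteq> {k \<in> S. r k = i}" for i
    using permutes_in_image[OF assms(2)] by (auto simp: stab_def)
  then show "\<forall>i. g ` {k \<in> S. r k = i} = {k \<in> S. r k = i}"
    using assms(1) permutes_inj_on[OF assms(2)] by (intro allI endo_inj_surj) auto
qed

lemma canonical_tableau_fibre:
  assumes "is_partition \<alpha>"
  shows "row_entries \<alpha> i = {k \<in> {1..sum_list \<alpha>}. row_of \<alpha> k = i}"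
    and "col_entries \<alpha> j = {k \<in> {1..sum_list \<alpha>}. col_of \<alpha> k = j}"
proof -
  note bij = bij_betw_canonical_tableau[OF assms]
  have 1: "row_of \<alpha> (canonical_tableau \<alpha> c) = fst c" "col_of \<alpha> (canonical_tableau \<alpha> c) = snd c"
    "canonical_tableau \<alpha> c \<in> {1..sum_list \<alpha>}" if "c \<in> young_diagram \<alpha>" for c
    using bij_betw_inv_into_left[OF bij that] bij_betw_apply[OF bij that] by (simp_all add: row_of_def col_of_def)
  have 2: "canonical_tableau \<alpha> (row_of \<alpha> k, col_of \<alpha> k) = k" "(row_of \<alpha> k, col_of \<alpha> k) \<in> young_diagram \<alpha>"
    if "k \<in> {1..sum_list \<alpha>}" for k
    using bij_betw_inv_into_right[OF bij that] bij_betw_apply[OF bij_betw_row_col[OF assms] that]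
    by (simp_all add: row_of_def col_of_def)
  show "row_entries \<alpha> i = {k \<in> {1..sum_list \<alpha>}. row_of \<alpha> k = i}"
  proof (intro equalityI subsetI)
    fix k assume "k \<in> row_entries \<alpha> i"
    then obtain j where "(i, j) \<in> young_diagram \<alpha>" "k = canonical_tableau \<alpha> (i, j)" unfolding row_entries_def by blast
    then show "k \<in> {k \<in> {1..sum_list \<alpha>}. row_of \<alpha> k = i}" using 1[of "(i, j)"] by simp
  next
    fix k assume "k \<in> {k \<in> {1..sum_list \<alpha>}. row_of \<alpha> k = i}"
    then have "(i, col_of \<alpha> k) \<in> young_diagram \<alpha>" "k = canonical_tableau \<alpha> (i, col_of \<alpha> k)" using 2[of k] by auto
    then show "k \<in> row_entries \<alpha> i" unfolding row_entries_def by blast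
  qed
  show "col_entries \<alpha> j = {k \<in> {1..sum_list \<alpha>}. col_of \<alpha> k = j}"
  proof (intro equalityI subsetI)
    fix k assume "k \<in> col_entries \<alpha> j"
    then obtain i where "(i, j) \<in> young_diagram \<alpha>" "k = canonical_tableau \<alpha> (i, j)" unfolding col_entries_def by blast
    then show "k \<in> {k \<in> {1..sum_list \<alpha>}. col_of \<alpha> k = j}" using 1[of "(i, j)"] by simp
  next
    fix k assume "k \<in> {k \<in> {1..sum_list \<alpha>}. col_of \<alpha> k = j}"
    then have "(row_of \<alpha> k, j) \<in> young_diagram \<alpha>" "k = canonical_tableau \<alpha> (row_of \<alpha> k, j)" using 2[of k] by auto
    then show "k \<in> col_entries \<alpha> j" unfolding col_entries_def by blast
  qed
qed

lemma row_group_eq: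
  assumes "is_partition \<alpha>"
  shows "row_group \<alpha> = stab {1..sum_list \<alpha>} (row_of \<alpha>)"
proof -
  have "g \<in> row_group \<alpha> \<longleftrightarrow> g \<in> stab {1..sum_list \<alpha>} (row_of \<alpha>)" for g
    unfolding row_group_def mem_Collect_eq canonical_tableau_fibre[OF assms] sym_group_carrier
    using preserves_fibres_iff[OF finite_atLeastAtMost, of g 1 "sum_list \<alpha>" "row_of \<alpha>"]
      stab_permutes[of g "{1..sum_list \<alpha>}" "row_of \<alpha>"] by blast
  then show ?thesis by blast
qed

lemma col_group_eq:
  assumes "is_partition \<alpha>"
  shows "col_group \<alpha> = stab {1..sum_list \<alpha>} (col_of \<alpha>)"
proof -
  have "g \<in> col_group \<alpha> \<longleftrightarrow> g \<in> stab {1..sum_list \<alpha>} (col_of \<alpha>)" for g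
    unfolding col_group_def mem_Collect_eq canonical_tableau_fibre[OF assms] sym_group_carrier
    using preserves_fibres_iff[OF finite_atLeastAtMost, of g 1 "sum_list \<alpha>" "col_of \<alpha>"]
      stab_permutes[of g "{1..sum_list \<alpha>}" "col_of \<alpha>"] by blast
  then show ?thesis by blast
qed

lemma young_symmetrizer_eq:
  assumes "is_partition \<alpha>" "x permutes {1..sum_list \<alpha>}"
  shows "young_symmetrizer \<alpha> x = ysym {1..sum_list \<alpha>} (row_of \<alpha>) (col_of \<alpha>) x"
proof -
  have "row_symmetrizer \<alpha> = (row_sum {1..sum_list \<alpha>} (row_of \<alpha>) :: _ \<Rightarrow> 'a)"
    "col_antisymmetrizer \<alpha> = (col_sum {1..sum_list \<alpha>} (col_of \<alpha>) :: _ \<Rightarrow> 'a)"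
    using assms(1) by (simp_all add: fun_eq_iff row_symmetrizer_def col_antisymmetrizer_def
        row_sum_def col_sum_def row_group_eq col_group_eq)
  then show ?thesis
    using assms(2) by (simp add: young_symmetrizer_def ysym_def ga_mult_eq_conv)
qed

text \<open>Right multiplication by \<open>c / k\<close> is the identity on the left ideal generated
  by \<open>c\<close>, which makes it a projection onto the Specht module and brings
  \<open>trace_on_projection\<close> into play.\<close>

lemma irrep_character_eq:
  assumes \<alpha>: "is_partition \<alpha>" and d: "d = sum_list \<alpha>" and \<sigma>: "\<sigma> permutes {1..d}"
  shows "irrep_character \<alpha> \<sigma> = (ychar {1..d} (row_of \<alpha>) (col_of \<alpha>) \<sigma> :: 'a::field_char_0)"
proof -
  let ?S = "{1..d}"
  let ?G = "{p. p permutes ?S}"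
  let ?c = "young_symmetrizer \<alpha> :: _ \<Rightarrow> 'a"
  let ?k = "hook_scalar ?S (row_of \<alpha>) (col_of \<alpha>) :: 'a"
  let ?m = "ga_mult d :: _ \<Rightarrow> (_ \<Rightarrow> 'a) \<Rightarrow> _"
  have F: "young_filling ?S (part \<alpha>) (row_of \<alpha>) (col_of \<alpha>)"
    unfolding d by (rule young_filling_canonical[OF \<alpha>])
  have k: "?k \<noteq> 0" by (rule hook_scalar_nonzero[OF F])
  have finG: "finite ?G" by (rule finite_permutations) simp
  have c: "?c x = ysym ?S (row_of \<alpha>) (col_of \<alpha>) x" if "x permutes ?S" for x
    using young_symmetrizer_eq[OF \<alpha>] that d by simp
  have W: "irrep \<alpha> = {?m x ?c | x. x \<in> group_algebra d}" by (simp add: irrep_def d)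
  have WI: "?m x ?c \<in> irrep \<alpha>" if "x \<in> group_algebra d" for x
    unfolding W using that by blast
  have m_apply: "?m f g x = (\<Sum>y\<in>?G. f y * g (pinv y \<circ> x))" if "x permutes ?S" for f g x
    using that by (simp add: ga_mult_eq_conv conv_def)
  have m_zero: "?m f g x = 0" if "\<not> x permutes ?S" for f g x
    using that by (simp add: ga_mult_eq_conv)
  have m_ga: "?m f g \<in> group_algebra d" for f g
    by (simp add: group_algebra_def sym_group_carrier m_zero)
  have m_lin: "?m f (\<Sum>b\<in>B. fscale (t b) (h b)) = (\<Sum>b\<in>B. fscale (t b) (?m f (h b)))" for f t h and B :: "(_ \<Rightarrow> 'a) set"
  proof
    fix x show "?m f (\<Sum>b\<in>B. fscale (t b) (h b)) x = (\<Sum>b\<in>B. fscale (t b) (?m f (h b))) x"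
    proof (cases "x permutes ?S")
      case True
      have "?m f (\<Sum>b\<in>B. fscale (t b) (h b)) x = (\<Sum>y\<in>?G. \<Sum>b\<in>B. t b * (f y * h b (pinv y \<circ> x)))"
        by (simp add: m_apply[OF True] sum_fun_apply fscale_def sum_distrib_left mult_ac)
      also have "\<dots> = (\<Sum>b\<in>B. \<Sum>y\<in>?G. t b * (f y * h b (pinv y \<circ> x)))" by (rule sum.swap)
      finally show ?thesis
        by (simp add: m_apply[OF True] sum_fun_apply fscale_def sum_distrib_left)
    qed (simp add: m_zero sum_fun_apply fscale_def)
  qed
  have m_of: "?m (ga_of y) g x = g (pinv y \<circ> x)" if "x permutes ?S" "y permutes ?S" for y g x
  proof -
    have "?m (ga_of y) g x = (\<Sum>z\<in>?G. if z = y then g (pinv y \<circ> x) else 0)"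
      unfolding m_apply[OF that(1)] by (rule sum.cong) (auto simp: ga_of_def)
    then show ?thesis using finG that(2) by simp
  qed
  have assoc: "?m (?m f g) h = ?m f (?m g h)" for f g h
  proof
    fix x show "?m (?m f g) h x = ?m f (?m g h) x"
    proof (cases "x permutes ?S")
      case True
      have "?m (?m f g) h x = conv ?S (conv ?S f g) h x"
        unfolding m_apply[OF True] unfolding conv_def[of _ _ h]
        by (rule sum.cong) (auto simp: ga_mult_eq_conv)
      also have "\<dots> = conv ?S f (conv ?S g h) x" by (rule conv_assoc[OF True])
      also have "\<dots> = ?m f (?m g h) x"
        unfolding m_apply[OF True] unfolding conv_def[of _ f]
        by (rule sum.cong) (use True in \<open>auto simp: ga_mult_eq_conv permutes_compose permutes_inv\<close>)
      finally show ?thesis .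
    qed (simp add: m_zero)
  qed
  have cc: "?m ?c ?c = fscale ?k ?c"
  proof
    fix x show "?m ?c ?c x = fscale ?k ?c x"
    proof (cases "x permutes ?S")
      case True
      have "?m ?c ?c x = conv ?S (ysym ?S (row_of \<alpha>) (col_of \<alpha>)) (ysym ?S (row_of \<alpha>) (col_of \<alpha>)) x"
        unfolding m_apply[OF True] conv_def
        by (rule sum.cong) (use True in \<open>auto simp: c permutes_compose permutes_inv\<close>)
      then show ?thesis using conv_ysym_ysym[OF F True] by (simp add: fscale_def c[OF True])
    next
      case False
      then show ?thesis
        using m_zero[OF False] by (simp add: fscale_def young_symmetrizer_def d ga_mult_eq_conv)
    qed
  qed
  define P where "P g = fscale (1 / ?k) (?m (ga_of g) ?c)" for g
  have Pg: "P g x = ?c (pinv g \<circ> x) / ?k" if "g permutes ?S" "x permutes ?S" for g x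
    using that by (simp add: P_def fscale_def m_of)
  have scale_left: "?m (fscale t f) g = fscale t (?m f g)" for t f g
    by (rule ext) (simp add: fscale_def ga_mult_eq_conv conv_def sum_distrib_left mult.assoc)
  have add_left: "?m (f + f') g = ?m f g + ?m f' g" for f f' g
    by (rule ext) (simp add: ga_mult_eq_conv conv_def sum.distrib distrib_right)
  have "irrep_character \<alpha> \<sigma> = trace_on (irrep \<alpha>) (?m (ga_of \<sigma>))"
    by (simp add: irrep_character_def d)
  also have "\<dots> = (\<Sum>g\<in>?G. ?m (ga_of \<sigma>) (P g) g)"
  proof (rule trace_on_projection[OF finG])
    show "fmod.subspace (irrep \<alpha> :: (_ \<Rightarrow> 'a) set)"
    proof (rule fmod.subspaceI)
      have "?m 0 ?c = 0" by (rule ext) (simp add: ga_mult_eq_conv conv_def)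
      moreover have "?m 0 ?c \<in> irrep \<alpha>" by (rule WI) (simp add: group_algebra_def)
      ultimately show "(0 :: _ \<Rightarrow> 'a) \<in> irrep \<alpha>" by simp
      fix v w :: "_ \<Rightarrow> 'a" and t :: 'a
      assume v: "v \<in> irrep \<alpha>"
      then obtain x where x: "v = ?m x ?c" "x \<in> group_algebra d" unfolding W by blast
      have "fscale t x \<in> group_algebra d" using x(2) by (simp add: group_algebra_def fscale_def)
      then show "fscale t v \<in> irrep \<alpha>" unfolding x(1) scale_left[symmetric] by (rule WI)
      assume "w \<in> irrep \<alpha>"
      then obtain y where y: "w = ?m y ?c" "y \<in> group_algebra d" unfolding W by blast
      have "x + y \<in> group_algebra d" using x(2) y(2) by (simp add: group_algebra_def)
      then show "v + w \<in> irrep \<alpha>" unfolding x(1) y(1) add_left[symmetric] by (rule WI)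
    qed
    show "P g \<in> irrep \<alpha>" if "g \<in> ?G" for g
    proof -
      have "fscale (1 / ?k) (ga_of g) \<in> group_algebra d"
        using that by (auto simp: group_algebra_def fscale_def ga_of_def sym_group_carrier)
      moreover have "P g = ?m (fscale (1 / ?k) (ga_of g)) ?c" by (simp add: P_def scale_left)
      ultimately show ?thesis using WI by metis
    qed
    show "w = (\<Sum>g\<in>?G. fscale (w g) (P g))" if "w \<in> irrep \<alpha>" for w
    proof -
      obtain x where x: "w = ?m x ?c" using \<open>w \<in> _\<close> unfolding W by blast
      \<comment> \<open>An element \<open>w = x c\<close> of the ideal satisfies
        \<open>w c = x c c = k w\<close>.\<close>
      have "?m w ?c = fscale ?k w"
        unfolding x assoc cc using m_lin[of x "\<lambda>_. ?k" "\<lambda>b. b" "{?c}"] by simp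
      then have wc: "w y = ?m w ?c y / ?k" for y using k by (simp add: fscale_def fun_eq_iff)
      show ?thesis
      proof
        fix y show "w y = (\<Sum>g\<in>?G. fscale (w g) (P g)) y"
        proof (cases "y permutes ?S")
          case True
          have "w y = (\<Sum>g\<in>?G. w g * ?c (pinv g \<circ> y)) / ?k" unfolding wc[of y] by (simp add: m_apply[OF True])
          also have "\<dots> = (\<Sum>g\<in>?G. w g * P g y)"
            unfolding sum_divide_distrib by (rule sum.cong) (use True in \<open>auto simp: Pg\<close>)
          finally show ?thesis by (simp add: sum_fun_apply fscale_def)
        next
          case False
          then show ?thesis by (simp add: x m_zero sum_fun_apply fscale_def P_def)
        qed
      qed
    qed
    show "?m (ga_of \<sigma>) w \<in> irrep \<alpha>" if "w \<in> irrep \<alpha>" for w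
    proof -
      obtain x where x: "w = ?m x ?c" using \<open>w \<in> irrep \<alpha>\<close> unfolding W by blast
      have "?m (ga_of \<sigma>) w = ?m (?m (ga_of \<sigma>) x) ?c" unfolding x assoc ..
      then show ?thesis using WI[OF m_ga] by simp
    qed
  qed (rule m_lin)
  also have "\<dots> = (\<Sum>g\<in>?G. ysym ?S (row_of \<alpha>) (col_of \<alpha>) (pinv g \<circ> (pinv \<sigma> \<circ> g)) / ?k)"
    by (rule sum.cong) (use \<sigma> in \<open>auto simp: m_of Pg c permutes_compose permutes_inv\<close>)
  also have "\<dots> = class_sum ?S (ysym ?S (row_of \<alpha>) (col_of \<alpha>)) (pinv \<sigma>) / ?k"
    by (simp add: class_sum_def sum_divide_distrib)
  \<comment> \<open>The coefficient of \<open>\<sigma> g c\<close> at \<open>g\<close> involves the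
    inverse of \<sigma>; class sums of Young symmetrizers are invariant under inversion.\<close>
  also have "\<dots> = ychar ?S (row_of \<alpha>) (col_of \<alpha>) \<sigma>"
    by (simp only: ychar_def ysym_pinv_symmetric[OF \<sigma> finite_atLeastAtMost])
  finally show ?thesis .
qed

section \<open>Frobenius' formula\<close>

text \<open>Two unitriangular factorisations of one Gram matrix coincide. The remainder of \<open>\<psi> \<mu>\<close> after
  subtracting its expansion has norm zero, so that completeness of the \<open>X \<kappa>\<close> is not needed.\<close>

lemma gram_expansion:
  fixes K m :: "'i \<Rightarrow> 'i \<Rightarrow> 'a::linordered_field" and rk :: "'i \<Rightarrow> nat"
  assumes I: "finite I" and G: "finite G" and N: "N > 0"
    and XX: "\<And>\<kappa> \<nu>. \<kappa> \<in> I \<Longrightarrow> \<nu> \<in> I \<Longrightarrow> (\<Sum>g\<in>G. X \<kappa> g * X \<nu> g) = (if \<kappa> = \<nu> then N else 0)"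
    and PX: "\<And>\<kappa> \<mu>. \<kappa> \<in> I \<Longrightarrow> \<mu> \<in> I \<Longrightarrow> (\<Sum>g\<in>G. \<psi> \<mu> g * X \<kappa> g) = N * m \<kappa> \<mu>"
    and PP: "\<And>\<mu> \<nu>. \<mu> \<in> I \<Longrightarrow> \<nu> \<in> I \<Longrightarrow> (\<Sum>g\<in>G. \<psi> \<mu> g * \<psi> \<nu> g) = N * (\<Sum>\<kappa>\<in>I. K \<kappa> \<mu> * K \<kappa> \<nu>)"
    and K1: "\<And>\<kappa>. \<kappa> \<in> I \<Longrightarrow> K \<kappa> \<kappa> = 1" and m1: "\<And>\<kappa>. \<kappa> \<in> I \<Longrightarrow> m \<kappa> \<kappa> = 1"
    and Kt: "\<And>\<kappa> \<mu>. \<kappa> \<in> I \<Longrightarrow> \<mu> \<in> I \<Longrightarrow> K \<kappa> \<mu> \<noteq> 0 \<Longrightarrow> \<kappa> = \<mu> \<or> rk \<mu> < rk \<kappa>"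
    and mt: "\<And>\<kappa> \<mu>. \<kappa> \<in> I \<Longrightarrow> \<mu> \<in> I \<Longrightarrow> m \<kappa> \<mu> \<noteq> 0 \<Longrightarrow> \<kappa> = \<mu> \<or> rk \<mu> < rk \<kappa>"
    and "\<mu> \<in> I" "g \<in> G"
  shows "\<psi> \<mu> g = (\<Sum>\<kappa>\<in>I. K \<kappa> \<mu> * X \<kappa> g)"
proof -
  define D where "D = Max (rk ` I)"
  have D: "rk i \<le> D" if "i \<in> I" for i unfolding D_def using I that by simp
  \<comment> \<open>Downward induction on the rank: pairing \<psi> \<mu> with the already expanded
    \<psi> \<kappa> of greater rank determines the coefficients of \<psi> \<mu>.\<close>
  have "\<mu> \<in> I \<longrightarrow> (\<forall>g\<in>G. \<psi> \<mu> g = (\<Sum>\<kappa>\<in>I. K \<kappa> \<mu> * X \<kappa> g))" for \<mu>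
  proof (induction "D - rk \<mu>" arbitrary: \<mu> rule: less_induct)
    case less
    show ?case
    proof
      assume \<mu>: "\<mu> \<in> I"
      have IH: "\<psi> \<nu> g = (\<Sum>\<kappa>\<in>I. K \<kappa> \<nu> * X \<kappa> g)" if "\<nu> \<in> I" "rk \<mu> < rk \<nu>" "g \<in> G" for \<nu> g
        using less[of \<nu>] that D[OF that(1)] by auto
      \<comment> \<open>Also downward: in the pairing with \<psi> \<kappa>, the terms of rank above
        \<kappa> agree by induction, and the term at \<kappa> has coefficient 1. If \<kappa> does
        not exceed \<mu> in rank, triangularity alone decides both entries.\<close>
      have "\<kappa> \<in> I \<longrightarrow> m \<kappa> \<mu> = K \<kappa> \<mu>" for \<kappa>
      proof (induction "D - rk \<kappa>" arbitrary: \<kappa> rule: less_induct)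
        case (less \<kappa>)
        show ?case
        proof
          assume \<kappa>: "\<kappa> \<in> I"
          show "m \<kappa> \<mu> = K \<kappa> \<mu>"
          proof (cases "rk \<mu> < rk \<kappa>")
            case False
            then show ?thesis using Kt[OF \<kappa> \<mu>] mt[OF \<kappa> \<mu>] K1[OF \<kappa>] m1[OF \<kappa>] by metis
          next
            case True
            have "N * (\<Sum>\<eta>\<in>I. K \<eta> \<mu> * K \<eta> \<kappa>) = (\<Sum>g\<in>G. \<psi> \<mu> g * \<psi> \<kappa> g)" using PP[OF \<mu> \<kappa>] by simp
            also have "\<dots> = (\<Sum>g\<in>G. \<Sum>\<eta>\<in>I. K \<eta> \<kappa> * (\<psi> \<mu> g * X \<eta> g))"
              by (rule sum.cong) (simp_all add: IH[OF \<kappa> True] sum_distrib_left mult_ac)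
            also have "\<dots> = (\<Sum>\<eta>\<in>I. K \<eta> \<kappa> * (\<Sum>g\<in>G. \<psi> \<mu> g * X \<eta> g))"
              by (subst sum.swap) (simp add: sum_distrib_left)
            also have "\<dots> = (\<Sum>\<eta>\<in>I. K \<eta> \<kappa> * (N * m \<eta> \<mu>))"
              by (rule sum.cong) (simp_all add: PX[OF _ \<mu>])
            also have "\<dots> = N * (\<Sum>\<eta>\<in>I. m \<eta> \<mu> * K \<eta> \<kappa>)"
              by (simp add: sum_distrib_left mult_ac)
            finally have "(\<Sum>\<eta>\<in>I. (K \<eta> \<mu> - m \<eta> \<mu>) * K \<eta> \<kappa>) = 0"
              using N by (simp add: left_diff_distrib sum_subtractf)
            moreover have "(\<Sum>\<eta>\<in>I. (K \<eta> \<mu> - m \<eta> \<mu>) * K \<eta> \<kappa>) = (\<Sum>\<eta>\<in>I. if \<eta> = \<kappa> then K \<kappa> \<mu> - m \<kappa> \<mu> else 0)"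
            proof (rule sum.cong[OF refl])
              fix \<eta> assume \<eta>: "\<eta> \<in> I"
              have "m \<eta> \<mu> = K \<eta> \<mu>" if "K \<eta> \<kappa> \<noteq> 0" "\<eta> \<noteq> \<kappa>"
                using less[of \<eta>] Kt[OF \<eta> \<kappa> that(1)] that(2) \<eta> D[OF \<eta>] by auto
              then show "(K \<eta> \<mu> - m \<eta> \<mu>) * K \<eta> \<kappa> = (if \<eta> = \<kappa> then K \<kappa> \<mu> - m \<kappa> \<mu> else 0)"
                using K1[OF \<kappa>] by (cases "K \<eta> \<kappa> = 0") auto
            qed
            ultimately show ?thesis using I \<kappa> by simp
          qed
        qed
      qed
      then have mK: "m \<kappa> \<mu> = K \<kappa> \<mu>" if "\<kappa> \<in> I" for \<kappa> using that by blast
      \<comment> \<open>\<open>E\<close> is the candidate expansion. Its norm, its pairing with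
        \<psi> \<mu> and the norm of \<psi> \<mu> all equal \<open>N * Q\<close>, so the squared
        difference sums to 0.\<close>
      define E where "E g = (\<Sum>\<kappa>\<in>I. K \<kappa> \<mu> * X \<kappa> g)" for g
      define Q where "Q = (\<Sum>\<kappa>\<in>I. K \<kappa> \<mu> * K \<kappa> \<mu>)"
      have pe: "(\<Sum>g\<in>G. \<psi> \<mu> g * E g) = N * Q"
      proof -
        have "(\<Sum>g\<in>G. \<psi> \<mu> g * E g) = (\<Sum>g\<in>G. \<Sum>\<kappa>\<in>I. K \<kappa> \<mu> * (\<psi> \<mu> g * X \<kappa> g))"
          by (simp add: E_def sum_distrib_left mult_ac)
        also have "\<dots> = (\<Sum>\<kappa>\<in>I. K \<kappa> \<mu> * (\<Sum>g\<in>G. \<psi> \<mu> g * X \<kappa> g))"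
          by (subst sum.swap) (simp add: sum_distrib_left)
        also have "\<dots> = (\<Sum>\<kappa>\<in>I. K \<kappa> \<mu> * (N * K \<kappa> \<mu>))"
          by (rule sum.cong) (simp_all add: PX[OF _ \<mu>] mK)
        finally show ?thesis by (simp add: Q_def sum_distrib_left mult_ac)
      qed
      have ee: "(\<Sum>g\<in>G. E g * E g) = N * Q"
      proof -
        have "(\<Sum>g\<in>G. E g * E g) = (\<Sum>g\<in>G. \<Sum>\<kappa>\<in>I. \<Sum>\<nu>\<in>I. (K \<kappa> \<mu> * K \<nu> \<mu>) * (X \<kappa> g * X \<nu> g))"
          by (simp add: E_def sum_product mult_ac)
        also have "\<dots> = (\<Sum>\<kappa>\<in>I. \<Sum>\<nu>\<in>I. \<Sum>g\<in>G. (K \<kappa> \<mu> * K \<nu> \<mu>) * (X \<kappa> g * X \<nu> g))"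
          by (rule sum_swap3[symmetric])
        also have "\<dots> = (\<Sum>\<kappa>\<in>I. \<Sum>\<nu>\<in>I. (K \<kappa> \<mu> * K \<nu> \<mu>) * (if \<kappa> = \<nu> then N else 0))"
          by (intro sum.cong refl) (simp add: sum_distrib_left[symmetric] XX)
        also have "\<dots> = (\<Sum>\<kappa>\<in>I. \<Sum>\<nu>\<in>I. if \<kappa> = \<nu> then K \<kappa> \<mu> * K \<kappa> \<mu> * N else 0)"
          by (intro sum.cong refl) auto
        also have "\<dots> = N * Q" using I by (simp add: Q_def sum_distrib_left mult_ac)
        finally show ?thesis .
      qed
      have "(\<Sum>g\<in>G. (\<psi> \<mu> g - E g)^2) = (\<Sum>g\<in>G. \<psi> \<mu> g * \<psi> \<mu> g - 2 * (\<psi> \<mu> g * E g) + E g * E g)"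
        by (rule sum.cong) (simp_all add: power2_eq_square algebra_simps)
      also have "\<dots> = (\<Sum>g\<in>G. \<psi> \<mu> g * \<psi> \<mu> g) - 2 * (\<Sum>g\<in>G. \<psi> \<mu> g * E g) + (\<Sum>g\<in>G. E g * E g)"
        by (simp add: sum.distrib sum_subtractf sum_distrib_left)
      also have "\<dots> = 0" using PP[OF \<mu> \<mu>] pe ee by (simp add: Q_def)
      finally have "\<forall>g\<in>G. (\<psi> \<mu> g - E g)^2 = 0"
        using sum_nonneg_eq_0_iff[OF G, of "\<lambda>g. (\<psi> \<mu> g - E g)^2"] by simp
      then show "\<forall>g\<in>G. \<psi> \<mu> g = (\<Sum>\<kappa>\<in>I. K \<kappa> \<mu> * X \<kappa> g)" by (simp add: E_def)
    qed
  qed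
  then show ?thesis using assms(11,12) by blast
qed

section \<open>Young's rule\<close>

lemma card_rows_of_below:
  assumes "\<alpha> \<in> partitions_of d"
  shows "card {k \<in> {1..d}. row_of \<alpha> k < r} = partial_sum \<alpha> r"
proof -
  have \<alpha>: "is_partition \<alpha>" "d = sum_list \<alpha>" using assms by (auto simp: partitions_of_def)
  have "partial_sum \<alpha> r = size (filter_mset (\<lambda>i. i < r) (image_mset (row_of \<alpha>) (mset_set {1..d})))"
    using size_row_content_below[OF \<alpha>(1)] image_mset_row_of[OF \<alpha>(1)] \<alpha>(2) by simp
  then show ?thesis by (simp add: size_filter_image_mset_set del: filter_mset_image_mset)
qed

lemma not_dominates_rows:
  assumes "\<alpha> \<in> partitions_of d" "\<beta> \<in> partitions_of d" "\<not> dominates \<alpha> \<beta>"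
  obtains r where "card {k \<in> {1..d}. row_of \<alpha> k < r} < card {k \<in> {1..d}. row_of \<beta> k < r}"
proof -
  obtain r where "partial_sum \<alpha> r < partial_sum \<beta> r" using assms(3) by (auto simp: dominates_def not_le)
  then show thesis
    by (intro that[of r]) (simp only: card_rows_of_below[OF assms(1)] card_rows_of_below[OF assms(2)])
qed

text \<open>Carried out over the rationals, where a vanishing sum of squares forces its terms to
  vanish.\<close>

lemma young_rule_rat:
  assumes \<mu>: "\<mu> \<in> partitions_of d" and \<sigma>: "\<sigma> permutes {1..d}"
  shows "of_nat (fixed_colourings {1..d} (row_content \<mu>) \<sigma>) =
    (\<Sum>\<alpha>\<in>partitions_of d. of_int (schur \<alpha> (row_content \<mu>)) * (ychar {1..d} (row_of \<alpha>) (col_of \<alpha>) \<sigma> :: rat))"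
proof -
  let ?S = "{1..d}"
  let ?I = "partitions_of d"
  let ?G = "{\<sigma>. \<sigma> permutes ?S}"
  let ?X = "\<lambda>\<alpha>. ychar ?S (row_of \<alpha>) (col_of \<alpha>) :: _ \<Rightarrow> rat"
  let ?k = "\<lambda>\<alpha>. hook_scalar ?S (row_of \<alpha>) (col_of \<alpha>) :: rat"
  let ?C = "\<lambda>\<alpha>. class_sum ?S (ysym ?S (row_of \<alpha>) (col_of \<alpha>)) :: _ \<Rightarrow> rat"
  let ?R = "\<lambda>\<alpha>. class_sum ?S (row_sum ?S (row_of \<alpha>)) :: _ \<Rightarrow> rat"
  let ?s = "\<lambda>\<alpha>. of_nat (card (stab ?S (row_of \<alpha>))) :: rat"
  let ?K = "\<lambda>\<alpha> \<mu>. of_int (schur \<alpha> (row_content \<mu>)) :: rat"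
  let ?psi = "\<lambda>\<mu> \<sigma>. of_nat (fixed_colourings ?S (row_content \<mu>) \<sigma>) :: rat"
  let ?N = "of_nat (fact d) :: rat"
  \<comment> \<open>The normalized inner products; \<open>gram_expansion\<close> will identify them
    with the Kostka numbers.\<close>
  define m where "m \<alpha> \<mu> = (\<Sum>\<sigma>\<in>?G. ?psi \<mu> \<sigma> * ?X \<alpha> \<sigma>) / ?N" for \<alpha> \<mu>
  have F: "young_filling ?S (part \<alpha>) (row_of \<alpha>) (col_of \<alpha>)" if "\<alpha> \<in> ?I" for \<alpha>
    using that young_filling_canonical[of \<alpha>] by (auto simp: partitions_of_def)
  have k: "?k \<alpha> \<noteq> 0" if "\<alpha> \<in> ?I" for \<alpha> by (rule hook_scalar_nonzero[OF F[OF that]])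
  have fin: "finite ?S" by simp
  have s: "?s \<alpha> \<noteq> 0" for \<alpha> using finite_stab[OF fin, of "row_of \<alpha>"] stab_id[of ?S "row_of \<alpha>"] by auto
  have psi: "?psi \<alpha> \<sigma> = ?R \<alpha> \<sigma> / ?s \<alpha>" if "\<alpha> \<in> ?I" "\<sigma> \<in> ?G" for \<alpha> \<sigma>
  proof -
    have "image_mset (row_of \<alpha>) (mset_set ?S) = row_content \<alpha>"
      using that image_mset_row_of[of \<alpha>] by (auto simp: partitions_of_def)
    then have "?R \<alpha> \<sigma> = ?s \<alpha> * ?psi \<alpha> \<sigma>"
      using class_sum_stab[OF fin, of \<sigma> "row_of \<alpha>"] that by (simp add: row_sum_def)
    then show ?thesis using s by simp
  qed
  have mX: "m \<alpha> \<mu> = (\<Sum>\<sigma>\<in>?G. ?R \<mu> \<sigma> * ?C \<alpha> \<sigma>) / (?N * (?s \<mu> * ?k \<alpha>))" if "\<mu> \<in> ?I" for \<alpha> \<mu>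
  proof -
    have "(\<Sum>\<sigma>\<in>?G. ?psi \<mu> \<sigma> * ?X \<alpha> \<sigma>) = (\<Sum>\<sigma>\<in>?G. ?R \<mu> \<sigma> * ?C \<alpha> \<sigma>) / (?s \<mu> * ?k \<alpha>)"
      unfolding sum_divide_distrib by (rule sum.cong) (simp_all add: psi[OF that] ychar_def del: One_nat_def)
    then show ?thesis by (simp add: m_def mult.commute)
  qed
  have dom0: "(\<Sum>\<sigma>\<in>?G. class_sum ?S u \<sigma> * ?C \<alpha> \<sigma>) = 0"
    if dm: "\<alpha> \<in> ?I" "\<beta> \<in> ?I" "\<not> dominates \<alpha> \<beta>" and u: "left_inv ?S (row_of \<beta>) u" for \<alpha> \<beta> u
  proof -
    obtain r where r: "card {k \<in> ?S. row_of \<alpha> k < r} < card {k \<in> ?S. row_of \<beta> k < r}"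
      by (rule not_dominates_rows[OF dm])
    show ?thesis by (rule inner_vanish[OF F[OF dm(1)] u r])
  qed
  show ?thesis
  proof (rule gram_expansion[where N = ?N and m = m and rk = "dom_rank d" and G = ?G and \<mu> = \<mu> and g = \<sigma>
        and X = ?X and K = ?K and \<psi> = ?psi and I = ?I])
    show "finite ?I" by (rule finite_partitions_of)
    show "finite ?G" by (rule finite_permutations) simp
    show "?N > 0" by simp
    show "(\<Sum>\<sigma>\<in>?G. ?X \<kappa> \<sigma> * ?X \<nu> \<sigma>) = (if \<kappa> = \<nu> then ?N else 0)" if l: "\<kappa> \<in> ?I" "\<nu> \<in> ?I" for \<kappa> \<nu>
    proof -
      have eq: "(\<Sum>\<sigma>\<in>?G. ?X \<kappa> \<sigma> * ?X \<nu> \<sigma>) = (\<Sum>\<sigma>\<in>?G. ?C \<kappa> \<sigma> * ?C \<nu> \<sigma>) / (?k \<kappa> * ?k \<nu>)"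
        by (simp add: ychar_def sum_divide_distrib)
      show ?thesis
      proof (cases "\<kappa> = \<nu>")
        case True
        then show ?thesis using inner_ysym_same[OF F[OF l(2)], where 'a = rat] k[OF l(2)]
          unfolding eq by (simp add: power2_eq_square)
      next
        case False
        \<comment> \<open>Dominance fails in at least one direction, and the symmetry of the inner
          product makes either failure enough for orthogonality.\<close>
        have "\<not> dominates \<kappa> \<nu> \<or> \<not> dominates \<nu> \<kappa>"
          using dominates_antisym[of \<kappa> \<nu>] l False by (auto simp: partitions_of_def)
        then have "(\<Sum>\<sigma>\<in>?G. ?C \<kappa> \<sigma> * ?C \<nu> \<sigma>) = 0"
        proof
          assume "\<not> dominates \<kappa> \<nu>"
          from dom0[OF l this left_inv_ysym]
          have "(\<Sum>\<sigma>\<in>?G. ?C \<nu> \<sigma> * ?C \<kappa> \<sigma>) = 0" .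
          then show ?thesis by (subst mult.commute)
        next
          assume "\<not> dominates \<nu> \<kappa>"
          from dom0[OF l(2,1) this left_inv_ysym] show ?thesis .
        qed
        then show ?thesis using False unfolding eq by simp
      qed
    qed
    show "(\<Sum>\<sigma>\<in>?G. ?psi \<mu> \<sigma> * ?X \<kappa> \<sigma>) = ?N * m \<kappa> \<mu>" for \<kappa> \<mu> by (simp add: m_def)
    show "(\<Sum>\<sigma>\<in>?G. ?psi \<mu> \<sigma> * ?psi \<nu> \<sigma>) = ?N * (\<Sum>\<kappa>\<in>?I. ?K \<kappa> \<mu> * ?K \<kappa> \<nu>)" if "\<mu> \<in> ?I" for \<mu> \<nu>
    proof -
      have sz: "size (row_content \<mu>) = d" using that by (simp add: size_row_content partitions_of_def)
      have "(\<Sum>\<sigma>\<in>?G. ?psi \<mu> \<sigma> * ?psi \<nu> \<sigma>) =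
          of_nat (\<Sum>\<sigma>\<in>?G. fixed_colourings ?S (row_content \<mu>) \<sigma> * fixed_colourings ?S (row_content \<nu>) \<sigma>)"
        by simp
      also have "\<dots> = ?N * of_int (int (pair_count (row_content \<mu>) (row_content \<nu>)))"
        using fixed_colourings_inner[OF fin, of "row_content \<mu>" "row_content \<nu>"] sz by simp
      also have "int (pair_count (row_content \<mu>) (row_content \<nu>)) =
          (\<Sum>\<kappa>\<in>?I. schur \<kappa> (row_content \<mu>) * schur \<kappa> (row_content \<nu>))"
        using schur_cauchy[of "row_content \<mu>" "row_content \<nu>"] sz by simp
      finally show ?thesis by simp
    qed
    show "?K \<kappa> \<kappa> = 1" if "\<kappa> \<in> ?I" for \<kappa>
      using that schur_row_content_self[of \<kappa>] by (simp add: partitions_of_def)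
    show "m \<kappa> \<kappa> = 1" if "\<kappa> \<in> ?I" for \<kappa>
      using inner_row_sum_ysym_same[OF F[OF that], where 'a = rat] mX[OF that, of \<kappa>] s[of \<kappa>] k[OF that] by simp
    show "\<kappa> = \<mu> \<or> dom_rank d \<mu> < dom_rank d \<kappa>" if "\<kappa> \<in> ?I" "\<mu> \<in> ?I" "?K \<kappa> \<mu> \<noteq> 0" for \<kappa> \<mu>
      using schur_triangular[OF that(1,2)] that(3) by auto
    show "\<kappa> = \<mu> \<or> dom_rank d \<mu> < dom_rank d \<kappa>" if l: "\<kappa> \<in> ?I" "\<mu> \<in> ?I" "m \<kappa> \<mu> \<noteq> 0" for \<kappa> \<mu>
    proof -
      have "dominates \<kappa> \<mu>"
      proof (rule ccontr)
        assume "\<not> dominates \<kappa> \<mu>"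
        then have "(\<Sum>\<sigma>\<in>?G. ?R \<mu> \<sigma> * ?C \<kappa> \<sigma>) = 0" by (rule dom0[OF l(1,2) _ left_inv_row_sum])
        then show False using l(3) mX[OF l(2), of \<kappa>] by simp
      qed
      then show ?thesis using dom_rank_less[OF l(1,2)] by blast
    qed
    show "\<mu> \<in> ?I" by (rule \<mu>)
    show "\<sigma> \<in> ?G" using \<sigma> by simp
  qed
qed

text \<open>Frobenius' formula read at one monomial. Relabelling reduces to the content of a
  partition, and rationality of the character values passes from \<open>rat\<close> to the given
  field.\<close>

theorem young_rule:
  assumes \<sigma>: "\<sigma> permutes {1..d}" and M: "size M = d"
  shows "of_nat (fixed_colourings {1..d} M \<sigma>) =
    (\<Sum>\<alpha>\<in>partitions_of d. of_int (schur \<alpha> M) * (irrep_character \<alpha> \<sigma> :: 'a::field_char_0))"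
proof -
  obtain \<mu> h where \<mu>: "\<mu> \<in> partitions_of d" and h: "inj_on h (set_mset (row_content \<mu>))" "image_mset h (row_content \<mu>) = M"
    using ex_partition_relabel[of M] M by blast
  have "of_nat (fixed_colourings {1..d} M \<sigma>) = (of_rat (of_nat (fixed_colourings {1..d} (row_content \<mu>) \<sigma>)) :: 'a)"
    using fixed_colourings_relabel[OF _ \<sigma> h(1)] h(2) by simp
  also have "\<dots> = (\<Sum>\<alpha>\<in>partitions_of d. of_int (schur \<alpha> (row_content \<mu>)) * of_rat (ychar {1..d} (row_of \<alpha>) (col_of \<alpha>) \<sigma>))"
    unfolding young_rule_rat[OF \<mu> \<sigma>] by (simp add: of_rat_sum of_rat_mult)
  also have "\<dots> = (\<Sum>\<alpha>\<in>partitions_of d. of_int (schur \<alpha> M) * irrep_character \<alpha> \<sigma>)"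
  proof (rule sum.cong[OF refl])
    fix \<alpha> assume "\<alpha> \<in> partitions_of d"
    then have \<alpha>: "is_partition \<alpha>" "d = sum_list \<alpha>" by (auto simp: partitions_of_def)
    have "schur \<alpha> M = schur \<alpha> (row_content \<mu>)"
      using schur_symmetric[OF \<alpha>(1)] h unfolding symmetric_series_def by blast
    then show "of_int (schur \<alpha> (row_content \<mu>)) * of_rat (ychar {1..d} (row_of \<alpha>) (col_of \<alpha>) \<sigma>) =
        (of_int (schur \<alpha> M) * irrep_character \<alpha> \<sigma> :: 'a)"
      using irrep_character_eq[OF \<alpha> \<sigma>, where 'a = 'a] ychar_of_rat[where 'a = 'a] by simp
  qed
  finally show ?thesis .
qed

section \<open>The eigenvector equation\<close>

text \<open>The cycle advances each element to its successor in the list, so invariance propagates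
  the value of the first element to all of them.\<close>

lemma cycle_of_list_invariant_iff:
  assumes "distinct c"
  shows "(\<forall>x\<in>set c. f (cycle_of_list c x) = f x) \<longleftrightarrow> (\<forall>x\<in>set c. \<forall>y\<in>set c. f x = f y)"
proof
  assume L: "\<forall>x\<in>set c. f (cycle_of_list c x) = f x"
  have "f (c ! i) = f (c ! 0)" if "i < length c" for i
    using that
  proof (induction i)
    case (Suc i)
    \<comment> \<open>Applying the cycle to its own list rotates the list by one place.\<close>
    have "map (cycle_of_list c) c = rotate1 c"
      using cyclic_rotation[OF assms, of 1] by simp
    then have "cycle_of_list c (c ! i) = rotate1 c ! i" using Suc.prems by (metis Suc_lessD nth_map)
    also have "\<dots> = c ! Suc i" using Suc.prems by (simp add: nth_rotate1)
    finally show ?case using L Suc by (metis Suc_lessD nth_mem)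
  qed simp
  then show "\<forall>x\<in>set c. \<forall>y\<in>set c. f x = f y" by (metis in_set_conv_nth)
next
  assume "\<forall>x\<in>set c. \<forall>y\<in>set c. f x = f y"
  then show "\<forall>x\<in>set c. f (cycle_of_list c x) = f x"
    using permutes_in_image[OF cycle_permutes[of c]] by blast
qed

text \<open>By disjointness the other cycles fix both \<open>x\<close> and its image, on whichever
  side of \<open>c\<close> they are composed.\<close>

lemma foldr_cycles_apply:
  assumes "distinct (concat cs)" "c \<in> set cs" "x \<in> set c"
  shows "foldr (\<circ>) (map cycle_of_list cs) id x = cycle_of_list c x"
  using assms
proof (induction cs)
  case (Cons c' cs)
  have outside: "foldr (\<circ>) (map cycle_of_list cs) id y = y" if "y \<notin> set (concat cs)" for y and cs :: "'a list list"
    using that by (induction cs) (auto simp: id_outside_supp)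
  have step: "foldr (\<circ>) (map cycle_of_list (c' # cs)) id x = cycle_of_list c' (foldr (\<circ>) (map cycle_of_list cs) id x)"
    by simp
  show ?case
  proof (cases "c = c'")
    case True
    then have "x \<notin> set (concat cs)" using Cons.prems by auto
    then have "foldr (\<circ>) (map cycle_of_list cs) id x = x" by (rule outside)
    then show ?thesis unfolding step True by (rule arg_cong)
  next
    case False
    then have c: "c \<in> set cs" using Cons.prems by simp
    have "x \<notin> set c'" using Cons.prems c by auto
    moreover have "cycle_of_list c x \<in> set c" using Cons.prems(3) permutes_in_image[OF cycle_permutes[of c]] by blast
    ultimately have "cycle_of_list c x \<notin> set c'" using Cons.prems c by auto
    then have "cycle_of_list c' (cycle_of_list c x) = cycle_of_list c x" by (rule id_outside_supp)
    moreover have "foldr (\<circ>) (map cycle_of_list cs) id x = cycle_of_list c x"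
      using Cons.prems by (intro Cons.IH c) auto
    ultimately show ?thesis unfolding step by (simp only:)
  qed
qed simp

text \<open>Each block contributes one free value, read at its head. An empty block would contribute
  a factor 1 instead of \<open>n\<close>, so nonemptiness matters for the exponent.\<close>

lemma card_constant_on_blocks:
  assumes "\<forall>c\<in>set cs. c \<noteq> []" "distinct (concat cs)"
  shows "card {f \<in> set (concat cs) \<rightarrow>\<^sub>E {..<n}. \<forall>c\<in>set cs. \<forall>x\<in>set c. \<forall>y\<in>set c. f x = f y} = n ^ length cs"
  using assms
proof (induction cs)
  case Nil
  then show ?case by simp
next
  case (Cons c cs)
  let ?A = "\<lambda>cs. {f \<in> set (concat cs) \<rightarrow>\<^sub>E {..<n}. \<forall>c\<in>set cs. \<forall>x\<in>set c. \<forall>y\<in>set c. f x = f y}"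
  let ?T = "set (concat cs)" and ?U = "set (concat (c # cs))"
  have disj: "set c \<inter> ?T = {}" using Cons.prems(2) by auto
  have h: "hd c \<in> set c" using Cons.prems(1) by simp
  let ?E = "\<lambda>(k, f). restrict (\<lambda>x. if x \<in> set c then k else f x) ?U"
  have "bij_betw (\<lambda>f. (f (hd c), restrict f ?T)) (?A (c # cs)) ({..<n} \<times> ?A cs)"
  proof (rule bij_betw_byWitness[where f' = ?E])
    show "\<forall>f\<in>?A (c # cs). ?E (f (hd c), restrict f ?T) = f"
    proof
      fix f assume f: "f \<in> ?A (c # cs)"
      then have "f \<in> ?U \<rightarrow>\<^sub>E {..<n}" by blast
      then have "f \<in> extensional ?U" by (simp add: PiE_def)
      moreover have const: "f x = f (hd c)" if "x \<in> set c" for x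
        using f that h unfolding list.set by blast
      ultimately show "?E (f (hd c), restrict f ?T) = f"
        unfolding prod.case
      proof (intro extensionalityI[where A = ?U])
        fix x assume x: "x \<in> ?U"
        show "restrict (\<lambda>x. if x \<in> set c then f (hd c) else restrict f ?T x) ?U x = f x"
        proof (cases "x \<in> set c")
          case True
          then show ?thesis using x const[OF True] by (simp only: restrict_apply if_True)
        next
          case False
          then have "x \<in> ?T" using x by simp
          then show ?thesis using x False by (simp only: restrict_apply if_True if_False)
        qed
      qed simp
    qed
    show "\<forall>p\<in>{..<n} \<times> ?A cs. (?E p (hd c), restrict (?E p) ?T) = p"
    proof
      fix p assume p: "p \<in> {..<n} \<times> ?A cs"
      obtain k f where kf: "p = (k, f)" by (cases p)
      have "f \<in> ?T \<rightarrow>\<^sub>E {..<n}" using p unfolding kf by blast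
      then have "f \<in> extensional ?T" by (simp add: PiE_def)
      then have "restrict (?E p) ?T = f"
        unfolding kf prod.case
      proof (intro extensionalityI[where A = ?T])
        fix x assume x: "x \<in> ?T"
        then have "x \<notin> set c" "x \<in> ?U" using disj by auto
        then show "restrict (restrict (\<lambda>x. if x \<in> set c then k else f x) ?U) ?T x = f x"
          using x by simp
      qed simp
      moreover have "?E p (hd c) = k" using h by (simp add: kf)
      ultimately show "(?E p (hd c), restrict (?E p) ?T) = p" by (simp add: kf)
    qed
    show "(\<lambda>f. (f (hd c), restrict f ?T)) ` ?A (c # cs) \<subseteq> {..<n} \<times> ?A cs"
    proof
      fix p assume "p \<in> (\<lambda>f. (f (hd c), restrict f ?T)) ` ?A (c # cs)"
      then obtain f where p: "p = (f (hd c), restrict f ?T)" and f: "f \<in> ?A (c # cs)" by blast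
      have "f \<in> ?U \<rightarrow>\<^sub>E {..<n}" using f by blast
      then have v: "f x < n" if "x \<in> ?U" for x using that by (auto simp: PiE_iff)
      have "restrict f ?T \<in> ?T \<rightarrow>\<^sub>E {..<n}" using v by simp
      moreover have "\<forall>c\<in>set cs. \<forall>x\<in>set c. \<forall>y\<in>set c. restrict f ?T x = restrict f ?T y"
      proof (intro ballI)
        fix c' x y assume *: "c' \<in> set cs" "x \<in> set c'" "y \<in> set c'"
        then have "f x = f y" using f unfolding list.set by blast
        moreover have "x \<in> ?T" "y \<in> ?T" using * by auto
        ultimately show "restrict f ?T x = restrict f ?T y" by simp
      qed
      moreover have "f (hd c) < n" using v[of "hd c"] h by simp
      ultimately show "p \<in> {..<n} \<times> ?A cs" unfolding p by blast
    qed
    show "?E ` ({..<n} \<times> ?A cs) \<subseteq> ?A (c # cs)"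
    proof
      fix g assume "g \<in> ?E ` ({..<n} \<times> ?A cs)"
      then obtain p where p: "p \<in> {..<n} \<times> ?A cs" "g = ?E p" by blast
      obtain k f where kf: "p = (k, f)" by (cases p)
      have g: "g = restrict (\<lambda>x. if x \<in> set c then k else f x) ?U" using p(2) by (simp add: kf)
      have k: "k < n" and f: "f \<in> ?A cs" using p(1) unfolding kf by blast+
      have "f \<in> ?T \<rightarrow>\<^sub>E {..<n}" using f by blast
      then have v: "f x < n" if "x \<in> ?T" for x using that by (auto simp: PiE_iff)
      have "g \<in> ?U \<rightarrow>\<^sub>E {..<n}" unfolding g restrict_PiE_iff using k v by auto
      moreover have "g x = g y" if *: "c' \<in> set (c # cs)" "x \<in> set c'" "y \<in> set c'" for c' x y
      proof (cases "c' = c")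
        case True
        then show ?thesis using * unfolding g by simp
      next
        case False
        then have c': "c' \<in> set cs" using * by simp
        have "x \<in> ?T" "y \<in> ?T" using c' * by auto
        moreover from this have "x \<notin> set c" "y \<notin> set c" using disj by auto
        moreover have "f x = f y" using f c' * by blast
        ultimately show ?thesis unfolding g by simp
      qed
      ultimately show "g \<in> ?A (c # cs)" by blast
    qed
  qed
  then have "card (?A (c # cs)) = card ({..<n} \<times> ?A cs)" by (rule bij_betw_same_card)
  also have "\<dots> = n * n ^ length cs" using Cons by (simp add: card_cartesian_product)
  finally show ?case by simp
qed

lemma card_invariant_colourings:
  assumes cs: "\<forall>c\<in>set cs. c \<noteq> []" "distinct (concat cs)" "set (concat cs) = S"
    and \<sigma>: "\<sigma> = foldr (\<circ>) (map cycle_of_list cs) id" "\<sigma> permutes S"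
  shows "card {f \<in> S \<rightarrow>\<^sub>E {..<n}. \<sigma> \<in> stab S f} = n ^ length cs"
proof -
  have "\<sigma> \<in> stab S f \<longleftrightarrow> (\<forall>c\<in>set cs. \<forall>x\<in>set c. \<forall>y\<in>set c. f x = f y)" for f :: "nat \<Rightarrow> nat"
  proof -
    have "\<sigma> \<in> stab S f \<longleftrightarrow> (\<forall>c\<in>set cs. \<forall>x\<in>set c. f (\<sigma> x) = f x)"
      using \<sigma>(2) cs(3) by (auto simp: stab_def)
    also have "\<dots> \<longleftrightarrow> (\<forall>c\<in>set cs. \<forall>x\<in>set c. f (cycle_of_list c x) = f x)"
      using foldr_cycles_apply[OF cs(2)] unfolding \<sigma>(1) by simp
    also have "\<dots> \<longleftrightarrow> (\<forall>c\<in>set cs. \<forall>x\<in>set c. \<forall>y\<in>set c. f x = f y)"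
    proof (rule ball_cong[OF refl])
      fix c assume "c \<in> set cs"
      then have "distinct c" using cs(2) by (simp add: distinct_concat_iff)
      then show "(\<forall>x\<in>set c. f (cycle_of_list c x) = f x) \<longleftrightarrow> (\<forall>x\<in>set c. \<forall>y\<in>set c. f x = f y)"
        by (rule cycle_of_list_invariant_iff)
    qed
    finally show ?thesis .
  qed
  then have "{f \<in> S \<rightarrow>\<^sub>E {..<n}. \<sigma> \<in> stab S f} =
      {f \<in> S \<rightarrow>\<^sub>E {..<n}. \<forall>c\<in>set cs. \<forall>x\<in>set c. \<forall>y\<in>set c. f x = f y}" by blast
  then show ?thesis using card_constant_on_blocks[OF cs(1,2), of n] by (simp only: cs(3))
qed

section \<open>From sums over partitions to the matrix and the vector\<close>

lemma partitions_list:
  "set (partitions_list d) = partitions_of d" "distinct (partitions_list d)"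
  using finite_partitions_of[of d] by (simp_all add: partitions_list_def)

lemma sum_partitions_list:
  "(\<Sum>j<length (partitions_list d). h (partitions_list d ! j)) = (\<Sum>\<mu>\<in>partitions_of d. h \<mu>)"
proof -
  have "(\<Sum>j<length (partitions_list d). h (partitions_list d ! j)) = sum_list (map h (partitions_list d))"
    by (simp add: sum_list_sum_nth atLeast0LessThan)
  also have "\<dots> = sum h (set (partitions_list d))"
    by (rule sum_list_distinct_conv_sum_set[OF partitions_list(2)])
  finally show ?thesis by (simp only: partitions_list(1))
qed

text \<open>Tested against Schur functions, the symmetric matrix acts on them instead of on the
  characters, and there it multiplies the alphabet. Young's rule before and after translates this
  into the factor \<open>q\<close> gained by fixed colourings.\<close>

lemma a_coeff_character:
  assumes n: "n > 0" and \<sigma>: "\<sigma> permutes {1..d}" and \<alpha>: "\<alpha> \<in> partitions_of d"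
    and q: "card {c \<in> {1..d} \<rightarrow>\<^sub>E {..<n}. \<sigma> \<in> stab {1..d} c} = q"
  shows "(\<Sum>\<mu>\<in>partitions_of d. of_int (a_coeff n \<alpha> \<mu>) * irrep_character \<mu> \<sigma>) =
    (of_nat q * irrep_character \<alpha> \<sigma> :: 'a::field_char_0)"
proof -
  let ?I = "partitions_of d"
  let ?X = "\<lambda>\<mu>. irrep_character \<mu> \<sigma> :: 'a"
  define x where "x \<alpha> = (\<Sum>\<mu>\<in>?I. of_int (a_coeff n \<alpha> \<mu>) * ?X \<mu>) - of_nat q * ?X \<alpha>" for \<alpha>
  have "x \<alpha> = 0"
  proof (rule schur_coeffs_unique[OF _ \<alpha>])
    fix \<beta> assume "\<beta> \<in> ?I"
    then have sz: "size (row_content \<beta>) = d" by (simp add: size_row_content partitions_of_def)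
    let ?M = "row_content \<beta>"
    let ?N = "{N. image_mset (\<lambda>k. k div n) N = ?M}"
    have szN: "size N = d" if "N \<in> ?N" for N using that sz by (metis (mono_tags, lifting) mem_Collect_eq size_image_mset)
    \<comment> \<open>Symmetry of the coefficients moves the matrix from the characters to the Schur
      functions.\<close>
    have "(\<Sum>\<alpha>\<in>?I. (\<Sum>\<mu>\<in>?I. of_int (a_coeff n \<alpha> \<mu>) * ?X \<mu>) * of_int (schur \<alpha> ?M)) =
        (\<Sum>\<alpha>\<in>?I. \<Sum>\<mu>\<in>?I. ?X \<mu> * of_int (a_coeff n \<mu> \<alpha> * schur \<alpha> ?M))"
      unfolding sum_distrib_right by (intro sum.cong refl) (subst a_coeff_commute, simp)
    also have "\<dots> = (\<Sum>\<mu>\<in>?I. ?X \<mu> * of_int (\<Sum>\<alpha>\<in>?I. a_coeff n \<mu> \<alpha> * schur \<alpha> ?M))"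
      by (subst sum.swap) (simp add: sum_distrib_left)
    also have "\<dots> = (\<Sum>\<mu>\<in>?I. ?X \<mu> * of_int (\<Sum>N\<in>?N. schur \<mu> N))"
      by (rule sum.cong[OF refl]) (use schur_multiply_alphabet[OF n, of _ ?M] sz in simp)
    also have "\<dots> = (\<Sum>N\<in>?N. \<Sum>\<mu>\<in>?I. of_int (schur \<mu> N) * ?X \<mu>)"
      by (subst sum.swap) (simp add: sum_distrib_left mult.commute)
    also have "\<dots> = (\<Sum>N\<in>?N. of_nat (fixed_colourings {1..d} N \<sigma>))"
      by (rule sum.cong[OF refl]) (simp only: young_rule[OF \<sigma> szN])
    also have "\<dots> = of_nat (\<Sum>N\<in>?N. fixed_colourings {1..d} N \<sigma>)" by simp
    also have "\<dots> = of_nat q * of_nat (fixed_colourings {1..d} ?M \<sigma>)"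
      using sum_fixed_colourings_div[OF _ \<sigma> n, of ?M] q by simp
    also have "\<dots> = (\<Sum>\<alpha>\<in>?I. (of_nat q * ?X \<alpha>) * of_int (schur \<alpha> ?M))"
      unfolding young_rule[OF \<sigma> sz] by (simp add: sum_distrib_left mult_ac)
    finally show "(\<Sum>\<alpha>\<in>?I. x \<alpha> * of_int (schur \<alpha> ?M)) = 0"
      by (simp add: x_def left_diff_distrib sum_subtractf)
  qed
  then show ?thesis by (simp add: x_def)
qed

text \<open>An eigenvector has to be nonzero. The colouring with a single colour is fixed by every
  permutation, so Young's rule writes a nonzero number as a combination of the character
  values.\<close>

lemma ex_nonzero_character:
  assumes \<sigma>: "\<sigma> permutes {1..d}"
  shows "\<exists>\<alpha>\<in>partitions_of d. irrep_character \<alpha> \<sigma> \<noteq> (0 :: 'a::field_char_0)"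
proof (rule ccontr)
  assume "\<not> ?thesis"
  then have z: "irrep_character \<alpha> \<sigma> = (0 :: 'a)" if "\<alpha> \<in> partitions_of d" for \<alpha> using that by blast
  have "(of_nat (fixed_colourings {1..d} (replicate_mset d (0::nat)) \<sigma>) :: 'a) =
      (\<Sum>\<alpha>\<in>partitions_of d. of_int (schur \<alpha> (replicate_mset d (0::nat))) * irrep_character \<alpha> \<sigma>)"
    by (rule young_rule[OF \<sigma>]) simp
  also have "\<dots> = 0" by (rule sum.neutral) (simp add: z)
  finally have 0: "(of_nat (fixed_colourings {1..d} (replicate_mset d (0::nat)) \<sigma>) :: 'a) = 0" .
  let ?h = "restrict (\<lambda>_. 0 :: nat) {1..d}"
  have "image_mset ?h (mset_set {1..d}) = image_mset (\<lambda>_. 0) (mset_set {1..d})"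
    by (rule image_mset_cong) simp
  then have "?h \<in> colourings {1..d} (replicate_mset d (0::nat))"
    by (simp add: colourings_def image_mset_const_eq)
  moreover have "\<sigma> \<in> stab {1..d} ?h"
    using \<sigma> permutes_in_image[OF \<sigma>] by (simp add: stab_def)
  ultimately have "fixed_colourings {1..d} (replicate_mset d (0::nat)) \<sigma> \<noteq> 0"
    unfolding fixed_colourings_def using finite_colourings[of "{1..d}" "replicate_mset d (0::nat)"] by auto
  then show False using 0 by simp
qed

theorem theorem9p7:
  fixes n d p :: nat
    and \<sigma> :: "nat \<Rightarrow> nat"
    and cs :: "nat list list"
  assumes "n > 0" and "d > 0"
    and "\<sigma> \<in> carrier (sym_group d)"
    and "length cs = p"
    and "\<forall>c\<in>set cs. c \<noteq> []"
    and "distinct (concat cs)"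
    and "set (concat cs) = {1..d}"
    and "\<sigma> = foldr (\<circ>) (map cycle_of_list cs) id"
  shows "eigenvector (map_mat of_int (A_matrix n d))
           (character_vec d \<sigma> :: 'a::{alg_closed_field, field_char_0} vec)
           (of_nat n ^ p)"
proof -
  let ?ps = "partitions_list d"
  let ?A = "map_mat of_int (A_matrix n d) :: 'a mat"
  let ?v = "character_vec d \<sigma> :: 'a vec"
  have \<sigma>: "\<sigma> permutes {1..d}" using assms(3) by (simp add: sym_group_carrier)
  have v: "dim_vec ?v = length ?ps" "\<And>i. i < length ?ps \<Longrightarrow> ?v $ i = irrep_character (?ps ! i) \<sigma>"
    by (simp_all add: character_vec_def Let_def)
  have A: "dim_row ?A = length ?ps" "dim_col ?A = length ?ps"
    "\<And>i j. i < length ?ps \<Longrightarrow> j < length ?ps \<Longrightarrow> ?A $$ (i, j) = of_int (a_coeff n (?ps ! i) (?ps ! j))"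
    by (simp_all add: A_matrix_def Let_def)
  \<comment> \<open>The origin of the eigenvalue: an invariant colouring with \<open>n\<close>
    colours is a free choice of one colour per cycle.\<close>
  have q: "card {c \<in> {1..d} \<rightarrow>\<^sub>E {..<n}. \<sigma> \<in> stab {1..d} c} = n ^ p"
    using card_invariant_colourings[OF assms(5-8) \<sigma>] assms(4) by simp
  have "?A *\<^sub>v ?v = of_nat n ^ p \<cdot>\<^sub>v ?v"
  proof (rule eq_vecI)
    fix i assume "i < dim_vec (of_nat n ^ p \<cdot>\<^sub>v ?v)"
    then have i: "i < length ?ps" by (simp add: v)
    then have \<alpha>: "?ps ! i \<in> partitions_of d" using partitions_list(1) nth_mem by blast
    have "(?A *\<^sub>v ?v) $ i = (\<Sum>j<length ?ps. of_int (a_coeff n (?ps ! i) (?ps ! j)) * irrep_character (?ps ! j) \<sigma>)"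
    proof -
      have "(?A *\<^sub>v ?v) $ i = row ?A i \<bullet> ?v" using i by (intro index_mult_mat_vec) (simp only: A(1))
      also have "\<dots> = (\<Sum>j\<in>{0..<length ?ps}. row ?A i $ j * ?v $ j)" by (simp only: scalar_prod_def v(1))
      also have "\<dots> = (\<Sum>j<length ?ps. of_int (a_coeff n (?ps ! i) (?ps ! j)) * irrep_character (?ps ! j) \<sigma>)"
      proof (rule sum.cong)
        fix j assume "j \<in> {..<length ?ps}"
        then have j: "j < length ?ps" by simp
        have "row ?A i $ j = ?A $$ (i, j)" by (rule index_row) (simp_all only: A(1,2) i j)
        then show "row ?A i $ j * ?v $ j = of_int (a_coeff n (?ps ! i) (?ps ! j)) * irrep_character (?ps ! j) \<sigma>"
          by (simp only: A(3)[OF i j] v(2)[OF j])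
      qed auto
      finally show ?thesis .
    qed
    also have "\<dots> = (\<Sum>\<mu>\<in>partitions_of d. of_int (a_coeff n (?ps ! i) \<mu>) * irrep_character \<mu> \<sigma>)"
      by (rule sum_partitions_list)
    also have "\<dots> = of_nat (n ^ p) * irrep_character (?ps ! i) \<sigma>"
      by (rule a_coeff_character[OF assms(1) \<sigma> \<alpha> q])
    finally show "(?A *\<^sub>v ?v) $ i = (of_nat n ^ p \<cdot>\<^sub>v ?v) $ i"
      using i by (simp only: index_smult_vec v of_nat_power)
  qed (simp only: dim_mult_mat_vec index_smult_vec v(1) A(1))
  moreover have "?v \<noteq> 0\<^sub>v (dim_row ?A)"
  proof
    assume 0: "?v = 0\<^sub>v (dim_row ?A)"
    obtain \<alpha> where \<alpha>: "\<alpha> \<in> partitions_of d" "irrep_character \<alpha> \<sigma> \<noteq> (0 :: 'a)"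
      using ex_nonzero_character[OF \<sigma>] by blast
    then obtain i where i: "i < length ?ps" "?ps ! i = \<alpha>"
      using partitions_list(1) by (metis in_set_conv_nth)
    have "?v $ i = 0" unfolding 0 A(1) using i(1) by (rule index_zero_vec)
    then show False using \<alpha>(2) v(2)[OF i(1)] i(2) by simp
  qed
  ultimately show ?thesis
    unfolding eigenvector_def A(1) using carrier_vecI[OF v(1)] by blast
qed

end
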